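(* Let $\mathcal{M}$ be a von Neumann algebra, let $M\subseteq\mathcal{M}_{sa}$ be a nonempty set of positive operators which is bounded in $(\mathcal{M}_{sa},\preceq)$, and let $\mathcal{F}$ be the set of all nonempty finite subsets of $M$. Then $$\sup_{x\in M}x=\operatorname{s-lim}_{F\in\mathcal{F}}\ \operatorname{s-lim}_{n\in\mathbb{N}}\left(\sum_{x\in F}x^n\right)^{\frac1n}=\operatorname{s-lim}_{F\in\mathcal{F}}\ \operatorname{s-lim}_{n\in\mathbb{N}}\left(\sum_{x\in F}\frac{x^n}{|F|}\right)^{\frac1n}.$$ If, in addition, $M$ has an invertible positive lower bound in $(\mathcal{M}_{sa},\preceq)$, then $$\inf_{x\in M}x=\operatorname{s-lim}_{F\in\mathcal{F}}\ \operatorname{s-lim}_{n\in\mathbb{N}}\left(\sum_{x\in F}x^{-n}\right)^{-\frac1n}=\operatorname{s-lim}_{F\in\mathcal{F}}\ \operatorname{s-lim}_{n\in\mathbb{N}}\left(\sum_{x\in F}\frac{x^{-n}}{|F|}\right)^{-\frac1n}.$$ The supremum and the infimum are taken in $(\mathcal{M}_{sa},\preceq)$.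
   Context: A von Neumann algebra $\mathcal{M}$ is a strongly operator closed C*-subalgebra of $\mathcal{B}(\mathcal{H})$, $\mathcal{H}$ a complex Hilbert space; $\mathcal{M}_{sa}$ is its self-adjoint part. For $x\in\mathcal{M}_{sa}$, $(E^x_\lambda)_{\lambda\in\mathbb{R}}$ denotes its (right-continuous) spectral family: $E^x_\lambda$ is the spectral projection of $x$ for $(-\infty,\lambda]$. The spectral order $\preceq$ on $\mathcal{M}_{sa}$ is defined by: $x\preceq y$ iff $E^y_\lambda\le E^x_\lambda$ for every $\lambda\in\mathbb{R}$. The poset $(\mathcal{M}_{sa},\preceq)$ is a conditionally complete lattice (every nonempty order bounded subset has a supremum and an infimum). $\operatorname{s-lim}$ is the limit in the strong operator topology; $\mathcal{F}$ is directed by inclusion, and $|F|$ is the cardinality of $F$. *)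

theory Defs
  imports "HOL-Analysis.Analysis" "HOL-Algebra.Order"
begin

text \<open>
  Complex Hilbert spaces. The inner product is linear in the first argument, and the norm,
  metric and topology of the type are the ones it induces (\<^class>\<open>banach\<close> supplies completeness).
  Positivity and definiteness of the inner product are contained in the last axiom.
\<close>

class chilbert_space = banach +
  fixes scaleC :: "complex \<Rightarrow> 'a \<Rightarrow> 'a" (infixr \<open>*\<^sub>C\<close> 75)
    and cinner :: "'a \<Rightarrow> 'a \<Rightarrow> complex"
  assumes scaleC_add_right: "c *\<^sub>C (x + y) = c *\<^sub>C x + c *\<^sub>C y"
    and scaleC_add_left: "(c + d) *\<^sub>C x = c *\<^sub>C x + d *\<^sub>C x"
    and scaleC_scaleC: "c *\<^sub>C d *\<^sub>C x = (c * d) *\<^sub>C x"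
    and scaleC_one: "1 *\<^sub>C x = x"
    and scaleR_eq_scaleC: "r *\<^sub>R x = complex_of_real r *\<^sub>C x"
    and cinner_commute: "cinner x y = cnj (cinner y x)"
    and cinner_add_left: "cinner (x + y) z = cinner x z + cinner y z"
    and cinner_scaleC_left: "cinner (c *\<^sub>C x) y = c * cinner x y"
    and cinner_self: "cinner x x = complex_of_real ((norm x)\<^sup>2)"

instantiation complex :: chilbert_space
begin

definition scaleC_complex :: "complex \<Rightarrow> complex \<Rightarrow> complex"
  where "scaleC_complex c x = c * x"

definition cinner_complex :: "complex \<Rightarrow> complex \<Rightarrow> complex"
  where "cinner_complex x y = x * cnj y"

instance
  by standard
    (simp_all add: scaleC_complex_def cinner_complex_def algebra_simps scaleR_conv_of_real
      complex_norm_square del: of_real_power)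

end

text \<open>
  Operators are represented by the library's real bounded linear maps; those lying in a
  \<open>C\<close>*-algebra are required to be complex linear. The adjoint is a relation: \<open>is_adjoint a b\<close>
  says that \<open>b\<close> is the adjoint of \<open>a\<close>. It forces both maps to be complex linear.
\<close>

definition complex_linear :: "('h::chilbert_space \<Rightarrow>\<^sub>L 'h) \<Rightarrow> bool"
  where "complex_linear a \<longleftrightarrow> (\<forall>c \<xi>. a (c *\<^sub>C \<xi>) = c *\<^sub>C a \<xi>)"

definition is_adjoint :: "('h::chilbert_space \<Rightarrow>\<^sub>L 'h) \<Rightarrow> ('h \<Rightarrow>\<^sub>L 'h) \<Rightarrow> bool"
  where "is_adjoint a b \<longleftrightarrow> (\<forall>\<xi> \<eta>. cinner (a \<xi>) \<eta> = cinner \<xi> (b \<eta>))"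

definition selfadjoint :: "('h::chilbert_space \<Rightarrow>\<^sub>L 'h) \<Rightarrow> bool"
  where "selfadjoint a \<longleftrightarrow> is_adjoint a a"

definition positive_op :: "('h::chilbert_space \<Rightarrow>\<^sub>L 'h) \<Rightarrow> bool"
  where "positive_op a \<longleftrightarrow> selfadjoint a \<and> (\<forall>\<xi>. 0 \<le> Re (cinner (a \<xi>) \<xi>))"

definition op_le :: "('h::chilbert_space \<Rightarrow>\<^sub>L 'h) \<Rightarrow> ('h \<Rightarrow>\<^sub>L 'h) \<Rightarrow> bool"
  where "op_le a b \<longleftrightarrow> positive_op (b - a)"

definition is_projection :: "('h::chilbert_space \<Rightarrow>\<^sub>L 'h) \<Rightarrow> bool"
  where "is_projection p \<longleftrightarrow> selfadjoint p \<and> p o\<^sub>L p = p"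

definition op_scaleC :: "complex \<Rightarrow> ('h::chilbert_space \<Rightarrow>\<^sub>L 'h) \<Rightarrow> ('h \<Rightarrow>\<^sub>L 'h)"
  where "op_scaleC c a = Blinfun (\<lambda>\<xi>. c *\<^sub>C a \<xi>)"

lemma norm_scaleC: "norm (c *\<^sub>C x) = cmod c * norm (x::'h::chilbert_space)"
proof -
  have "cinner (c *\<^sub>C x) (c *\<^sub>C x) = c * cnj c * cinner x x"
    by (metis cinner_commute cinner_scaleC_left complex_cnj_mult mult.assoc)
  also have "\<dots> = complex_of_real ((cmod c)\<^sup>2 * (norm x)\<^sup>2)"
    by (simp only: complex_norm_square[symmetric] cinner_self of_real_mult)
  finally have "(norm (c *\<^sub>C x))\<^sup>2 = (cmod c * norm x)\<^sup>2"
    unfolding cinner_self of_real_eq_iff power_mult_distrib .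
  then show ?thesis by simp
qed

lemma op_scaleC_apply: "op_scaleC c a \<xi> = c *\<^sub>C a \<xi>" for a :: "'h::chilbert_space \<Rightarrow>\<^sub>L 'h"
proof -
  have "bounded_linear ((*\<^sub>C) c :: 'h \<Rightarrow> 'h)"
    by (rule bounded_linear_intro[where K = "cmod c"])
      (simp_all add: scaleC_add_right scaleR_eq_scaleC scaleC_scaleC norm_scaleC mult.commute)
  then have "bounded_linear (\<lambda>\<xi>. c *\<^sub>C a \<xi>)"
    using blinfun.bounded_linear_right bounded_linear_compose by blast
  then show ?thesis
    by (simp add: op_scaleC_def bounded_linear_Blinfun_apply)
qed

definition op_power :: "('h::chilbert_space \<Rightarrow>\<^sub>L 'h) \<Rightarrow> nat \<Rightarrow> ('h \<Rightarrow>\<^sub>L 'h)"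
  where "op_power a n = ((o\<^sub>L) a ^^ n) id_blinfun"

text \<open>The \<open>n\<close>-th root of a positive operator, for \<open>n \<ge> 1\<close>: its unique positive \<open>n\<close>-th root.\<close>

definition op_root :: "nat \<Rightarrow> ('h::chilbert_space \<Rightarrow>\<^sub>L 'h) \<Rightarrow> ('h \<Rightarrow>\<^sub>L 'h)"
  where "op_root n a = (THE b. positive_op b \<and> op_power b n = a)"

definition cstar_subalgebra :: "('h::chilbert_space \<Rightarrow>\<^sub>L 'h) set \<Rightarrow> bool"
  where "cstar_subalgebra A \<longleftrightarrow>
    (\<forall>a\<in>A. complex_linear a) \<and>
    0 \<in> A \<and>
    (\<forall>a\<in>A. \<forall>b\<in>A. a + b \<in> A) \<and>
    (\<forall>c. \<forall>a\<in>A. op_scaleC c a \<in> A) \<and>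
    (\<forall>a\<in>A. \<forall>b\<in>A. a o\<^sub>L b \<in> A) \<and>
    (\<forall>a\<in>A. \<exists>b\<in>A. is_adjoint a b) \<and>
    closed A"

text \<open>
  The identity of the Hilbert space is not required to belong to a von Neumann algebra. Inverses
  are therefore taken inside the algebra, with respect to its own unit (the identity operator
  when the algebra contains it).
\<close>

definition von_neumann_algebra :: "('h::chilbert_space \<Rightarrow>\<^sub>L 'h) set \<Rightarrow> bool"
  where "von_neumann_algebra A \<longleftrightarrow> cstar_subalgebra A \<and> closedin strong_operator_topology A"

definition sa_part :: "('h::chilbert_space \<Rightarrow>\<^sub>L 'h) set \<Rightarrow> ('h \<Rightarrow>\<^sub>L 'h) set"
  where "sa_part A = {a \<in> A. selfadjoint a}"

definition is_unit_of :: "('h::chilbert_space \<Rightarrow>\<^sub>L 'h) set \<Rightarrow> ('h \<Rightarrow>\<^sub>L 'h) \<Rightarrow> bool"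
  where "is_unit_of A e \<longleftrightarrow> e \<in> A \<and> (\<forall>a\<in>A. e o\<^sub>L a = a \<and> a o\<^sub>L e = a)"

definition is_inverse_in :: "('h::chilbert_space \<Rightarrow>\<^sub>L 'h) set \<Rightarrow> ('h \<Rightarrow>\<^sub>L 'h) \<Rightarrow> ('h \<Rightarrow>\<^sub>L 'h) \<Rightarrow> bool"
  where "is_inverse_in A a b \<longleftrightarrow>
    a \<in> A \<and> b \<in> A \<and> is_unit_of A (a o\<^sub>L b) \<and> is_unit_of A (b o\<^sub>L a)"

definition invertible_in :: "('h::chilbert_space \<Rightarrow>\<^sub>L 'h) set \<Rightarrow> ('h \<Rightarrow>\<^sub>L 'h) \<Rightarrow> bool"
  where "invertible_in A a \<longleftrightarrow> (\<exists>b. is_inverse_in A a b)"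

definition inverse_in :: "('h::chilbert_space \<Rightarrow>\<^sub>L 'h) set \<Rightarrow> ('h \<Rightarrow>\<^sub>L 'h) \<Rightarrow> ('h \<Rightarrow>\<^sub>L 'h)"
  where "inverse_in A a = (THE b. is_inverse_in A a b)"

text \<open>
  The spectral family of a bounded self-adjoint operator \<open>x\<close>: the unique right-continuous bounded
  resolution of the identity \<open>E\<close> with \<open>x = \<integral> \<lambda> dE\<^sub>\<lambda>\<close>. The spectral integral is taken in the
  weak sense, with the Lebesgue-Stieltjes measure of \<open>\<lambda> \<mapsto> \<langle>E\<^sub>\<lambda> \<xi>, \<xi>\<rangle>\<close> for each vector \<open>\<xi>\<close>.
\<close>

definition is_spectral_family ::
    "('h::chilbert_space \<Rightarrow>\<^sub>L 'h) \<Rightarrow> (real \<Rightarrow> ('h \<Rightarrow>\<^sub>L 'h)) \<Rightarrow> bool"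
  where "is_spectral_family x E \<longleftrightarrow>
    (\<forall>l. is_projection (E l)) \<and>
    (\<forall>l m. l \<le> m \<longrightarrow> op_le (E l) (E m)) \<and>
    (\<forall>l. limitin strong_operator_topology E (E l) (at_right l)) \<and>
    (\<exists>r. (\<forall>l < - r. E l = 0) \<and> (\<forall>l > r. E l = id_blinfun)) \<and>
    (\<forall>\<xi>. has_bochner_integral (interval_measure (\<lambda>l. Re (cinner (E l \<xi>) \<xi>))) (\<lambda>l. l)
            (Re (cinner (x \<xi>) \<xi>)))"

definition spectral_family :: "('h::chilbert_space \<Rightarrow>\<^sub>L 'h) \<Rightarrow> real \<Rightarrow> ('h \<Rightarrow>\<^sub>L 'h)"
  where "spectral_family x = (THE E. is_spectral_family x E)"

definition spectral_le :: "('h::chilbert_space \<Rightarrow>\<^sub>L 'h) \<Rightarrow> ('h \<Rightarrow>\<^sub>L 'h) \<Rightarrow> bool"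
  where "spectral_le x y \<longleftrightarrow> (\<forall>l. op_le (spectral_family y l) (spectral_family x l))"

definition spectral_poset :: "('h::chilbert_space \<Rightarrow>\<^sub>L 'h) set \<Rightarrow> ('h \<Rightarrow>\<^sub>L 'h) gorder"
  where "spectral_poset A = \<lparr>carrier = sa_part A, eq = (=), le = spectral_le\<rparr>"

text \<open>
  \<open>iterated_slim X f s\<close>: the inner strong limit of \<open>f F n\<close> as \<open>n\<close> tends to infinity exists for every
  nonempty finite \<open>F \<subseteq> X\<close>, and these limits converge strongly to \<open>s\<close> along the nonempty finite
  subsets of \<open>X\<close> directed by inclusion. For nonempty \<open>X\<close> the filter below ignores \<open>F = {}\<close>.
\<close>

definition iterated_slim ::
    "('h::chilbert_space \<Rightarrow>\<^sub>L 'h) set \<Rightarrow> (('h \<Rightarrow>\<^sub>L 'h) set \<Rightarrow> nat \<Rightarrow> ('h \<Rightarrow>\<^sub>L 'h)) \<Rightarrow> ('h \<Rightarrow>\<^sub>L 'h) \<Rightarrow> bool"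
  where "iterated_slim X f s \<longleftrightarrow>
    (\<exists>g. (\<forall>F. finite F \<and> F \<noteq> {} \<and> F \<subseteq> X \<longrightarrow>
            limitin strong_operator_topology (f F) (g F) sequentially) \<and>
         limitin strong_operator_topology g s (finite_subsets_at_top X))"

end

theory Submission
  imports Defs
begin

text \<open>
  The key is a description of spectral subspaces by growth: for a positive operator \<open>x\<close> with spectral
  family \<open>E\<close> and \<open>l \<ge> 0\<close>, a vector \<open>u\<close> lies in the range of \<open>E l\<close> iff \<open>\<langle>x\<^sup>n u, u\<rangle> \<le> C * l\<^sup>n\<close> for some
  \<open>C\<close> and all \<open>n\<close> (\<open>spectral_subspace_iff_growth\<close>). Its quantitative halves are
  \<open>\<langle>x\<^sup>n u, u\<rangle> \<le> l\<^sup>n * (norm u)\<^sup>2\<close> on the range of \<open>E l\<close> (\<open>power_form_upper\<close>) and the Chebyshev estimate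
  \<open>l\<^sup>n * (norm (u - E l u))\<^sup>2 \<le> \<langle>x\<^sup>n u, u\<rangle>\<close> for all \<open>u\<close> (\<open>power_form_lower\<close>).

  Supremum of a finite family. The spectral family of the supremum \<open>s\<close> of \<open>F\<close> in the spectral order
  is \<open>G l = inf E\<^sup>x\<^sub>l\<close>, the meet over \<open>x \<in> F\<close>. Put \<open>y\<^sub>n = (\<Sum>x\<in>F. x\<^sup>n)\<^sup>1\<^sup>/\<^sup>n\<close>, so that
  \<open>\<langle>y\<^sub>n\<^sup>n u, u\<rangle> = (\<Sum>x\<in>F. \<langle>x\<^sup>n u, u\<rangle>)\<close>. If \<open>u\<close> is in the range of \<open>G l\<close>, the sum is at most
  \<open>card F * l\<^sup>n * (norm u)\<^sup>2\<close>, and the Chebyshev estimate for \<open>y\<^sub>n\<close> shows that the component of \<open>u\<close>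
  above \<open>m > l\<close> tends to zero. Conversely \<open>\<langle>x\<^sup>n w, w\<rangle> \<le> \<langle>y\<^sub>n\<^sup>n w, w\<rangle> \<le> l\<^sup>n * (norm w)\<^sup>2\<close> for \<open>w\<close> in the
  spectral subspace of \<open>y\<^sub>n\<close> for \<open>l\<close>, so the Chebyshev estimate for \<open>x\<close> shows that the spectral
  projection of \<open>y\<^sub>n\<close> for \<open>l\<close> tends to zero strongly on the complement of \<open>E\<^sup>x\<^sub>m\<close>, for every \<open>x \<in> F\<close>
  and \<open>m > l\<close>. The vectors on which these projections tend to zero form a closed subspace, and the
  complements of the \<open>E\<^sup>x\<^sub>m\<close> span a dense subspace of the complement of \<open>G m\<close>
  (\<open>meet_complement_in\<close>). Two families of spectral projections that are interlaced asymptotically in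
  this way belong to strongly convergent operators: cut the spectrum of \<open>s\<close> into \<open>N\<close> pieces and
  approximate on each piece (\<open>strong_limit_if_spectral_limit\<close>). Since \<open>card F\<^sup>1\<^sup>/\<^sup>n\<close> tends to one, the
  averages have the same limit.
  The passage from finite subsets to the whole set is another instance of the same convergence
  criterion (\<open>spectral_joins_tendsto\<close>), and the limits stay in the algebra because it is strongly
  closed.

  Infimum. Inversion reverses the spectral order on positive invertible elements. With \<open>w\<close> the inverse
  of \<open>x\<close>, the complement of \<open>E\<^sup>x\<^sub>m\<close> lies in the spectral subspace of \<open>w\<close> for \<open>1 / m\<close>
  (\<open>spectral_complement_inverse\<close>), and that subspace is orthogonal to the spectral subspaces of \<open>x\<close>
  below \<open>m\<close> (\<open>spectral_inverse_orthogonal\<close>); both are Cauchy-Schwarz estimates on powers. Hence the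
  infimum is the inverse of the supremum of the inverses, and since the inverses involved are
  uniformly bounded, strong convergence passes to them (\<open>inverse_tendsto\<close>).

  Underneath lies the spectral theorem for bounded self-adjoint operators. Polynomials that are
  nonnegative on an interval are evaluated to positive operators (\<open>poly_op_positive\<close>), which yields
  the continuous functional calculus, roots of positive operators with their uniqueness, and positive
  parts; the spectral projection for \<open>l\<close> is the projection onto the kernel of the positive part of
  \<open>x - l\<close>. The Stieltjes integral in the definition of the spectral family is rewritten as an
  ordinary integral of the spectral family itself (\<open>is_spectral_family_formula\<close>), which is linear in
  the family.
\<close>

section \<open>The real inner product and self-adjoint operators\<close>

text \<open>
  The real part of the inner product carries the whole theory: self-adjointness is symmetry for
  \<open>re_inner\<close> together with complex linearity (\<open>selfadjoint_iff\<close>).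
\<close>

definition re_inner :: "'h::chilbert_space \<Rightarrow> 'h \<Rightarrow> real"  (\<open>(\<open>notation=\<open>mixfix re_inner\<close>\<close>\<langle>_,/ _\<rangle>)\<close>)
  where "\<langle>x, y\<rangle> = Re (cinner x y)"

lemma cinner_add_right: "cinner x (y + z) = cinner x y + cinner x (z :: 'h::chilbert_space)"
  by (metis cinner_add_left cinner_commute complex_cnj_add)

lemma cinner_scaleC_right: "cinner x (c *\<^sub>C y) = cnj c * cinner x (y :: 'h::chilbert_space)"
  by (metis cinner_commute cinner_scaleC_left complex_cnj_mult)

lemma re_inner_commute: "\<langle>x, y\<rangle> = \<langle>y, x\<rangle>"
  unfolding re_inner_def by (metis cinner_commute cnj.simps(1))

lemma re_inner_self: "\<langle>x, x\<rangle> = (norm x)\<^sup>2"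
  unfolding re_inner_def by (simp add: cinner_self)

lemma re_inner_add_left': "\<langle>x + y, z\<rangle> = \<langle>x, z\<rangle> + \<langle>y, z\<rangle>"
  unfolding re_inner_def by (simp add: cinner_add_left)

lemma re_inner_add_right': "\<langle>x, y + z\<rangle> = \<langle>x, y\<rangle> + \<langle>x, z\<rangle>"
  unfolding re_inner_def by (simp add: cinner_add_right)

lemma re_inner_scaleR_left': "\<langle>r *\<^sub>R x, y\<rangle> = r * \<langle>x, y\<rangle>"
  unfolding re_inner_def by (simp add: scaleR_eq_scaleC cinner_scaleC_left)

lemma re_inner_scaleR_right': "\<langle>x, r *\<^sub>R y\<rangle> = r * \<langle>x, y\<rangle>"
  by (metis re_inner_commute re_inner_scaleR_left')

lemma form_Cauchy_Schwarz:
  fixes a :: "'h::chilbert_space \<Rightarrow>\<^sub>L 'h"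
  assumes sym: "\<And>x y. \<langle>a x, y\<rangle> = \<langle>x, a y\<rangle>" and pos: "\<And>x. 0 \<le> \<langle>a x, x\<rangle>"
  shows "\<langle>a x, y\<rangle>\<^sup>2 \<le> \<langle>a x, x\<rangle> * \<langle>a y, y\<rangle>"
proof -
  let ?A = "\<langle>a x, x\<rangle>" and ?B = "\<langle>a x, y\<rangle>" and ?C = "\<langle>a y, y\<rangle>"
  have "\<langle>a y, x\<rangle> = ?B" using sym re_inner_commute by metis
  then have *: "0 \<le> ?A + 2 * t * ?B + t * t * ?C" for t
    using pos[of "x + t *\<^sub>R y"]
    by (simp add: blinfun.add_right blinfun.scaleR_right re_inner_add_left' re_inner_add_right'
        re_inner_scaleR_left' re_inner_scaleR_right' algebra_simps)
  show ?thesis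
  proof (cases "?C = 0")
    case True
    have "?B = 0"
    proof (rule ccontr)
      assume "?B \<noteq> 0"
      then show False using *[of "-(?A + 1) / (2 * ?B)"] True by (simp add: field_simps)
    qed
    then show ?thesis using True by simp
  next
    case False
    then have C: "0 < ?C" using pos[of y] by simp
    have "0 \<le> (?A + 2 * (- ?B / ?C) * ?B + (- ?B / ?C) * (- ?B / ?C) * ?C) * ?C"
      using *[of "- ?B / ?C"] C by simp
    also have "\<dots> = ?A * ?C - ?B\<^sup>2" using C by (simp add: field_simps power2_eq_square)
    finally show ?thesis by simp
  qed
qed

lemma re_inner_Cauchy_Schwarz: "\<bar>\<langle>x, y\<rangle>\<bar> \<le> norm x * norm y"
proof -
  have "\<langle>x, y\<rangle>\<^sup>2 \<le> (norm x * norm y)\<^sup>2"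
    using form_Cauchy_Schwarz[of id_blinfun x y]
    by (simp add: re_inner_self power_mult_distrib)
  then show ?thesis by (simp add: abs_le_square_iff[symmetric])
qed

interpretation re_inner: bounded_bilinear re_inner
proof
  show "\<exists>K. \<forall>a b. norm \<langle>a, b\<rangle> \<le> norm a * norm b * K"
    using re_inner_Cauchy_Schwarz by (intro exI[of _ 1]) auto
qed (simp_all add: re_inner_add_left' re_inner_add_right' re_inner_scaleR_left'
      re_inner_scaleR_right')

lemmas re_inner_simps = re_inner.add_left re_inner.add_right re_inner.diff_left re_inner.diff_right
  re_inner.scaleR_left re_inner.scaleR_right re_inner.minus_left re_inner.minus_right

lemmas blinfun_simps = blinfun.add_left blinfun.add_right blinfun.diff_left blinfun.diff_right
  blinfun.scaleR_left blinfun.scaleR_right blinfun.minus_left blinfun.minus_right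

lemma re_inner_i: "\<langle>\<i> *\<^sub>C x, y\<rangle> = - \<langle>x, \<i> *\<^sub>C y\<rangle>"
  unfolding re_inner_def by (simp add: cinner_scaleC_left cinner_scaleC_right)

lemma cinner_eq_re_inner: "cinner x y = Complex \<langle>x, y\<rangle> \<langle>x, \<i> *\<^sub>C y\<rangle>"
  unfolding re_inner_def by (simp add: complex_eq_iff cinner_scaleC_right)

lemma re_inner_ext:
  assumes "\<And>z. \<langle>x, z\<rangle> = \<langle>y, z\<rangle>" shows "x = y"
proof -
  have "\<langle>x - y, x - y\<rangle> = 0" using assms[of "x - y"] by (simp add: re_inner_simps)
  then show ?thesis by (simp add: re_inner_self)
qed

lemma scaleC_conv: "c *\<^sub>C x = Re c *\<^sub>R x + Im c *\<^sub>R (\<i> *\<^sub>C (x::'h::chilbert_space))"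
  by (metis complex_eq scaleC_add_left scaleC_scaleC scaleR_eq_scaleC mult.commute)

lemma complex_linear_iff: "complex_linear a \<longleftrightarrow> (\<forall>x. a (\<i> *\<^sub>C x) = \<i> *\<^sub>C a x)"
  unfolding complex_linear_def
  by (metis blinfun.add_right blinfun.scaleR_right scaleC_conv)

lemma complex_linearI:
  fixes a b :: "'h::chilbert_space \<Rightarrow>\<^sub>L 'h"
  assumes "\<And>x y. cinner (a x) y = cinner x (b y)" shows "complex_linear a"
  unfolding complex_linear_def
proof (intro allI)
  fix c x
  have "cinner (a (c *\<^sub>C x)) z = cinner (c *\<^sub>C a x) z" for z
    by (simp add: assms cinner_scaleC_left)
  then show "a (c *\<^sub>C x) = c *\<^sub>C a x"
    by (intro re_inner_ext) (simp add: re_inner_def)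
qed

lemma is_adjoint_iff:
  "is_adjoint a b \<longleftrightarrow> complex_linear b \<and> (\<forall>x y. \<langle>a x, y\<rangle> = \<langle>x, b y\<rangle>)"
proof
  assume L: "is_adjoint a b"
  then have *: "cinner (a x) y = cinner x (b y)" for x y by (simp add: is_adjoint_def)
  then have "cinner (b x) y = cinner x (a y)" for x y by (metis cinner_commute)
  then have "complex_linear b" by (rule complex_linearI)
  then show "complex_linear b \<and> (\<forall>x y. \<langle>a x, y\<rangle> = \<langle>x, b y\<rangle>)"
    using * by (simp add: re_inner_def)
next
  assume "complex_linear b \<and> (\<forall>x y. \<langle>a x, y\<rangle> = \<langle>x, b y\<rangle>)"
  then show "is_adjoint a b"
    by (simp add: is_adjoint_def cinner_eq_re_inner complex_linear_def)
qed

lemma selfadjoint_iff: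
  "selfadjoint a \<longleftrightarrow> complex_linear a \<and> (\<forall>x y. \<langle>a x, y\<rangle> = \<langle>x, a y\<rangle>)"
  by (simp add: selfadjoint_def is_adjoint_iff)

lemma selfadjointD: "selfadjoint a \<Longrightarrow> \<langle>a x, y\<rangle> = \<langle>x, a y\<rangle>"
  by (simp add: selfadjoint_iff)

lemma selfadjoint_0 [simp]: "selfadjoint 0"
  and selfadjoint_id [simp]: "selfadjoint id_blinfun"
  by (simp_all add: selfadjoint_iff complex_linear_iff re_inner.zero_left re_inner.zero_right)
     (metis mult_zero_right mult_zero_left scaleC_scaleC scaleR_eq_scaleC of_real_0 scaleR_zero_left)

lemma selfadjoint_add [intro]: "selfadjoint a \<Longrightarrow> selfadjoint b \<Longrightarrow> selfadjoint (a + b)"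
  by (simp add: selfadjoint_iff complex_linear_iff blinfun_simps re_inner_simps scaleC_add_right)

lemma selfadjoint_scaleR [intro]: "selfadjoint a \<Longrightarrow> selfadjoint (r *\<^sub>R a)"
  by (simp add: selfadjoint_iff complex_linear_iff blinfun_simps re_inner_simps)
     (metis scaleC_scaleC scaleR_eq_scaleC mult.commute)

lemma selfadjoint_minus [intro]: "selfadjoint a \<Longrightarrow> selfadjoint (- a)"
  using selfadjoint_scaleR[of a "-1"] by simp

lemma selfadjoint_diff [intro]: "selfadjoint a \<Longrightarrow> selfadjoint b \<Longrightarrow> selfadjoint (a - b)"
  using selfadjoint_add[of a "- b"] selfadjoint_minus[of b] by simp

lemma selfadjoint_sum: "(\<And>i. i \<in> I \<Longrightarrow> selfadjoint (f i)) \<Longrightarrow> selfadjoint (sum f I)"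
  by (induction I rule: infinite_finite_induct) (auto intro: selfadjoint_add)

lemma selfadjoint_compose_commute:
  assumes "selfadjoint a" "selfadjoint b" "a o\<^sub>L b = b o\<^sub>L a" shows "selfadjoint (a o\<^sub>L b)"
proof -
  have "a (b x) = b (a x)" for x by (metis assms(3) blinfun_apply_blinfun_compose)
  then show ?thesis using assms by (simp add: selfadjoint_iff complex_linear_iff)
qed

lemma selfadjoint_conj:
  assumes "selfadjoint a" "selfadjoint b" shows "selfadjoint (b o\<^sub>L a o\<^sub>L b)"
  using assms by (simp add: selfadjoint_iff complex_linear_iff)

lemma tendsto_scaleC: 
  fixes f :: "'i \<Rightarrow> 'h::chilbert_space"
  assumes "(f \<longlongrightarrow> l) F" shows "((\<lambda>i. c *\<^sub>C f i) \<longlongrightarrow> c *\<^sub>C l) F"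
proof -
  have "bounded_linear ((*\<^sub>C) c :: 'h \<Rightarrow> 'h)"
    by (rule bounded_linear_intro[where K = "cmod c"])
      (simp_all add: scaleC_add_right scaleR_eq_scaleC scaleC_scaleC norm_scaleC mult.commute)
  then show ?thesis using assms by (rule bounded_linear.tendsto)
qed

lemma selfadjoint_strong_limit:
  fixes f :: "'i \<Rightarrow> ('h::chilbert_space \<Rightarrow>\<^sub>L 'h)" and a :: "'h \<Rightarrow>\<^sub>L 'h"
  assumes "F \<noteq> bot" "eventually (\<lambda>i. selfadjoint (f i)) F" "\<And>x. ((\<lambda>i. f i x) \<longlongrightarrow> a x) F"
  shows "selfadjoint a"
proof -
  have "a (\<i> *\<^sub>C x) = \<i> *\<^sub>C a x" for x
  proof (rule tendsto_unique[OF assms(1) assms(3)[of "\<i> *\<^sub>C x"]])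
    show "((\<lambda>i. f i (\<i> *\<^sub>C x)) \<longlongrightarrow> \<i> *\<^sub>C a x) F"
      by (rule Lim_transform_eventually[OF tendsto_scaleC[OF assms(3)[of x]]])
        (use assms(2) in eventually_elim, simp add: selfadjoint_iff complex_linear_def)
  qed
  moreover have "\<langle>a x, y\<rangle> = \<langle>x, a y\<rangle>" for x y
  proof (rule tendsto_unique[OF assms(1) re_inner.tendsto[OF assms(3) tendsto_const]])
    show "((\<lambda>i. \<langle>f i x, y\<rangle>) \<longlongrightarrow> \<langle>x, a y\<rangle>) F"
      by (rule Lim_transform_eventually[OF re_inner.tendsto[OF tendsto_const assms(3)]])
        (use assms(2) in eventually_elim, simp add: selfadjoint_iff)
  qed
  ultimately show ?thesis by (simp add: selfadjoint_iff complex_linear_iff)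
qed

lemma tendsto_blinfun_apply: "(f \<longlongrightarrow> a) F \<Longrightarrow> ((\<lambda>i. blinfun_apply (f i) x) \<longlongrightarrow> a x) F"
  by (intro tendsto_intros)

lemma selfadjoint_limit:
  assumes "\<And>n. selfadjoint (f n)" "f \<longlonglongrightarrow> a"
  shows "selfadjoint a"
  by (rule selfadjoint_strong_limit[of sequentially f])
     (use assms tendsto_blinfun_apply in auto)

lemma selfadjoint_ext:
  assumes "selfadjoint a" "selfadjoint b" "\<And>x. \<langle>a x, x\<rangle> = \<langle>b x, x\<rangle>"
  shows "a = b"
proof (rule blinfun_eqI, rule re_inner_ext)
  fix x y
  let ?d = "a - b"
  have sd: "selfadjoint ?d" using assms by auto
  have q: "\<langle>?d z, z\<rangle> = 0" for z using assms(3) by (simp add: blinfun_simps re_inner_simps)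
  have "\<langle>?d (x + y), x + y\<rangle> = \<langle>?d x, x\<rangle> + \<langle>?d y, y\<rangle> + 2 * \<langle>?d x, y\<rangle>"
    using selfadjointD[OF sd, of x y] re_inner_commute[of x "?d y"]
    by (simp add: blinfun.add_right re_inner_simps)
  then have "\<langle>?d x, y\<rangle> = 0" by (simp only: q)
  then show "\<langle>a x, y\<rangle> = \<langle>b x, y\<rangle>" by (simp add: blinfun_simps re_inner_simps)
qed

text \<open>
  Polarization of \<open>\<langle>a (u + v), u + v\<rangle> - \<langle>a (u - v), u - v\<rangle> = 4 * \<langle>a u, v\<rangle>\<close> with \<open>u\<close> a multiple of \<open>x\<close>
  and \<open>v\<close> a multiple of \<open>a x\<close>, scaled to have equal norms; the parallelogram law then bounds the
  numerical values.
\<close>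

lemma selfadjoint_norm_bound:
  assumes sa: "selfadjoint a" and c: "\<And>x. \<bar>\<langle>a x, x\<rangle>\<bar> \<le> c * (norm x)\<^sup>2"
  shows "norm (a x) \<le> c * norm x"
proof (cases "norm (a x) = 0 \<or> norm x = 0")
  case True
  show ?thesis
  proof (cases "norm x = 0")
    case False
    then have "0 \<le> c"
      using c[of x] by (smt (verit, best) zero_le_mult_iff zero_less_power2)
    then show ?thesis using True False by simp
  qed (simp add: blinfun.zero_right)
next
  case False
  define t where "t = sqrt (norm x / norm (a x))"
  have t: "t > 0" "t^2 = norm x / norm (a x)" using False unfolding t_def by auto
  define u where "u = inverse t *\<^sub>R x" 
  define v where "v = t *\<^sub>R a x"
  have "\<langle>a (u + v), u + v\<rangle> - \<langle>a (u - v), u - v\<rangle> = 4 * \<langle>a u, v\<rangle>"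
    using selfadjointD[OF sa, of u v] re_inner_commute[of u "a v"]
    by (simp add: blinfun_simps re_inner_simps)
  also have "\<langle>a u, v\<rangle> = (norm (a x))\<^sup>2"
    using t by (simp add: u_def v_def blinfun_simps re_inner_simps re_inner_self)
  finally have "4 * (norm (a x))\<^sup>2 \<le> c * (norm (u + v))\<^sup>2 + c * (norm (u - v))\<^sup>2"
    using c[of "u + v"] c[of "u - v"] by linarith
  also have "\<dots> = c * (2 * (norm u)\<^sup>2 + 2 * (norm v)\<^sup>2)"
    unfolding re_inner_self[symmetric] by (simp add: re_inner_simps algebra_simps)
  also have "(norm u)\<^sup>2 = norm x * norm (a x)"
    using t False by (simp add: u_def power_mult_distrib power_inverse) (simp add: power2_eq_square)
  also have "(norm v)\<^sup>2 = norm x * norm (a x)"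
    using t False by (simp add: v_def power_mult_distrib) (simp add: power2_eq_square)
  finally show ?thesis using False by (simp add: power2_eq_square)
qed

section \<open>Positive operators and projections\<close>

lemma positive_op_iff: "positive_op a \<longleftrightarrow> selfadjoint a \<and> (\<forall>x. 0 \<le> \<langle>a x, x\<rangle>)"
  by (simp add: positive_op_def re_inner_def)

lemma op_le_iff:
  "selfadjoint a \<Longrightarrow> selfadjoint b \<Longrightarrow> op_le a b \<longleftrightarrow> (\<forall>x. \<langle>a x, x\<rangle> \<le> \<langle>b x, x\<rangle>)"
  by (auto simp: op_le_def positive_op_iff blinfun_simps re_inner_simps selfadjoint_diff)

lemma positive_selfadjoint: "positive_op a \<Longrightarrow> selfadjoint a"
  by (simp add: positive_op_iff)

lemma positive_Cauchy_Schwarz: "positive_op a \<Longrightarrow> \<langle>a x, y\<rangle>\<^sup>2 \<le> \<langle>a x, x\<rangle> * \<langle>a y, y\<rangle>"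
  by (intro form_Cauchy_Schwarz) (auto simp: positive_op_iff selfadjoint_iff)

lemma positive_kernel:
  assumes "positive_op a" "\<langle>a x, x\<rangle> = 0" shows "a x = 0"
  using positive_Cauchy_Schwarz[OF assms(1), of x "a x"] assms(2) by (simp add: re_inner_self)

lemma positive_norm_bound:
  assumes "positive_op a" "\<And>x. \<langle>a x, x\<rangle> \<le> c * (norm x)\<^sup>2"
  shows "norm (a x) \<le> c * norm x"
  by (rule selfadjoint_norm_bound) (use assms in \<open>auto simp: positive_op_iff\<close>)

lemma form_le_norm:
  fixes a :: "'h::chilbert_space \<Rightarrow>\<^sub>L 'h"
  shows "\<langle>a x, x\<rangle> \<le> norm a * (norm x)\<^sup>2" "- (norm a * (norm x)\<^sup>2) \<le> \<langle>a x, x\<rangle>"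
proof -
  have "\<bar>\<langle>a x, x\<rangle>\<bar> \<le> norm (a x) * norm x" by (rule re_inner_Cauchy_Schwarz)
  also have "\<dots> \<le> (norm a * norm x) * norm x"
    by (intro mult_right_mono norm_blinfun) auto
  finally show "\<langle>a x, x\<rangle> \<le> norm a * (norm x)\<^sup>2" "- (norm a * (norm x)\<^sup>2) \<le> \<langle>a x, x\<rangle>"
    by (auto simp: power2_eq_square mult.assoc)
qed

lemma projectionD:
  assumes "is_projection p"
  shows "selfadjoint p" "\<langle>p x, y\<rangle> = \<langle>x, p y\<rangle>" "p (p x) = p x" "\<langle>p x, x\<rangle> = (norm (p x))\<^sup>2"
    "norm (p x) \<le> norm x"
proof -
  show sa: "selfadjoint p" and 2: "\<langle>p x, y\<rangle> = \<langle>x, p y\<rangle>" for x y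
    using assms by (auto simp: is_projection_def selfadjoint_iff)
  have "(p o\<^sub>L p) x = p x" using assms by (simp add: is_projection_def)
  then show 3: "p (p x) = p x" by simp
  then show 4: "\<langle>p x, x\<rangle> = (norm (p x))\<^sup>2"
    using 2[of "p x" x] 2 by (simp add: re_inner_self[symmetric])
  have "(norm (p x))\<^sup>2 \<le> norm (p x) * norm x"
    using re_inner_Cauchy_Schwarz[of "p x" x] 4 by linarith
  then show "norm (p x) \<le> norm x"
    by (cases "norm (p x) = 0") (auto simp: power2_eq_square)
qed

lemma projection_complement: "is_projection p \<Longrightarrow> is_projection (id_blinfun - p)"
  unfolding is_projection_def
  by (auto intro!: selfadjoint_diff blinfun_eqI simp: blinfun_simps dest: arg_cong[where f=blinfun_apply])
     (metis blinfun_apply_blinfun_compose)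

lemma projection_le_iff:
  assumes p: "is_projection p" and q: "is_projection q"
  shows "op_le p q \<longleftrightarrow> (\<forall>x. p x = x \<longrightarrow> q x = x)"
proof
  assume le: "op_le p q"
  show "\<forall>x. p x = x \<longrightarrow> q x = x"
  proof (intro allI impI)
    fix x assume x: "p x = x"
    have "\<langle>p x, x\<rangle> \<le> \<langle>q x, x\<rangle>" using le p q by (simp add: op_le_iff projectionD(1))
    then have "\<langle>(id_blinfun - q) x, x\<rangle> \<le> 0" using x by (simp add: blinfun_simps re_inner_simps)
    then have "(norm ((id_blinfun - q) x))\<^sup>2 \<le> 0"
      using projectionD(4)[OF projection_complement[OF q]] by simp
    then show "q x = x" by (simp add: blinfun_simps)
  qed
next
  assume *: "\<forall>x. p x = x \<longrightarrow> q x = x"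
  then have qp: "q (p x) = p x" for x using projectionD(3)[OF p] by simp
  have pq: "p (q x) = p x" for x
    by (rule re_inner_ext) (metis projectionD(2)[OF p] projectionD(2)[OF q] qp)
  have "norm (p x) \<le> norm (q x)" for x
    using projectionD(5)[OF p, of "q x"] pq by simp
  then show "op_le p q"
    using p q by (simp add: op_le_iff projectionD(1,4) power_mono)
qed

lemma parallelogram: "(norm (x + y))\<^sup>2 + (norm (x - y))\<^sup>2 = 2 * (norm x)\<^sup>2 + 2 * (norm (y::'h::chilbert_space))\<^sup>2"
  unfolding re_inner_self[symmetric] by (simp add: re_inner_simps)

lemma norm_diff_scaleR:
  "(norm (w - t *\<^sub>R z))\<^sup>2 = (norm w)\<^sup>2 - 2 * t * \<langle>w, z\<rangle> + t\<^sup>2 * (norm (z :: 'h::chilbert_space))\<^sup>2"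
  unfolding re_inner_self[symmetric]
  by (simp add: re_inner_simps re_inner_commute[of z w] power2_eq_square algebra_simps)

text \<open>
  A minimizing sequence is Cauchy by the parallelogram law.
\<close>

lemma nearest_point:
  fixes S :: "'h::chilbert_space set"
  assumes S: "subspace S" "closed S"
  obtains y where "y \<in> S" "\<And>z. z \<in> S \<Longrightarrow> \<langle>x - y, z\<rangle> = 0"
proof -
  define d where "d = (INF y\<in>S. (norm (x - y))\<^sup>2)"
  have ne: "S \<noteq> {}" using S(1) subspace_0 by blast
  have bdd: "bdd_below ((\<lambda>y. (norm (x - y))\<^sup>2) ` S)" by (intro bdd_belowI2[of _ 0]) simp
  have d: "d \<le> (norm (x - y))\<^sup>2" if "y \<in> S" for y
    unfolding d_def by (intro cINF_lower bdd that)
  have "\<exists>y\<in>S. (norm (x - y))\<^sup>2 < d + 1 / Suc n" for n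
    using cINF_less_iff[OF ne bdd, of "d + 1 / Suc n"] unfolding d_def by simp
  then obtain u where u: "\<And>n. u n \<in> S" "\<And>n. (norm (x - u n))\<^sup>2 < d + 1 / Suc n" by metis
  have par: "(norm (u n - u m))\<^sup>2 \<le> 2 * (1 / Suc n + 1 / Suc m)" for n m
  proof -
    have "(1/2) *\<^sub>R (u n + u m) \<in> S" using u(1) S(1) by (simp add: subspace_add subspace_scale)
    from d[OF this] have "d \<le> (norm (x - (1/2) *\<^sub>R (u n + u m)))\<^sup>2" .
    moreover have "(norm (u n - u m))\<^sup>2 + 4 * (norm (x - (1/2) *\<^sub>R (u n + u m)))\<^sup>2
        = 2 * (norm (x - u n))\<^sup>2 + 2 * (norm (x - u m))\<^sup>2"
    proof -
      have "x - (1/2) *\<^sub>R (u n + u m) = (1/2) *\<^sub>R ((x - u n) + (x - u m))"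
        by (simp add: algebra_simps flip: scaleR_2)
      then have "4 * (norm (x - (1/2) *\<^sub>R (u n + u m)))\<^sup>2 = (norm ((x - u n) + (x - u m)))\<^sup>2"
        by (simp add: power_divide)
      moreover have "u n - u m = (x - u m) - (x - u n)" by simp
      ultimately show ?thesis using parallelogram[of "x - u m" "x - u n"] by (simp add: add.commute)
    qed
    moreover have "A \<le> 2 * (\<alpha> + \<beta>)" if "d \<le> D" "A + 4 * D = 2 * P + 2 * Q" "P < d + \<alpha>" "Q < d + \<beta>"
      for A D P Q \<alpha> \<beta> :: real using that by argo
    ultimately show ?thesis using u(2)[of n] u(2)[of m] by blast
  qed
  have "Cauchy u"
  proof (rule metric_CauchyI)
    fix e :: real assume e: "0 < e"
    obtain N where N: "1 / real (Suc N) < e\<^sup>2 / 4"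
      using reals_Archimedean[of "e\<^sup>2 / 4"] e by (auto simp: inverse_eq_divide)
    show "\<exists>M. \<forall>m\<ge>M. \<forall>n\<ge>M. dist (u m) (u n) < e"
    proof (intro exI allI impI)
      fix m n assume mn: "N \<le> m" "N \<le> n"
      have "1 / real (Suc m) \<le> 1 / real (Suc N)" "1 / real (Suc n) \<le> 1 / real (Suc N)"
        using mn by (auto intro!: divide_left_mono)
      moreover have "A < B" if "a \<le> c" "b \<le> c" "A \<le> 2 * (a + b)" "c < B / 4" for a b c A B :: real
        using that by argo
      ultimately have "(norm (u m - u n))\<^sup>2 < e\<^sup>2" using par[of m n] N by blast
      then show "dist (u m) (u n) < e" using e by (simp add: dist_norm power_less_imp_less_base)
    qed
  qed
  then obtain y where y: "u \<longlonglongrightarrow> y" using Cauchy_convergent convergent_def by blast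
  have yS: "y \<in> S" using closed_sequentially[OF S(2)] u(1) y by blast
  have "(\<lambda>n. (norm (x - u n))\<^sup>2) \<longlonglongrightarrow> (norm (x - y))\<^sup>2" by (intro tendsto_intros y)
  moreover have "(\<lambda>n. d + 1 / Suc n) \<longlonglongrightarrow> d + 0"
    using LIMSEQ_Suc[OF lim_1_over_n[where 'a=real]] by (intro tendsto_add tendsto_const) simp
  ultimately have "(norm (x - y))\<^sup>2 \<le> d"
    using LIMSEQ_le[of "\<lambda>n. (norm (x - u n))\<^sup>2" _ "\<lambda>n. d + 1 / Suc n" "d + 0"] u(2)
    by (auto intro: less_imp_le)
  then have min: "(norm (x - y))\<^sup>2 \<le> (norm (x - y - t *\<^sub>R z))\<^sup>2" if "z \<in> S" for z t
  proof -
    have "y + t *\<^sub>R z \<in> S" using that S(1) yS by (simp add: subspace_add subspace_scale)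
    from d[OF this] show ?thesis using \<open>(norm (x - y))\<^sup>2 \<le> d\<close> unfolding diff_diff_eq by (rule order_trans[rotated])
  qed
  have "\<langle>x - y, z\<rangle> = 0" if z: "z \<in> S" for z
  proof (cases "z = 0")
    case False
    define t where "t = \<langle>x - y, z\<rangle> / (norm z)\<^sup>2"
    have *: "0 \<le> - (2 * t * \<langle>x - y, z\<rangle>) + t\<^sup>2 * (norm z)\<^sup>2"
      using min[OF z, of t] unfolding norm_diff_scaleR by simp
    have "\<langle>x - y, z\<rangle> = t * (norm z)\<^sup>2" using False by (simp add: t_def)
    then have "0 \<le> - (t * (norm z)\<^sup>2)\<^sup>2"
      using mult_right_mono[OF *, of "(norm z)\<^sup>2"] by (simp add: power2_eq_square algebra_simps)
    then show ?thesis using False by (simp add: t_def)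
  qed (simp add: re_inner.zero_right)
  then show thesis using that yS by blast
qed

lemma projection_onto:
  fixes S :: "'h::chilbert_space set"
  assumes S: "subspace S" "closed S" and i: "\<And>x. x \<in> S \<Longrightarrow> \<i> *\<^sub>C x \<in> S"
  shows "\<exists>p. is_projection p \<and> (\<forall>x. p x = x \<longleftrightarrow> x \<in> S)"
proof -
  have "\<exists>y. y \<in> S \<and> (\<forall>z\<in>S. \<langle>x - y, z\<rangle> = 0)" for x
    by (rule nearest_point[OF S, of x]) blast
  then obtain f where f: "\<And>x. f x \<in> S" "\<And>x z. z \<in> S \<Longrightarrow> \<langle>x - f x, z\<rangle> = 0" by metis
  have uniq: "y = f x" if "y \<in> S" "\<And>z. z \<in> S \<Longrightarrow> \<langle>x - y, z\<rangle> = 0" for x y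
  proof -
    have "y - f x \<in> S" by (rule subspace_diff[OF S(1) that(1) f(1)])
    then have "\<langle>(x - f x) - (x - y), y - f x\<rangle> = 0"
      unfolding re_inner.diff_left[of "x - f x"] using f(2)[of "y - f x" x] that(2)[of "y - f x"] by simp
    then show ?thesis by (simp add: re_inner_self)
  qed
  have add: "f (x + y) = f x + f y" for x y
  proof (rule uniq[symmetric])
    fix z assume z: "z \<in> S"
    have "x + y - (f x + f y) = (x - f x) + (y - f y)" by simp
    then show "\<langle>x + y - (f x + f y), z\<rangle> = 0"
      by (simp only: re_inner.add_left f(2)[OF z])
  qed (rule subspace_add[OF S(1) f(1) f(1)])
  have scale: "f (r *\<^sub>R x) = r *\<^sub>R f x" for r x
  proof (rule uniq[symmetric])
    fix z assume z: "z \<in> S"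
    have "r *\<^sub>R x - r *\<^sub>R f x = r *\<^sub>R (x - f x)" by (simp add: scaleR_diff_right)
    then show "\<langle>r *\<^sub>R x - r *\<^sub>R f x, z\<rangle> = 0"
      by (simp only: re_inner.scaleR_left f(2)[OF z]) simp
  qed (rule subspace_scale[OF S(1) f(1)])
  have ci: "f (\<i> *\<^sub>C x) = \<i> *\<^sub>C f x" for x
  proof (rule uniq[symmetric])
    fix z assume "z \<in> S"
    have "\<i> *\<^sub>C (x - f x) + \<i> *\<^sub>C f x = \<i> *\<^sub>C x"
      by (simp flip: scaleC_add_right)
    then have "\<i> *\<^sub>C x - \<i> *\<^sub>C f x = \<i> *\<^sub>C (x - f x)" by (metis add_diff_cancel_right')
    then show "\<langle>\<i> *\<^sub>C x - \<i> *\<^sub>C f x, z\<rangle> = 0" using f(2) i \<open>z \<in> S\<close> by (simp add: re_inner_i)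
  qed (use f i in auto)
  have sym: "\<langle>f x, y\<rangle> = \<langle>x, f y\<rangle>" for x y
  proof -
    have "\<langle>x, f y\<rangle> = \<langle>f x, f y\<rangle>"
      using f(2)[OF f(1)[of y], of x] by (simp add: re_inner.diff_left)
    moreover have "\<langle>y, f x\<rangle> = \<langle>f y, f x\<rangle>"
      using f(2)[OF f(1)[of x], of y] by (simp add: re_inner.diff_left)
    ultimately show ?thesis by (metis re_inner_commute)
  qed
  have ff: "f x = x \<longleftrightarrow> x \<in> S" for x
  proof
    show "x \<in> S" if "f x = x" using f(1)[of x] that by simp
    show "f x = x" if "x \<in> S" using uniq[OF that, of x] by (simp add: re_inner.zero_left)
  qed
  have "norm (f x) \<le> norm x * 1" for x
  proof -
    have "(norm (f x))\<^sup>2 = \<langle>x, f x\<rangle>"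
      using f(2)[OF f(1)[of x], of x] by (simp add: re_inner_simps re_inner_self)
    also have "\<dots> \<le> norm x * norm (f x)" using re_inner_Cauchy_Schwarz[of x "f x"] by linarith
    finally show ?thesis by (cases "f x = 0") (auto simp: power2_eq_square)
  qed
  then have "bounded_linear f" by (intro bounded_linear_intro[where K=1] add scale)
  then have p: "Blinfun f x = f x" for x by (simp add: bounded_linear_Blinfun_apply)
  have "is_projection (Blinfun f)"
    unfolding is_projection_def selfadjoint_iff complex_linear_iff
  proof (intro conjI allI blinfun_eqI)
    show "(Blinfun f o\<^sub>L Blinfun f) x = Blinfun f x" for x
      using ff[of "f x"] f(1)[of x] by (simp add: p)
    show "Blinfun f (\<i> *\<^sub>C x) = \<i> *\<^sub>C Blinfun f x" for x by (simp only: p ci)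
    show "\<langle>Blinfun f x, y\<rangle> = \<langle>x, Blinfun f y\<rangle>" for x y by (simp only: p) (rule sym)
  qed
  then show ?thesis using ff by (intro exI[of _ "Blinfun f"]) (simp add: p)
qed

lemma projection_eqI:
  assumes "is_projection p" "is_projection q" "\<And>x. p x = x \<longleftrightarrow> q x = x"
  shows "p = q"
proof (rule selfadjoint_ext)
  have "op_le p q" "op_le q p" using assms by (simp_all add: projection_le_iff)
  then show "\<langle>p x, x\<rangle> = \<langle>q x, x\<rangle>" for x
    using assms(1,2) by (intro antisym) (simp_all add: op_le_iff projectionD(1))
qed (use assms projectionD in auto)

lemma projection_fixed_subspace: "subspace {x. p x = x}" for p :: "'h::chilbert_space \<Rightarrow>\<^sub>L 'h"
  by (auto simp: subspace_def blinfun_simps blinfun.zero_right)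

lemma projection_fixed_closed: "closed {x. p x = x}" for p :: "'h::chilbert_space \<Rightarrow>\<^sub>L 'h"
  by (intro closed_Collect_eq continuous_intros)

lemma projection_meet:
  fixes P :: "'i \<Rightarrow> ('h::chilbert_space \<Rightarrow>\<^sub>L 'h)"
  assumes "\<And>i. i \<in> I \<Longrightarrow> is_projection (P i)"
  shows "\<exists>q. is_projection q \<and> (\<forall>x. q x = x \<longleftrightarrow> (\<forall>i\<in>I. P i x = x))"
proof -
  let ?S = "\<Inter>i\<in>I. {x. P i x = x}"
  have "subspace ?S" by (intro subspace_Inter) (auto simp: projection_fixed_subspace)
  moreover have "closed ?S" by (intro closed_INT ballI projection_fixed_closed)
  moreover have "\<i> *\<^sub>C x \<in> ?S" if "x \<in> ?S" for x
    using that projectionD(1)[OF assms] by (simp add: selfadjoint_iff complex_linear_def)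
  ultimately show ?thesis using projection_onto[of ?S] by simp
qed

text \<open>
  The complement of an intersection of closed subspaces is the closed span of their complements:
  a vector orthogonal to \<open>V\<close> is orthogonal to every complement, hence fixed by every \<open>P i\<close>, hence
  by \<open>q\<close>. It is used with \<open>V\<close> the set of vectors on which a net of projections tends to zero.
\<close>

lemma meet_complement_in:
  fixes P :: "'i \<Rightarrow> ('h::chilbert_space \<Rightarrow>\<^sub>L 'h)"
  assumes P: "\<And>i. i \<in> I \<Longrightarrow> is_projection (P i)" and q: "is_projection q"
    and qP: "\<And>x. q x = x \<longleftrightarrow> (\<forall>i\<in>I. P i x = x)"
    and V: "subspace V" "closed V" "\<And>x. x \<in> V \<Longrightarrow> \<i> *\<^sub>C x \<in> V"
    and PV: "\<And>i x. i \<in> I \<Longrightarrow> x - P i x \<in> V"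
  shows "x - q x \<in> V"
proof -
  obtain r where r: "is_projection r" "\<And>x. r x = x \<longleftrightarrow> x \<in> V" using projection_onto[OF V] by blast
  have "P i (z - r z) = z - r z" if "i \<in> I" for i z
  proof -
    let ?u = "z - r z"
    have v: "r (?u - P i ?u) = ?u - P i ?u" using PV[OF that] r(2) by blast
    have "\<langle>?u - P i ?u, ?u - P i ?u\<rangle> = \<langle>?u - P i ?u, ?u\<rangle>"
      using projectionD(2,3)[OF P[OF that]] by (simp add: re_inner_simps)
    also have "\<dots> = \<langle>?u - P i ?u, r ?u\<rangle>" using v projectionD(2)[OF r(1)] by metis
    also have "r ?u = 0" by (simp add: blinfun.diff_right projectionD(3)[OF r(1)])
    finally show ?thesis by (simp add: re_inner_self re_inner.zero_right)
  qed
  then have qr: "q (z - r z) = z - r z" for z using qP by blast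
  have "\<langle>(x - q x) - r (x - q x), z\<rangle> = 0" for z
  proof -
    have "\<langle>(x - q x) - r (x - q x), z\<rangle> = \<langle>x - q x, z - r z\<rangle>"
      using projectionD(2)[OF r(1)] by (simp add: re_inner_simps)
    also have "\<dots> = \<langle>x - q x, q (z - r z)\<rangle>" by (simp only: qr)
    also have "\<dots> = \<langle>q (x - q x), z - r z\<rangle>" using projectionD(2)[OF q] by simp
    also have "q (x - q x) = 0" by (simp add: blinfun.diff_right projectionD(3)[OF q])
    finally show ?thesis by (simp add: re_inner.zero_left)
  qed
  then have "(x - q x) - r (x - q x) = 0" by (intro re_inner_ext) (simp add: re_inner.zero_left)
  then show ?thesis using r(2)[of "x - q x"] by simp
qed

section \<open>Polynomials of an operator\<close>

lemma op_power_0 [simp]: "op_power a 0 = id_blinfun"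
  and op_power_Suc: "op_power a (Suc n) = a o\<^sub>L op_power a n"
  by (simp_all add: op_power_def)

lemma op_power_Suc_apply: "op_power a (Suc n) x = a (op_power a n x)"
  by (simp add: op_power_Suc)

lemma op_power_1 [simp]: "op_power a (Suc 0) = a"
  by (auto simp: op_power_Suc intro: blinfun_eqI)

lemma op_power_commute_apply:
  fixes a b :: "'h::chilbert_space \<Rightarrow>\<^sub>L 'h"
  assumes "\<And>x. a (b x) = b (a x)" shows "op_power a n (b x) = b (op_power a n x)"
  by (induction n) (simp_all add: op_power_Suc assms)

definition poly_op :: "real poly \<Rightarrow> ('h::chilbert_space \<Rightarrow>\<^sub>L 'h) \<Rightarrow> ('h \<Rightarrow>\<^sub>L 'h)"
  where "poly_op p a = fold_coeffs (\<lambda>c b. c *\<^sub>R id_blinfun + (a o\<^sub>L b)) p 0"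

lemma poly_op_0 [simp]: "poly_op 0 a = 0"
  by (simp add: poly_op_def)

lemma poly_op_pCons [simp]: "poly_op (pCons c p) a = c *\<^sub>R id_blinfun + (a o\<^sub>L poly_op p a)"
  by (cases "p = 0 \<and> c = 0") (auto simp: poly_op_def intro: blinfun_eqI simp: blinfun.zero_right)

lemma poly_op_add: "poly_op (p + q) a = poly_op p a + poly_op q a"
  by (induction p q rule: poly_induct2)
    (auto intro!: blinfun_eqI simp: blinfun_simps blinfun.zero_right algebra_simps)

lemma poly_op_smult: "poly_op (smult r p) a = r *\<^sub>R poly_op p a"
  by (induction p) (auto intro!: blinfun_eqI simp: blinfun_simps scaleR_add_right)

lemma poly_op_diff: "poly_op (p - q) a = poly_op p a - poly_op q a"
  using poly_op_add[of "p - q" q a] by simp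

lemma poly_op_sum: "poly_op (sum f I) a = (\<Sum>i\<in>I. poly_op (f i) a)"
  by (induction I rule: infinite_finite_induct) (simp_all add: poly_op_add)

lemma poly_op_mult_apply: "poly_op (p * q) a x = poly_op p a (poly_op q a x)"
  by (induction p arbitrary: x)
    (simp_all add: mult_pCons_left poly_op_add poly_op_smult blinfun_simps blinfun.zero_right)

lemma poly_op_mult: "poly_op (p * q) a = poly_op p a o\<^sub>L poly_op q a"
  by (rule blinfun_eqI) (simp add: poly_op_mult_apply)

lemma poly_op_commute: "poly_op p a (poly_op q a x) = poly_op q a (poly_op p a x)"
  unfolding poly_op_mult_apply[symmetric] by (simp only: mult.commute)

lemma poly_op_commute_apply:
  fixes a b :: "'h::chilbert_space \<Rightarrow>\<^sub>L 'h"
  assumes "\<And>x. a (b x) = b (a x)" shows "poly_op p a (b x) = b (poly_op p a x)"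
  by (induction p arbitrary: x) (simp_all add: blinfun_simps assms blinfun.zero_right)

lemma selfadjoint_poly_op: "selfadjoint a \<Longrightarrow> selfadjoint (poly_op p a)"
proof (induction p)
  case (pCons c p)
  have "selfadjoint (a o\<^sub>L poly_op p a)" using pCons
    by (intro selfadjoint_compose_commute blinfun_eqI) (auto simp: poly_op_commute_apply)
  then show ?case by (simp add: selfadjoint_scaleR selfadjoint_add)
qed simp

lemma poly_op_pcompose: "poly_op (pcompose p q) a = poly_op p (poly_op q a)"
  by (induction p) (simp_all add: pcompose_pCons poly_op_add poly_op_mult)

lemma poly_op_const: "poly_op [:c:] a = c *\<^sub>R id_blinfun"
  by (auto intro!: blinfun_eqI)

lemma poly_op_X: "poly_op [:0, 1:] a = a"
  by (auto intro!: blinfun_eqI simp: blinfun_simps)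

lemma poly_op_power: "poly_op (p ^ n) a = op_power (poly_op p a) n"
  by (induction n) (simp_all add: op_power_Suc poly_op_mult one_pCons poly_op_const del: poly_op_pCons)

lemma sum_choose_Bernstein:
  assumes "j \<le> n"
  shows "(\<Sum>k\<le>n. real (k choose j) * Bernstein n k t) = real (n choose j) * t ^ j"
proof -
  have "(\<Sum>k\<le>n. real (k choose j) * Bernstein n k t)
      = (\<Sum>k=j..n. real (n choose j) * real ((n - j) choose (k - j)) * (t^k * (1 - t)^(n - k)))"
  proof (rule sum.mono_neutral_cong_right)
    fix k assume "k \<in> {j..n}"
    then have "(n choose k) * (k choose j) = (n choose j) * ((n - j) choose (k - j))"
      by (simp add: choose_mult)
    then have "real (n choose k) * real (k choose j) = real (n choose j) * real ((n - j) choose (k - j))"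
      by (metis of_nat_mult)
    then show "real (k choose j) * Bernstein n k t =
      real (n choose j) * real ((n - j) choose (k - j)) * (t ^ k * (1 - t) ^ (n - k))"
      by (simp add: Bernstein_def algebra_simps)
  qed (auto simp: binomial_eq_0)
  also have "\<dots> = (\<Sum>i\<le>n - j. real (n choose j) * t^j * Bernstein (n - j) i t)"
    using assms
    by (intro sum.reindex_bij_witness[of _ "\<lambda>i. i + j" "\<lambda>k. k - j"])
       (auto simp: Bernstein_def power_add[symmetric] algebra_simps)
  also have "\<dots> = real (n choose j) * t ^ j" by (simp add: sum_distrib_left[symmetric])
  finally show ?thesis .
qed

text \<open>
  For \<open>j \<le> k\<close> both are products of \<open>j\<close> factors in \<open>[0, 1]\<close>, corresponding factors being \<open>(k - i)/(n - i)\<close>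
  and \<open>k/n\<close>, which differ by at most \<open>i/n\<close>. For \<open>k < j\<close> the first ratio is zero.
\<close>

lemma choose_ratio_approx:
  assumes "k \<le> n" "j \<le> n" "0 < n"
  shows "\<bar>real (k choose j) / real (n choose j) - (real k / real n) ^ j\<bar> \<le> real (j * j) / real n
    \<and> real (k choose j) \<le> real (n choose j)"
  using assms(2)
proof (induction j)
  case (Suc j)
  let ?r = "\<lambda>j. real (k choose j) / real (n choose j)" and ?s = "real k / real n"
  have choose: "real (l choose Suc j) * real (Suc j) = real (l choose j) * (real l - real j)" for l
  proof (cases "j \<le> l")
    case True
    have "Suc j * (l choose Suc j) = (l choose j) * (l - j)"
      using binomial_absorb_comp[of l j] Suc_times_binomial_eq by (metis binomial_absorption mult.commute)
    then show ?thesis using True by (metis of_nat_diff of_nat_mult mult.commute)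
  qed (simp add: binomial_eq_0)
  have IH: "\<bar>?r j - ?s ^ j\<bar> \<le> real (j * j) / real n" "real (k choose j) \<le> real (n choose j)"
    using Suc by auto
  have pos: "0 < real (n choose j)" "0 < real (n choose Suc j)" using Suc.prems by auto
  have s: "0 \<le> ?s" "?s \<le> 1" using assms by auto
  show ?case
  proof (cases "j \<le> k")
    case False
    have "\<bar>?s ^ Suc j\<bar> = ?s * ?s ^ j" using s by simp
    also have "\<dots> \<le> ?s * 1" using s by (intro mult_left_mono power_le_one) auto
    also have "\<dots> = ?s" by simp
    also have "\<dots> \<le> real (Suc j * Suc j) / real n"
      using False assms by (intro divide_right_mono) (auto simp: of_nat_le_iff intro: order_trans[of _ "real j"])
    finally show ?thesis using False by (simp add: binomial_eq_0)
  next
    case True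
    define q where "q = (real k - real j) / (real n - real j)"
    have nj: "real n - real j > 0" using Suc.prems by simp
    have q: "0 \<le> q" "q \<le> 1" unfolding q_def using nj True assms by (auto simp: divide_simps)
    have rS: "?r (Suc j) = ?r j * q"
      using choose[of k] choose[of n] pos nj unfolding q_def
      by (simp add: divide_simps) (metis (no_types, opaque_lifting) mult.assoc mult.commute)
    have "?s - q = real j * (real n - real k) / (real n * (real n - real j))"
      using nj assms unfolding q_def by (simp add: field_simps)
    also have "\<dots> = (real j / real n) * ((real n - real k) / (real n - real j))" by simp
    finally have sq: "?s - q = (real j / real n) * ((real n - real k) / (real n - real j))" .
    have "0 \<le> (real n - real k) / (real n - real j)" "(real n - real k) / (real n - real j) \<le> 1"
      using nj True assms by (auto simp: divide_simps)
    then have sq': "\<bar>q - ?s\<bar> \<le> real j / real n"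
      using sq mult_left_le[of "(real n - real k) / (real n - real j)" "real j / real n"]
      by (smt (verit, best) divide_nonneg_nonneg mult_nonneg_nonneg of_nat_0_le_iff)
    have "?r (Suc j) - ?s ^ Suc j = (?r j - ?s ^ j) * q + ?s ^ j * (q - ?s)"
      by (simp add: rS algebra_simps)
    then have "\<bar>?r (Suc j) - ?s ^ Suc j\<bar> \<le> \<bar>?r j - ?s ^ j\<bar> * q + ?s ^ j * \<bar>q - ?s\<bar>"
      using q s by (metis abs_mult abs_of_nonneg abs_triangle_ineq zero_le_power)
    also have "\<dots> \<le> real (j * j) / real n * 1 + 1 * (real j / real n)"
      using IH sq' q s by (intro add_mono mult_mono) (auto simp: power_le_one)
    also have "\<dots> \<le> real (Suc j * Suc j) / real n"
      by (simp add: add_divide_distrib[symmetric] divide_right_mono algebra_simps)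
    finally have 1: "\<bar>?r (Suc j) - ?s ^ Suc j\<bar> \<le> real (Suc j * Suc j) / real n" .
    have "?r (Suc j) \<le> 1" unfolding rS using IH(2) pos q by (intro mult_le_one) auto
    then show ?thesis using 1 pos by (auto simp: divide_simps)
  qed
qed simp

text \<open>
  The monomial \<open>t\<^sup>j\<close> is the combination of the Bernstein polynomials of degree \<open>n\<close> with coefficients
  \<open>(k choose j) / (n choose j)\<close>, which are close to \<open>(k/n)\<^sup>j\<close>. So the Bernstein coefficients of \<open>p\<close> are
  close to the values \<open>p (k/n)\<close>, and adding \<open>e\<close> makes them nonnegative. This is a polynomial identity
  and can therefore be evaluated at an operator.
\<close>

lemma Bernstein_cone:
  fixes p :: "real poly"
  assumes p: "\<And>t. 0 \<le> t \<Longrightarrow> t \<le> 1 \<Longrightarrow> 0 \<le> poly p t" and e: "0 < e"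
  shows "\<exists>n b. (\<forall>k\<le>n. 0 \<le> b k) \<and>
    p + [:e:] = (\<Sum>k\<le>n. smult (b k) ([:0, 1:] ^ k * [:1, -1:] ^ (n - k)))"
proof -
  define C where "C = (\<Sum>j\<le>degree p. \<bar>coeff p j\<bar> * real (j * j))"
  obtain n where n: "C / e < real n" "degree p < n"
    using reals_Archimedean2[of "max (C / e) (real (degree p))"] by auto
  then have n0: "0 < n" by simp
  have Cn: "C / real n \<le> e" using n e n0 by (simp add: field_simps)
  define b where "b k = (\<Sum>j\<le>degree p. coeff p j * (real (k choose j) / real (n choose j)))" for k
  have b: "0 \<le> b k + e" if "k \<le> n" for k
  proof -
    have "\<bar>b k - poly p (real k / real n)\<bar>
        = \<bar>\<Sum>j\<le>degree p. coeff p j * (real (k choose j) / real (n choose j) - (real k / real n) ^ j)\<bar>"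
      by (simp add: b_def poly_altdef sum_subtractf right_diff_distrib)
    also have "\<dots> \<le> (\<Sum>j\<le>degree p. \<bar>coeff p j\<bar> * (real (j * j) / real n))"
    proof (rule order_trans[OF sum_abs], rule sum_mono)
      fix j assume "j \<in> {..degree p}"
      then have "j \<le> n" using n by simp
      then show "\<bar>coeff p j * (real (k choose j) / real (n choose j) - (real k / real n) ^ j)\<bar>
          \<le> \<bar>coeff p j\<bar> * (real (j * j) / real n)"
        using choose_ratio_approx[OF that _ n0, of j] unfolding abs_mult by (intro mult_left_mono) auto
    qed
    also have "\<dots> = C / real n" by (simp add: C_def sum_divide_distrib)
    finally have "\<bar>b k - poly p (real k / real n)\<bar> \<le> e" using Cn by linarith
    moreover have "0 \<le> poly p (real k / real n)" using that n0 by (intro p) auto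
    ultimately show ?thesis by linarith
  qed
  have "poly (p + [:e:]) t =
      poly (\<Sum>k\<le>n. smult ((b k + e) * real (n choose k)) ([:0, 1:] ^ k * [:1, -1:] ^ (n - k))) t" for t
  proof -
    have "(\<Sum>k\<le>n. b k * Bernstein n k t) = (\<Sum>j\<le>degree p. \<Sum>k\<le>n.
        coeff p j * (real (k choose j) / real (n choose j)) * Bernstein n k t)"
      unfolding b_def sum_distrib_right by (rule sum.swap)
    also have "\<dots> = (\<Sum>j\<le>degree p. coeff p j / real (n choose j) *
        (\<Sum>k\<le>n. real (k choose j) * Bernstein n k t))"
      by (simp add: sum_distrib_left algebra_simps)
    also have "\<dots> = poly p t"
      unfolding poly_altdef
    proof (rule sum.cong)
      fix j assume "j \<in> {..degree p}"
      then have "j \<le> n" using n by simp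
      then show "coeff p j / real (n choose j) * (\<Sum>k\<le>n. real (k choose j) * Bernstein n k t)
          = coeff p j * t ^ j"
        by (simp add: sum_choose_Bernstein)
    qed simp
    finally have "poly (p + [:e:]) t = (\<Sum>k\<le>n. b k * Bernstein n k t) + e * (\<Sum>k\<le>n. Bernstein n k t)"
      by simp
    then show ?thesis
      by (simp only: sum_distrib_left sum.distrib[symmetric])
        (simp add: poly_sum Bernstein_def algebra_simps)
  qed
  then have "p + [:e:] =
      (\<Sum>k\<le>n. smult ((b k + e) * real (n choose k)) ([:0, 1:] ^ k * [:1, -1:] ^ (n - k)))"
    unfolding poly_eq_poly_eq_iff[symmetric] by (rule ext)
  then show ?thesis using b by (intro exI[of _ n] exI[of _ "\<lambda>k. (b k + e) * real (n choose k)"]) simp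
qed

text \<open>
  Even powers can be split off as a conjugation by a self-adjoint operator. What remains is one of
  \<open>1\<close>, \<open>X\<close>, \<open>1 - X\<close> and \<open>X (1 - X) = X (1 - X) X + (1 - X) X (1 - X)\<close>.
\<close>

lemma Bernstein_op_positive:
  fixes a :: "'h::chilbert_space \<Rightarrow>\<^sub>L 'h"
  assumes sa: "selfadjoint a" and a: "\<And>x. 0 \<le> \<langle>a x, x\<rangle>" "\<And>x. \<langle>a x, x\<rangle> \<le> (norm x)\<^sup>2"
  shows "0 \<le> \<langle>poly_op ([:0, 1:] ^ k * [:1, -1:] ^ l) a x, x\<rangle>"
proof -
  let ?X = "[:0, 1:] :: real poly" and ?Y = "[:1, -1:] :: real poly"
  have conj: "0 \<le> \<langle>poly_op (q * q * r) a x, x\<rangle>" if "\<And>x. 0 \<le> \<langle>poly_op r a x, x\<rangle>" for q r x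
  proof -
    have "poly_op (q * q * r) a x = poly_op q a (poly_op r a (poly_op q a x))"
      by (simp only: poly_op_mult_apply poly_op_commute[of r a q])
    then show ?thesis
      using selfadjointD[OF selfadjoint_poly_op[OF sa], of q "poly_op r a (poly_op q a x)" x] that
      by simp
  qed
  have X: "0 \<le> \<langle>poly_op ?X a x, x\<rangle>" for x using a(1) by (simp only: poly_op_X)
  have Yeq: "?Y = [:1:] - ?X" by simp
  have Y: "0 \<le> \<langle>poly_op ?Y a x, x\<rangle>" for x
    using a(2)[of x] unfolding Yeq poly_op_diff poly_op_X poly_op_const
    by (simp add: blinfun_simps re_inner_simps re_inner_self)
  have I: "0 \<le> \<langle>poly_op 1 a x, x\<rangle>" for x
    unfolding one_pCons poly_op_const by (simp add: re_inner_self)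
  have XYeq: "?X * ?Y = ?X * ?X * ?Y + ?Y * ?Y * ?X" by simp
  have XY: "0 \<le> \<langle>poly_op (?X * ?Y) a x, x\<rangle>" for x
    unfolding XYeq poly_op_add blinfun.add_left re_inner.add_left
    by (intro add_nonneg_nonneg conj X Y)
  have pw: "P ^ k = P ^ (k div 2) * P ^ (k div 2) * P ^ (k mod 2)" for P :: "real poly" and k :: nat
  proof -
    have "k = k div 2 + k div 2 + k mod 2" by presburger
    then show ?thesis unfolding power_add[symmetric] by simp
  qed
  \<comment> \<open>the remaining exponents are 0 or 1\<close>
  define Q where "Q = ?X ^ (k div 2) * ?Y ^ (l div 2)"
  have eq: "?X ^ k * ?Y ^ l = Q * Q * (?X ^ (k mod 2) * ?Y ^ (l mod 2))"
    unfolding Q_def by (subst pw[of ?X k], subst pw[of ?Y l]) (simp only: mult_ac)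
  have "0 \<le> \<langle>poly_op (?X ^ (k mod 2) * ?Y ^ (l mod 2)) a x, x\<rangle>" for x
  proof -
    have pm: "P ^ (k mod 2) = 1 \<or> P ^ (k mod 2) = P" for P :: "real poly" and k :: nat
      by (cases "even k") (auto simp: even_iff_mod_2_eq_zero odd_iff_mod_2_eq_one)
    show ?thesis
      using pm[of ?X k] pm[of ?Y l] X[of x] Y[of x] XY[of x] I[of x]
      by (elim disjE) (simp_all only: mult_1_left mult_1_right)
  qed
  then show ?thesis unfolding eq by (rule conj)
qed

lemma poly_op_positive_unit:
  fixes a :: "'h::chilbert_space \<Rightarrow>\<^sub>L 'h"
  assumes sa: "selfadjoint a" and a: "\<And>x. 0 \<le> \<langle>a x, x\<rangle>" "\<And>x. \<langle>a x, x\<rangle> \<le> (norm x)\<^sup>2"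
    and p: "\<And>t. 0 \<le> t \<Longrightarrow> t \<le> 1 \<Longrightarrow> 0 \<le> poly p t"
  shows "0 \<le> \<langle>poly_op p a x, x\<rangle>"
proof (rule field_le_epsilon)
  fix e :: real assume e: "0 < e"
  \<comment> \<open>the summand 1 covers the case that the vector is zero\<close>
  define d where "d = e / ((norm x)\<^sup>2 + 1)"
  have pos1: "0 < (norm x)\<^sup>2 + 1" by (simp add: add_nonneg_pos)
  have d: "0 < d" "d * (norm x)\<^sup>2 \<le> e"
    using e pos1 by (auto simp: d_def divide_simps mult_left_mono)
  obtain n b where b: "\<And>k. k \<le> n \<Longrightarrow> 0 \<le> b k"
    and eq: "p + [:d:] = (\<Sum>k\<le>n. smult (b k) ([:0, 1:] ^ k * [:1, -1:] ^ (n - k)))"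
    using Bernstein_cone[OF p d(1)] by blast
  have "0 \<le> (\<Sum>k\<le>n. b k * \<langle>poly_op ([:0, 1:] ^ k * [:1, -1:] ^ (n - k)) a x, x\<rangle>)"
    using b by (intro sum_nonneg mult_nonneg_nonneg Bernstein_op_positive sa a) auto
  also have "\<dots> = \<langle>poly_op (p + [:d:]) a x, x\<rangle>"
    unfolding eq poly_op_sum poly_op_smult blinfun.sum_left re_inner.sum_left
      blinfun.scaleR_left re_inner.scaleR_left by simp
  also have "\<dots> = \<langle>poly_op p a x, x\<rangle> + d * (norm x)\<^sup>2"
    by (simp add: poly_op_add poly_op_const blinfun_simps re_inner_simps re_inner_self
        del: poly_op_pCons)
  finally show "0 \<le> \<langle>poly_op p a x, x\<rangle> + e" using d by linarith
qed

definition form_between :: "real \<Rightarrow> real \<Rightarrow> ('h::chilbert_space \<Rightarrow>\<^sub>L 'h) \<Rightarrow> bool"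
  where "form_between m M a \<longleftrightarrow> selfadjoint a \<and> m < M \<and>
    (\<forall>x. m * (norm x)\<^sup>2 \<le> \<langle>a x, x\<rangle> \<and> \<langle>a x, x\<rangle> \<le> M * (norm x)\<^sup>2)"

lemma poly_op_positive:
  assumes a: "form_between m M a" and p: "\<And>t. m \<le> t \<Longrightarrow> t \<le> M \<Longrightarrow> 0 \<le> poly p t"
  shows "0 \<le> \<langle>poly_op p a x, x\<rangle>"
proof -
  have sa: "selfadjoint a" and mM: "m < M" using a by (auto simp: form_between_def)
  define u where "u = (1 / (M - m)) *\<^sub>R (a - m *\<^sub>R id_blinfun)"
  let ?q = "[:m, M - m:]"
  have u: "selfadjoint u" unfolding u_def using sa by (intro selfadjoint_scaleR selfadjoint_diff) auto
  have "\<langle>u x, x\<rangle> = (\<langle>a x, x\<rangle> - m * (norm x)\<^sup>2) / (M - m)" for x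
    by (simp add: u_def blinfun_simps re_inner_simps re_inner_self)
  moreover have "m * (norm x)\<^sup>2 \<le> \<langle>a x, x\<rangle>" "\<langle>a x, x\<rangle> \<le> M * (norm x)\<^sup>2" for x
    using a by (auto simp: form_between_def)
  ultimately have u01: "0 \<le> \<langle>u x, x\<rangle>" "\<langle>u x, x\<rangle> \<le> (norm x)\<^sup>2" for x
    using mM by (simp_all add: pos_divide_le_eq algebra_simps)
  have "poly_op ?q u = a"
    using mM by (auto intro!: blinfun_eqI simp: u_def blinfun_simps blinfun.zero_right)
  then have "poly_op p a = poly_op (pcompose p ?q) u" by (simp only: poly_op_pcompose)
  moreover have "0 \<le> poly (pcompose p ?q) t" if "0 \<le> t" "t \<le> 1" for t
  proof -
    have "t * (M - m) \<le> 1 * (M - m)" using that mM by (intro mult_right_mono) auto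
    then have "m + t * (M - m) \<le> M" by simp
    moreover have "0 \<le> t * (M - m)" using that mM by simp
    ultimately show ?thesis unfolding poly_pcompose by (intro p) auto
  qed
  ultimately show ?thesis using poly_op_positive_unit[OF u u01] by metis
qed

lemma poly_op_norm:
  assumes a: "form_between m M a" and p: "\<And>t. m \<le> t \<Longrightarrow> t \<le> M \<Longrightarrow> \<bar>poly p t\<bar> \<le> c"
  shows "norm (poly_op p a) \<le> c"
proof (rule norm_blinfun_bound)
  show "0 \<le> c" using p[of m] a by (simp add: form_between_def)
  fix x
  have "0 \<le> \<langle>poly_op ([:c:] + p) a y, y\<rangle>" for y
  proof (rule poly_op_positive[OF a])
    fix t assume "m \<le> t" "t \<le> M" then show "0 \<le> poly ([:c:] + p) t" using p[of t] by simp
  qed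
  moreover have "0 \<le> \<langle>poly_op ([:c:] - p) a y, y\<rangle>" for y
  proof (rule poly_op_positive[OF a])
    fix t assume "m \<le> t" "t \<le> M" then show "0 \<le> poly ([:c:] - p) t" using p[of t] by simp
  qed
  ultimately have "0 \<le> c * (norm y)\<^sup>2 + \<langle>poly_op p a y, y\<rangle>" "0 \<le> c * (norm y)\<^sup>2 - \<langle>poly_op p a y, y\<rangle>" for y
    unfolding poly_op_add poly_op_diff poly_op_const blinfun.add_left blinfun.diff_left
      re_inner.add_left re_inner.diff_left
    by (simp_all add: blinfun.scaleR_left re_inner.scaleR_left re_inner_self)
  then have "\<bar>\<langle>poly_op p a y, y\<rangle>\<bar> \<le> c * (norm y)\<^sup>2" for y
    unfolding abs_le_iff by (smt (verit, best))
  then show "norm (poly_op p a x) \<le> c * norm x"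
    using a by (intro selfadjoint_norm_bound selfadjoint_poly_op) (auto simp: form_between_def)
qed

section \<open>Continuous functional calculus\<close>

text \<open>
  The functional calculus is a relation between a function on \<open>[m, M]\<close> and the operator \<open>f(a)\<close>:
  this avoids choosing approximating polynomials, and \<open>fun_calc_eqI\<close> supplies uniqueness.
\<close>

definition fun_calc ::
    "real \<Rightarrow> real \<Rightarrow> ('h::chilbert_space \<Rightarrow>\<^sub>L 'h) \<Rightarrow> (real \<Rightarrow> real) \<Rightarrow> ('h \<Rightarrow>\<^sub>L 'h) \<Rightarrow> bool"
  where "fun_calc m M a f b \<longleftrightarrow> (\<exists>p. uniform_limit {m..M} (\<lambda>k. poly (p k)) f sequentially \<and>
    (\<lambda>k. poly_op (p k) a) \<longlonglongrightarrow> b)"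

lemma form_between_norm:
  assumes "selfadjoint a" "norm a < M" shows "form_between (- M) M a"
proof -
  have "0 \<le> norm a" by simp
  then have M: "0 < M" using assms(2) by linarith
  have "norm a * (norm x)\<^sup>2 \<le> M * (norm x)\<^sup>2" for x :: 'a
    using assms(2) by (intro mult_right_mono) auto
  then show ?thesis
    unfolding form_between_def using assms(1) M form_le_norm[of a] by (smt (verit) mult_minus_left)
qed

lemma form_between_positive:
  assumes "positive_op a" "norm a < M" shows "form_between 0 M a"
proof -
  have "form_between (- M) M a" using assms by (intro form_between_norm positive_selfadjoint)
  then show ?thesis using assms unfolding form_between_def positive_op_iff by auto
qed

lemma exists_uniform_polys:
  fixes f :: "real \<Rightarrow> real"
  assumes "continuous_on {m..M} f"
  shows "\<exists>p. uniform_limit {m..M} (\<lambda>k. poly (p k)) f sequentially"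
proof -
  have "\<exists>q. \<forall>t\<in>{m..M}. \<bar>poly q t - f t\<bar> < 1 / real (Suc k)" for k
  proof -
    have e: "0 < 1 / real (Suc k)" by simp
    obtain g where g: "real_polynomial_function g" "\<And>t. t \<in> {m..M} \<Longrightarrow> \<bar>f t - g t\<bar> < 1 / real (Suc k)"
      using Stone_Weierstrass_real_polynomial_function[OF compact_Icc assms e] by blast
    obtain c n where "g = (\<lambda>x. \<Sum>i\<le>n. c i * x^i)"
      using g(1) unfolding real_polynomial_function_iff_sum by blast
    then have "poly (\<Sum>i\<le>n. monom (c i) i) t = g t" for t by (simp add: poly_sum poly_monom)
    then show ?thesis using g(2) by (intro exI[of _ "\<Sum>i\<le>n. monom (c i) i"]) (simp add: abs_minus_commute)
  qed
  then obtain p where p: "\<And>k t. t \<in> {m..M} \<Longrightarrow> \<bar>poly (p k) t - f t\<bar> < 1 / real (Suc k)" by metis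
  have "uniform_limit {m..M} (\<lambda>k. poly (p k)) f sequentially"
  proof (rule uniform_limitI)
    fix e :: real assume "0 < e"
    then have "\<forall>\<^sub>F k in sequentially. 1 / real (Suc k) < e"
      using LIMSEQ_Suc[OF lim_1_over_n[where 'a=real]] by (rule order_tendstoD(2)[rotated])
    then show "\<forall>\<^sub>F k in sequentially. \<forall>t\<in>{m..M}. dist (poly (p k) t) (f t) < e"
    proof eventually_elim
      case (elim k)
      then show ?case using p[of _ k] by (auto simp: dist_real_def intro!: less_trans[OF _ elim])
    qed
  qed
  then show ?thesis by blast
qed

lemma poly_op_convergent:
  assumes a: "form_between m M a" and p: "uniform_limit {m..M} (\<lambda>k. poly (p k)) f sequentially"
  shows "\<exists>b. (\<lambda>k. poly_op (p k) a) \<longlonglongrightarrow> b"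
proof -
  have "Cauchy (\<lambda>k. poly_op (p k) a)"
  proof (rule CauchyI)
    fix e :: real assume e: "0 < e"
    then have "\<forall>\<^sub>F k in sequentially. \<forall>t\<in>{m..M}. dist (poly (p k) t) (f t) < e / 4"
      using uniform_limitD[OF p, of "e / 4"] by simp
    then obtain N where N: "\<And>k t. N \<le> k \<Longrightarrow> t \<in> {m..M} \<Longrightarrow> \<bar>poly (p k) t - f t\<bar> < e / 4"
      unfolding eventually_sequentially dist_real_def by blast
    have "norm (poly_op (p i) a - poly_op (p j) a) \<le> e / 2" if "N \<le> i" "N \<le> j" for i j
      unfolding poly_op_diff[symmetric]
    proof (rule poly_op_norm[OF a])
      fix t assume "m \<le> t" "t \<le> M"
      then show "\<bar>poly (p i - p j) t\<bar> \<le> e / 2"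
        using N[OF that(1), of t] N[OF that(2), of t] abs_triangle_ineq4[of "poly (p i) t - f t" "poly (p j) t - f t"]
        by simp
    qed
    then show "\<exists>N. \<forall>i\<ge>N. \<forall>j\<ge>N. norm (poly_op (p i) a - poly_op (p j) a) < e"
      using e by (intro exI[of _ N]) force
  qed
  then show ?thesis using Cauchy_convergent convergent_def by blast
qed

lemma fun_calc_exists:
  assumes "form_between m M a" "continuous_on {m..M} f"
  shows "\<exists>b. fun_calc m M a f b"
  unfolding fun_calc_def using exists_uniform_polys[OF assms(2)] poly_op_convergent[OF assms(1)] by blast

lemma fun_calc_poly: "fun_calc m M a (poly p) (poly_op p a)"
  unfolding fun_calc_def by (intro exI[of _ "\<lambda>_. p"]) (auto intro: uniform_limitI)

lemma fun_calc_id: "fun_calc m M a (\<lambda>t. t) a"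
proof -
  have "poly [:0, 1:] = (\<lambda>t::real. t)" by (simp add: fun_eq_iff)
  then show ?thesis using fun_calc_poly[of m M a "[:0, 1:]"] by (simp only: poly_op_X)
qed

lemma fun_calc_const: "fun_calc m M a (\<lambda>t. c) (c *\<^sub>R id_blinfun)"
proof -
  have "poly [:c:] = (\<lambda>t::real. c)" by (simp add: fun_eq_iff)
  then show ?thesis using fun_calc_poly[of m M a "[:c:]"] by (simp only: poly_op_const)
qed

lemma fun_calc_selfadjoint:
  assumes "selfadjoint a" "fun_calc m M a f b" shows "selfadjoint b"
proof -
  obtain p where "(\<lambda>k. poly_op (p k) a) \<longlonglongrightarrow> b" using assms(2) unfolding fun_calc_def by blast
  then show ?thesis by (rule selfadjoint_limit[rotated]) (rule selfadjoint_poly_op[OF assms(1)])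
qed

lemma fun_calc_commute:
  fixes a b c :: "'h::chilbert_space \<Rightarrow>\<^sub>L 'h"
  assumes b: "fun_calc m M a f b" and c: "\<And>x. a (c x) = c (a x)"
  shows "b (c x) = c (b x)"
proof -
  obtain p where p: "(\<lambda>k. poly_op (p k) a) \<longlonglongrightarrow> b" using b unfolding fun_calc_def by blast
  have "(\<lambda>k. poly_op (p k) a (c x)) \<longlonglongrightarrow> b (c x)" by (rule tendsto_blinfun_apply[OF p])
  moreover have "(\<lambda>k. c (poly_op (p k) a x)) \<longlonglongrightarrow> c (b x)" by (intro tendsto_intros p)
  ultimately show ?thesis by (simp add: poly_op_commute_apply c LIMSEQ_unique)
qed

lemma fun_calc_diff:
  assumes "fun_calc m M a f b" "fun_calc m M a g c"
  shows "fun_calc m M a (\<lambda>t. f t - g t) (b - c)"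
proof -
  obtain p q where "uniform_limit {m..M} (\<lambda>k. poly (p k)) f sequentially" "(\<lambda>k. poly_op (p k) a) \<longlonglongrightarrow> b"
    "uniform_limit {m..M} (\<lambda>k. poly (q k)) g sequentially" "(\<lambda>k. poly_op (q k) a) \<longlonglongrightarrow> c"
    using assms unfolding fun_calc_def by blast
  moreover have "(\<lambda>k. poly (p k - q k)) = (\<lambda>k t. poly (p k) t - poly (q k) t)"
    by (simp add: fun_eq_iff)
  ultimately show ?thesis unfolding fun_calc_def
    by (intro exI[of _ "\<lambda>k. p k - q k"]) (simp add: poly_op_diff uniform_limit_minus tendsto_diff)
qed

lemma fun_calc_bounded:
  assumes "fun_calc m M a f b" shows "bounded (f ` {m..M})"
proof -
  obtain p where "uniform_limit {m..M} (\<lambda>k. poly (p k)) f sequentially"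
    using assms unfolding fun_calc_def by blast
  then have "continuous_on {m..M} f"
    by (rule uniform_limit_theorem[rotated]) (auto intro!: always_eventually continuous_intros)
  then show ?thesis by (intro compact_imp_bounded compact_continuous_image compact_Icc)
qed

lemma fun_calc_mult:
  assumes b: "fun_calc m M a f b" and c: "fun_calc m M a g c"
  shows "fun_calc m M a (\<lambda>t. f t * g t) (b o\<^sub>L c)"
proof -
  obtain p q where pq: "uniform_limit {m..M} (\<lambda>k. poly (p k)) f sequentially" "(\<lambda>k. poly_op (p k) a) \<longlonglongrightarrow> b"
    "uniform_limit {m..M} (\<lambda>k. poly (q k)) g sequentially" "(\<lambda>k. poly_op (q k) a) \<longlonglongrightarrow> c"
    using assms unfolding fun_calc_def by blast
  have "uniform_limit {m..M} (\<lambda>k t. poly (p k) t * poly (q k) t) (\<lambda>t. f t * g t) sequentially"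
    by (intro uniform_lim_mult pq fun_calc_bounded[OF b] fun_calc_bounded[OF c])
  moreover have "(\<lambda>k. poly_op (p k) a o\<^sub>L poly_op (q k) a) \<longlonglongrightarrow> (b o\<^sub>L c)"
    by (intro bounded_bilinear.tendsto[OF bounded_bilinear_blinfun_compose] pq)
  moreover have "(\<lambda>k. poly (p k * q k)) = (\<lambda>k t. poly (p k) t * poly (q k) t)"
    by (simp add: fun_eq_iff)
  ultimately show ?thesis unfolding fun_calc_def
    by (intro exI[of _ "\<lambda>k. p k * q k"]) (simp add: poly_op_mult)
qed

lemma fun_calc_power:
  assumes "fun_calc m M a f b" shows "fun_calc m M a (\<lambda>t. f t ^ n) (op_power b n)"
proof (induction n)
  case 0
  show ?case using fun_calc_const[of m M a 1] by simp
next
  case (Suc n)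
  show ?case using fun_calc_mult[OF assms Suc] by (simp add: op_power_Suc)
qed

lemma fun_calc_mono:
  assumes a: "form_between m M a" and b: "fun_calc m M a f b" and c: "fun_calc m M a g c"
    and le: "\<And>t. m \<le> t \<Longrightarrow> t \<le> M \<Longrightarrow> f t \<le> g t"
  shows "\<langle>b x, x\<rangle> \<le> \<langle>c x, x\<rangle>"
proof (rule field_le_epsilon)
  fix e :: real assume e: "0 < e"
  obtain p q where p: "uniform_limit {m..M} (\<lambda>k. poly (p k)) f sequentially" "(\<lambda>k. poly_op (p k) a) \<longlonglongrightarrow> b"
    and q: "uniform_limit {m..M} (\<lambda>k. poly (q k)) g sequentially" "(\<lambda>k. poly_op (q k) a) \<longlonglongrightarrow> c"
    using b c unfolding fun_calc_def by blast
  define d where "d = e / (2 * ((norm x)\<^sup>2 + 1))"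
  have n1: "0 < (norm x)\<^sup>2 + 1" by (simp add: add_nonneg_pos)
  have d: "0 < d" "2 * d * (norm x)\<^sup>2 \<le> e" using e n1 unfolding d_def
    by (auto simp: divide_simps mult_left_mono)
  have "\<forall>\<^sub>F k in sequentially. (\<forall>t\<in>{m..M}. dist (poly (p k) t) (f t) < d)"
    "\<forall>\<^sub>F k in sequentially. (\<forall>t\<in>{m..M}. dist (poly (q k) t) (g t) < d)"
    using uniform_limitD[OF p(1) d(1)] uniform_limitD[OF q(1) d(1)] by auto
  then have "\<forall>\<^sub>F k in sequentially. \<langle>poly_op (p k) a x, x\<rangle> \<le> \<langle>poly_op (q k) a x, x\<rangle> + e"
  proof eventually_elim
    case (elim k)
    have "0 \<le> \<langle>poly_op (q k - p k + [:2 * d:]) a x, x\<rangle>"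
    proof (rule poly_op_positive[OF a])
      fix t assume t: "m \<le> t" "t \<le> M"
      then have "\<bar>poly (p k) t - f t\<bar> < d" "\<bar>poly (q k) t - g t\<bar> < d"
        using elim by (auto simp: dist_real_def)
      then show "0 \<le> poly (q k - p k + [:2 * d:]) t" using le[OF t] by simp
    qed
    also have "\<dots> = \<langle>poly_op (q k) a x, x\<rangle> - \<langle>poly_op (p k) a x, x\<rangle> + 2 * d * (norm x)\<^sup>2"
      by (simp only: poly_op_add poly_op_diff poly_op_const blinfun_simps re_inner_simps
          id_blinfun.rep_eq re_inner_self real_scaleR_def)
    finally show ?case using d(2) by linarith
  qed
  moreover have "(\<lambda>k. \<langle>poly_op (p k) a x, x\<rangle>) \<longlonglongrightarrow> \<langle>b x, x\<rangle>"
    "(\<lambda>k. \<langle>poly_op (q k) a x, x\<rangle> + e) \<longlonglongrightarrow> \<langle>c x, x\<rangle> + e"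
    by (intro re_inner.tendsto tendsto_add tendsto_blinfun_apply tendsto_const p(2) q(2))+
  ultimately show "\<langle>b x, x\<rangle> \<le> \<langle>c x, x\<rangle> + e"
    by (intro tendsto_le[OF trivial_limit_sequentially])
qed

lemma fun_calc_eqI:
  assumes a: "form_between m M a" and "fun_calc m M a f b" "fun_calc m M a g c"
    and "\<And>t. m \<le> t \<Longrightarrow> t \<le> M \<Longrightarrow> f t = g t"
  shows "b = c"
proof (rule selfadjoint_ext)
  show "\<langle>b x, x\<rangle> = \<langle>c x, x\<rangle>" for x
    using fun_calc_mono[OF a assms(2,3)] fun_calc_mono[OF a assms(3,2)] assms(4)
    by (intro antisym) auto
qed (use assms fun_calc_selfadjoint in \<open>auto simp: form_between_def\<close>)

lemma fun_calc_positive: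
  assumes a: "form_between m M a" and b: "fun_calc m M a f b"
    and "\<And>t. m \<le> t \<Longrightarrow> t \<le> M \<Longrightarrow> 0 \<le> f t"
  shows "positive_op b"
  using fun_calc_mono[OF a fun_calc_const b, of 0] assms fun_calc_selfadjoint[OF _ b]
  by (auto simp: positive_op_iff form_between_def re_inner.zero_left)

lemma fun_calc_tendsto:
  assumes a: "form_between m M a" and b: "fun_calc m M a f b"
    and p: "uniform_limit {m..M} (\<lambda>k. poly (p k)) f sequentially"
  shows "(\<lambda>k. poly_op (p k) a) \<longlonglongrightarrow> b"
proof -
  obtain c where c: "(\<lambda>k. poly_op (p k) a) \<longlonglongrightarrow> c" using poly_op_convergent[OF a p] by blast
  then have "fun_calc m M a f c" using p unfolding fun_calc_def by blast
  then show ?thesis using c fun_calc_eqI[OF a b] by blast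
qed

section \<open>Algebras of operators\<close>

lemma algebra_scaleR:
  assumes "cstar_subalgebra A" "a \<in> A" shows "r *\<^sub>R a \<in> A"
proof -
  have "op_scaleC (complex_of_real r) a = r *\<^sub>R a"
    by (intro blinfun_eqI) (simp add: op_scaleC_apply scaleR_eq_scaleC blinfun.scaleR_left)
  moreover have "op_scaleC (complex_of_real r) a \<in> A" using assms by (simp add: cstar_subalgebra_def)
  ultimately show ?thesis by simp
qed

lemma algebra_add: "cstar_subalgebra A \<Longrightarrow> a \<in> A \<Longrightarrow> b \<in> A \<Longrightarrow> a + b \<in> A"
  and algebra_compose: "cstar_subalgebra A \<Longrightarrow> a \<in> A \<Longrightarrow> b \<in> A \<Longrightarrow> a o\<^sub>L b \<in> A"
  and algebra_0: "cstar_subalgebra A \<Longrightarrow> 0 \<in> A"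
  and algebra_closed: "cstar_subalgebra A \<Longrightarrow> closed A"
  by (simp_all add: cstar_subalgebra_def)

lemma algebra_sum: "cstar_subalgebra A \<Longrightarrow> (\<And>i. i \<in> I \<Longrightarrow> f i \<in> A) \<Longrightarrow> sum f I \<in> A"
  by (induction I rule: infinite_finite_induct) (auto intro: algebra_add algebra_0)

lemma algebra_power: "cstar_subalgebra A \<Longrightarrow> a \<in> A \<Longrightarrow> op_power a (Suc n) \<in> A"
proof (induction n)
  case (Suc n)
  then show ?case unfolding op_power_Suc[of a "Suc n"] by (intro algebra_compose)
qed simp

text \<open>
  The algebra need not contain the identity, so the constant term of \<open>p\<close> has to be cut down by \<open>e\<close>.
\<close>

lemma algebra_poly_op:
  assumes A: "cstar_subalgebra A" and a: "a \<in> A" and e: "e \<in> A" "a o\<^sub>L e = a"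
  shows "poly_op p a o\<^sub>L e \<in> A"
proof (induction p)
  case 0
  have "poly_op 0 a o\<^sub>L e = 0" by (auto intro: blinfun_eqI)
  then show ?case using algebra_0[OF A] by simp
next
  case (pCons c p)
  have "poly_op (pCons c p) a o\<^sub>L e = c *\<^sub>R e + (a o\<^sub>L (poly_op p a o\<^sub>L e))"
    by (auto intro!: blinfun_eqI simp: blinfun_simps)
  then show ?case using pCons by (simp add: algebra_add algebra_scaleR algebra_compose A a e)
qed

text \<open>
  As \<open>f 0 = 0\<close>, the approximating polynomials can be chosen without constant term.
\<close>

lemma algebra_fun_calc:
  assumes A: "cstar_subalgebra A" and a: "a \<in> A" "form_between m M a" and b: "fun_calc m M a f b"
    and 0: "m \<le> 0" "0 \<le> M" "f 0 = 0"
  shows "b \<in> A"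
proof -
  obtain p where p: "uniform_limit {m..M} (\<lambda>k. poly (p k)) f sequentially"
    using b unfolding fun_calc_def by blast
  define q where "q k = p k - [:poly (p k) 0:]" for k
  have "(\<lambda>k. poly (p k) 0) \<longlonglongrightarrow> f 0" using tendsto_uniform_limitI[OF p, of 0] 0 by simp
  then have "uniform_limit {m..M} (\<lambda>k t. poly (p k) 0) (\<lambda>_. f 0) sequentially"
    by (simp add: uniform_limit_iff tendsto_iff)
  then have "uniform_limit {m..M} (\<lambda>k t. poly (p k) t - poly (p k) 0) (\<lambda>t. f t - f 0) sequentially"
    by (rule uniform_limit_minus[OF p])
  moreover have "(\<lambda>k. poly (q k)) = (\<lambda>k t. poly (p k) t - poly (p k) 0)"
    by (simp add: q_def fun_eq_iff)
  ultimately have "uniform_limit {m..M} (\<lambda>k. poly (q k)) f sequentially"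
    by (simp add: 0)
  then have lim: "(\<lambda>k. poly_op (q k) a) \<longlonglongrightarrow> b" by (rule fun_calc_tendsto[OF a(2) b])
  have in_A: "a o\<^sub>L poly_op r a \<in> A" for r
  proof (induction r)
    case 0
    have "a o\<^sub>L 0 = 0" by (auto intro: blinfun_eqI simp: blinfun.zero_right)
    then show ?case using algebra_0[OF A] by simp
  next
    case (pCons c r)
    have "a o\<^sub>L poly_op (pCons c r) a = c *\<^sub>R a + (a o\<^sub>L (a o\<^sub>L poly_op r a))"
      by (auto intro!: blinfun_eqI simp: blinfun_simps)
    then show ?case using pCons by (simp add: algebra_add algebra_scaleR algebra_compose A a)
  qed
  have "poly_op (q k) a \<in> A" for k
  proof (cases "q k")
    case (pCons c r)
    have "poly (q k) 0 = 0" by (simp add: q_def)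
    then have "c = 0" using pCons by simp
    then show ?thesis using in_A[of r] pCons by simp
  qed
  then show ?thesis by (rule closed_sequentially[OF algebra_closed[OF A] _ lim])
qed

section \<open>Roots of positive operators\<close>

lemma positive_power:
  assumes "positive_op b" shows "positive_op (op_power b n)"
proof -
  obtain M where "norm b < M" using lt_ex gt_ex by blast
  then have M: "form_between 0 M b" using assms by (rule form_between_positive[rotated])
  show ?thesis by (rule fun_calc_positive[OF M fun_calc_power[OF fun_calc_id]]) simp
qed

lemma positive_root_exists:
  assumes a: "positive_op a" and M: "form_between 0 M a" and n: "0 < n"
  shows "\<exists>b. positive_op b \<and> op_power b n = a \<and> fun_calc 0 M a (root n) b"
proof -
  have "continuous_on {0..M} (root n)" by (intro continuous_on_real_root continuous_on_id)
  then obtain b where b: "fun_calc 0 M a (root n) b" using fun_calc_exists[OF M] by blast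
  have "op_power b n = a"
    by (rule fun_calc_eqI[OF M fun_calc_power[OF b] fun_calc_id]) (use n in simp)
  moreover have "positive_op b"
    by (rule fun_calc_positive[OF M b]) (use n in \<open>simp add: real_root_ge_zero\<close>)
  ultimately show ?thesis using b by blast
qed

text \<open>
  If polynomials \<open>p k\<close> converge to the \<open>n\<close>-th root, then \<open>p k (t\<^sup>n)\<close> converges to \<open>t\<close> uniformly on
  \<open>[0, M]\<close>; so \<open>b\<close> is the limit of \<open>p k (b\<^sup>n)\<close> and is determined by its \<open>n\<close>-th power.
\<close>

lemma positive_root_unique:
  assumes b: "positive_op b" and M: "form_between 0 M b" and n: "0 < n"
    and c: "fun_calc 0 (M ^ n) (op_power b n) (root n) c"
  shows "b = c"
proof -
  let ?a = "op_power b n"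
  have M0: "0 < M" using M by (simp add: form_between_def)
  have "\<langle>?a x, x\<rangle> \<le> M ^ n * (norm x)\<^sup>2" for x
    using fun_calc_mono[OF M fun_calc_power[OF fun_calc_id] fun_calc_const, of n "M ^ n" x] M0
    by (simp add: power_mono blinfun_simps re_inner_simps re_inner_self)
  then have Mn: "form_between 0 (M ^ n) ?a"
    using positive_power[OF b, of n] M0 unfolding form_between_def positive_op_iff by simp
  obtain p where p: "uniform_limit {0..M ^ n} (\<lambda>k. poly (p k)) (root n) sequentially"
    using c unfolding fun_calc_def by blast
  have 1: "(\<lambda>k. poly_op (p k) ?a) \<longlonglongrightarrow> c" by (rule fun_calc_tendsto[OF Mn c p])
  define q where "q k = pcompose (p k) ([:0, 1:] ^ n)" for k
  have q: "poly_op (q k) b = poly_op (p k) ?a" for k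
    by (simp only: q_def poly_op_pcompose poly_op_power poly_op_X)
  have "uniform_limit {0..M} (\<lambda>k t. poly (p k) (t ^ n)) (\<lambda>t. root n (t ^ n)) sequentially"
    by (rule uniform_limit_compose'[OF p]) (auto simp: power_mono)
  then have "uniform_limit {0..M} (\<lambda>k. poly (q k)) (\<lambda>t. t) sequentially"
    by (rule uniform_limit_cong[THEN iffD1, rotated -1])
       (use n in \<open>auto simp: q_def poly_pcompose real_root_power_cancel\<close>)
  then have "(\<lambda>k. poly_op (q k) b) \<longlonglongrightarrow> b" by (rule fun_calc_tendsto[OF M fun_calc_id])
  then show ?thesis using 1 unfolding q by (rule LIMSEQ_unique)
qed

lemma op_root_unique:
  assumes "positive_op b" "op_power b n = a" "0 < n" shows "op_root n a = b"
  unfolding op_root_def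
proof (rule the_equality)
  show "positive_op b \<and> op_power b n = a" using assms by simp
  fix c assume c: "positive_op c \<and> op_power c n = a"
  define M where "M = max (norm b) (norm c) + 1"
  have M: "form_between 0 M b" "form_between 0 M c"
    using assms c by (auto intro!: form_between_positive simp: M_def)
  have M0: "0 < M" using M by (simp add: form_between_def)
  have "\<langle>a x, x\<rangle> \<le> M ^ n * (norm x)\<^sup>2" for x
    using fun_calc_mono[OF M(1) fun_calc_power[OF fun_calc_id] fun_calc_const, of n "M ^ n" x] M0
    by (simp add: power_mono blinfun_simps re_inner_simps re_inner_self assms(2))
  then have "form_between 0 (M ^ n) a"
    using positive_power[OF assms(1), of n] assms(2) M0 unfolding form_between_def positive_op_iff by simp
  then obtain d where d: "fun_calc 0 (M ^ n) a (root n) d"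
    using fun_calc_exists continuous_on_real_root continuous_on_id by blast
  show "c = b"
    using positive_root_unique[OF _ M(1) assms(3), of d] positive_root_unique[OF _ M(2) assms(3), of d]
      assms c d by simp
qed

lemma op_root:
  assumes "positive_op a" "0 < n"
  shows "positive_op (op_root n a)" "op_power (op_root n a) n = a"
proof -
  obtain M where "norm a < M" using lt_ex gt_ex by blast
  then have M: "form_between 0 M a" using assms by (intro form_between_positive)
  obtain b where b: "positive_op b" "op_power b n = a" using positive_root_exists[OF assms(1) M assms(2)] by blast
  then show "positive_op (op_root n a)" "op_power (op_root n a) n = a"
    using op_root_unique[OF b assms(2)] by auto
qed

lemma algebra_op_root:
  assumes A: "cstar_subalgebra A" and a: "positive_op a" "a \<in> A" and n: "0 < n"
  shows "op_root n a \<in> A"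
proof -
  obtain M where "norm a < M" using lt_ex gt_ex by blast
  then have M: "form_between 0 M a" using a by (intro form_between_positive)
  obtain b where b: "positive_op b" "op_power b n = a" "fun_calc 0 M a (root n) b"
    using positive_root_exists[OF a(1) M n] by blast
  have "0 \<le> M" using M by (simp add: form_between_def)
  then have "b \<in> A" using algebra_fun_calc[OF A a(2) M b(3)] by simp
  then show ?thesis using op_root_unique[OF b(1,2) n] by simp
qed

section \<open>Strong limits of projections\<close>

lemma strong_limit_iff:
  fixes f :: "'i \<Rightarrow> ('h::chilbert_space \<Rightarrow>\<^sub>L 'h)"
  shows "limitin strong_operator_topology f a F \<longleftrightarrow> (\<forall>x. ((\<lambda>i. f i x) \<longlongrightarrow> a x) F)"
proof
  assume L: "limitin strong_operator_topology f a F"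
  show "\<forall>x. ((\<lambda>i. f i x) \<longlongrightarrow> a x) F"
    using continuous_map_limit[OF strong_operator_topology_continuous_evaluation L]
    by (simp add: comp_def)
next
  assume R: "\<forall>x. ((\<lambda>i. f i x) \<longlongrightarrow> a x) F"
  have "limitin (product_topology (\<lambda>_. euclidean) UNIV) (\<lambda>i. blinfun_apply (f i)) (blinfun_apply a) F"
    using R by (subst limitin_componentwise) auto
  then have *: "((\<lambda>i. blinfun_apply (f i)) \<longlongrightarrow> blinfun_apply a) F"
    by (simp add: euclidean_product_topology)
  show "limitin strong_operator_topology f a F"
    unfolding limitin_def strong_operator_topology_topspace
  proof (intro conjI allI impI)
    fix U assume U: "openin strong_operator_topology U \<and> a \<in> U"
    then obtain V where V: "open V" "U = blinfun_apply -` V \<inter> UNIV"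
      by (auto simp: strong_operator_topology_def openin_pullback_topology)
    then have "blinfun_apply a \<in> V" using U by blast
    then have "eventually (\<lambda>i. blinfun_apply (f i) \<in> V) F" using * V(1) by (rule topological_tendstoD[rotated 2])
    then show "eventually (\<lambda>i. f i \<in> U) F" using V(2) by simp
  qed simp
qed

text \<open>
  The subspace is closed because projections are contractions, uniformly in the index.
\<close>

lemma null_space:
  fixes P :: "'i \<Rightarrow> ('h::chilbert_space \<Rightarrow>\<^sub>L 'h)" and F :: "'i filter"
  assumes P: "\<And>i. is_projection (P i)"
  defines "V \<equiv> {x. ((\<lambda>i. P i x) \<longlongrightarrow> 0) F}"
  shows "subspace V" "closed V" "\<And>x. x \<in> V \<Longrightarrow> \<i> *\<^sub>C x \<in> V"
proof -
  show "subspace V"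
    unfolding subspace_def V_def
    by (auto simp: blinfun_simps blinfun.zero_right intro: tendsto_add_zero tendsto_eq_intros)
  have z: "\<i> *\<^sub>C 0 = (0 :: 'h)" by (metis norm_eq_zero norm_scaleC mult_zero_right norm_zero)
  show "\<i> *\<^sub>C x \<in> V" if "x \<in> V" for x
  proof -
    have "P i (\<i> *\<^sub>C x) = \<i> *\<^sub>C P i x" for i
      using projectionD(1)[OF P] by (simp add: selfadjoint_iff complex_linear_def)
    then show ?thesis using that tendsto_scaleC[of "\<lambda>i. P i x" 0 F \<i>] by (simp add: V_def z)
  qed
  show "closed V"
    unfolding closed_sequential_limits
  proof (intro allI impI)
    fix u x assume u: "(\<forall>n. u n \<in> V) \<and> u \<longlonglongrightarrow> x"
    have "((\<lambda>i. P i x) \<longlongrightarrow> 0) F"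
    proof (rule tendstoI)
      fix e :: real assume e: "0 < e"
      have "\<forall>\<^sub>F n in sequentially. dist (u n) x < e / 2" using u e by (intro tendstoD) auto
      then obtain n where n: "dist (u n) x < e / 2" by (auto simp: eventually_sequentially)
      have "\<forall>\<^sub>F i in F. dist (P i (u n)) 0 < e / 2" using u e unfolding V_def by (intro tendstoD) auto
      then show "\<forall>\<^sub>F i in F. dist (P i x) 0 < e"
      proof eventually_elim
        case (elim i)
        have "norm (P i x) \<le> norm (P i (x - u n)) + norm (P i (u n))"
          using norm_triangle_ineq[of "P i (x - u n)" "P i (u n)"] by (simp add: blinfun.diff_right)
        also have "norm (P i (x - u n)) \<le> norm (x - u n)" by (rule projectionD(5)[OF P])
        finally show ?case using n elim by (simp add: dist_norm norm_minus_commute)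
      qed
    qed
    then show "x \<in> V" by (simp add: V_def)
  qed
qed

section \<open>Resolutions of the identity\<close>

text \<open>
  The conditions on the spectral family that do not mention the operator.
\<close>

definition resolution :: "(real \<Rightarrow> ('h::chilbert_space \<Rightarrow>\<^sub>L 'h)) \<Rightarrow> bool"
  where "resolution E \<longleftrightarrow> (\<forall>l. is_projection (E l)) \<and> (\<forall>l m. l \<le> m \<longrightarrow> op_le (E l) (E m)) \<and>
    (\<forall>l. limitin strong_operator_topology E (E l) (at_right l)) \<and>
    (\<exists>r. (\<forall>l < - r. E l = 0) \<and> (\<forall>l > r. E l = id_blinfun))"

lemma is_spectral_family_iff:
  "is_spectral_family x E \<longleftrightarrow> resolution E \<and>
    (\<forall>u. has_bochner_integral (interval_measure (\<lambda>l. \<langle>E l u, u\<rangle>)) (\<lambda>l. l) \<langle>x u, u\<rangle>)"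
  by (auto simp: is_spectral_family_def resolution_def re_inner_def)

lemma resolutionD:
  assumes E: "resolution E"
  shows resolution_projection: "is_projection (E l)"
    and resolution_mono: "l \<le> m \<Longrightarrow> E l x = x \<Longrightarrow> E m x = x"
    and resolution_op_le: "l \<le> m \<Longrightarrow> op_le (E l) (E m)"
    and resolution_right_lim: "((\<lambda>m. E m x) \<longlongrightarrow> E l x) (at_right l)"
    and resolution_bounded: "\<exists>r. (\<forall>l < - r. E l = 0) \<and> (\<forall>l > r. E l = id_blinfun)"
proof -
  show P: "is_projection (E l)" for l using E by (simp add: resolution_def)
  show "l \<le> m \<Longrightarrow> op_le (E l) (E m)" for l m using E by (simp add: resolution_def)
  then show "l \<le> m \<Longrightarrow> E l x = x \<Longrightarrow> E m x = x" using projection_le_iff[OF P P] by blast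
  show "((\<lambda>m. E m x) \<longlongrightarrow> E l x) (at_right l)" using E by (simp add: resolution_def strong_limit_iff)
  show "\<exists>r. (\<forall>l < - r. E l = 0) \<and> (\<forall>l > r. E l = id_blinfun)" using E by (simp add: resolution_def)
qed

lemma resolution_compose:
  assumes E: "resolution E" and "l \<le> m"
  shows "E m (E l x) = E l x" "E l (E m x) = E l x"
proof -
  show *: "E m (E l x) = E l x" for x
    using resolution_mono[OF E assms(2)] projectionD(3)[OF resolution_projection[OF E]] by blast
  show "E l (E m x) = E l x"
  proof (rule re_inner_ext)
    fix z
    show "\<langle>E l (E m x), z\<rangle> = \<langle>E l x, z\<rangle>"
      using projectionD(2)[OF resolution_projection[OF E]] * by simp
  qed
qed

lemma resolution_right:
  assumes E: "resolution E" and x: "\<And>m. l < m \<Longrightarrow> E m x = x"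
  shows "E l x = x"
proof (rule tendsto_unique[OF _ resolution_right_lim[OF E]])
  show "((\<lambda>m. E m x) \<longlongrightarrow> x) (at_right l)"
    by (rule tendsto_eventually) (simp add: eventually_at_right_less x eventually_mono[OF eventually_at_right_less])
qed simp

lemma resolution_bound:
  assumes E: "resolution E"
  obtains R where "R > k" "0 < R" "\<forall>l\<le>- R. E l = 0" "\<forall>l\<ge>R. E l = id_blinfun"
proof -
  obtain r where r: "\<forall>l < - r. E l = 0" "\<forall>l > r. E l = id_blinfun" using resolution_bounded[OF E] by blast
  show thesis
    by (rule that[of "max (max k 0) r + 1"]) (use r in auto)
qed

text \<open>
  Monotonicity turns right continuity into a statement about fixed vectors: by
  \<open>meet_complement_in\<close>, the projections \<open>E m\<close> with \<open>m > l\<close> tend to zero on the complement of \<open>E l\<close>,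
  since they eventually vanish on each complement of an \<open>E k\<close> with \<open>k > l\<close>.
\<close>

lemma resolutionI:
  fixes E :: "real \<Rightarrow> ('h::chilbert_space \<Rightarrow>\<^sub>L 'h)"
  assumes P: "\<And>l. is_projection (E l)"
    and mono: "\<And>l m x. l \<le> m \<Longrightarrow> E l x = x \<Longrightarrow> E m x = x"
    and right: "\<And>l x. (\<And>m. l < m \<Longrightarrow> E m x = x) \<Longrightarrow> E l x = x"
    and bounds: "\<And>l. l < - r \<Longrightarrow> E l = 0" "\<And>l. r < l \<Longrightarrow> E l = id_blinfun"
  shows "resolution E"
proof -
  have le: "op_le (E l) (E m)" if "l \<le> m" for l m
    using projection_le_iff[OF P P] mono[OF that] by blast
  have EE: "E m (E l x) = E l x" if "l \<le> m" for l m x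
    using mono[OF that] projectionD(3)[OF P] by blast
  have EE': "E l (E m x) = E l x" if "l \<le> m" for l m x
  proof (rule re_inner_ext)
    fix z show "\<langle>E l (E m x), z\<rangle> = \<langle>E l x, z\<rangle>" using projectionD(2)[OF P] EE[OF that] by simp
  qed
  have "((\<lambda>m. E m x) \<longlongrightarrow> E l x) (at_right l)" for l x
  proof -
    let ?V = "{x. ((\<lambda>m. E m x) \<longlongrightarrow> 0) (at_right l)}"
    have "x - E l x \<in> ?V"
    proof (rule meet_complement_in[of "{l<..}" E "E l" ?V])
      show "E l x = x \<longleftrightarrow> (\<forall>m\<in>{l<..}. E m x = x)" for x
      proof
        show "E l x = x" if "\<forall>m\<in>{l<..}. E m x = x" by (rule right) (use that in simp)
        show "\<forall>m\<in>{l<..}. E m x = x" if "E l x = x" using mono[OF _ that] by simp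
      qed
      show "x - E m x \<in> ?V" if "m \<in> {l<..}" for m x
      proof -
        have "\<forall>\<^sub>F k in at_right l. k < m" using that by (simp add: eventually_at_right_field) blast
        then have "\<forall>\<^sub>F k in at_right l. E k (x - E m x) = 0"
          by eventually_elim (simp add: blinfun.diff_right EE')
        then show ?thesis by (simp add: tendsto_eventually)
      qed
    qed (use P null_space[OF P] in auto)
    then have "((\<lambda>m. E m (x - E l x)) \<longlongrightarrow> 0) (at_right l)" by simp
    then have "((\<lambda>m. E m (x - E l x) + E l x) \<longlongrightarrow> 0 + E l x) (at_right l)"
      by (intro tendsto_add tendsto_const)
    moreover have "\<forall>\<^sub>F m in at_right l. E m (x - E l x) + E l x = E m x"
      using eventually_at_right_less[of l] by eventually_elim (simp add: blinfun.diff_right EE)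
    ultimately show ?thesis using tendsto_cong by force
  qed
  then show ?thesis
    using P le bounds by (auto simp: resolution_def strong_limit_iff)
qed

lemma resolution_form_mono:
  assumes E: "resolution E" and "l \<le> m" shows "\<langle>E l u, u\<rangle> \<le> \<langle>E m u, u\<rangle>"
  using resolution_op_le[OF assms] projectionD(1)[OF resolution_projection[OF E]]
  by (simp add: op_le_iff)

lemma resolution_increment:
  assumes E: "resolution E" and lm: "l \<le> m"
  shows "E l (E m u - E l u) = 0" "E m (E m u - E l u) = E m u - E l u"
    "(norm (E m u - E l u))\<^sup>2 = \<langle>E m u, u\<rangle> - \<langle>E l u, u\<rangle>"
proof -
  have idem: "E k (E k u) = E k u" for k by (rule projectionD(3)[OF resolution_projection[OF E]])
  show "E l (E m u - E l u) = 0" "E m (E m u - E l u) = E m u - E l u"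
    using resolution_compose[OF E lm] idem by (simp_all add: blinfun.diff_right)
  have "\<langle>E k u, E k u\<rangle> = \<langle>E k u, u\<rangle>" for k
    using projectionD(2)[OF resolution_projection[OF E], of k "E k u" u] idem by simp
  moreover have "\<langle>E l u, E m u\<rangle> = \<langle>E l u, u\<rangle>" "\<langle>E m u, E l u\<rangle> = \<langle>E l u, u\<rangle>"
    using projectionD(2)[OF resolution_projection[OF E], of m "E l u" u]
      resolution_compose[OF E lm, of u] re_inner_commute[of "E m u" "E l u"] by auto
  ultimately show "(norm (E m u - E l u))\<^sup>2 = \<langle>E m u, u\<rangle> - \<langle>E l u, u\<rangle>"
    by (simp only: re_inner_self[symmetric] re_inner.diff_left re_inner.diff_right)
qed

section \<open>Stieltjes integrals of the identity function\<close>

text \<open>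
  If \<open>H\<close> behaves like the indefinite integral of \<open>t dg(t)\<close>, integration by parts suggests that
  \<open>K t = t * g t - H t\<close> is an antiderivative of \<open>g\<close>. The two bounds say that the increments of \<open>K\<close>
  satisfy the same estimates as those of the integral of \<open>g\<close>, with a total error that vanishes as
  the subdivision is refined. It is applied to quadratic forms of spectral projections and to the
  Lebesgue-Stieltjes integral.
\<close>

lemma sandwich_integral:
  fixes g H :: "real \<Rightarrow> real"
  assumes g: "\<And>l m. l \<le> m \<Longrightarrow> g l \<le> g m" and ab: "a \<le> b"
    and lower: "\<And>l m. a \<le> l \<Longrightarrow> l \<le> m \<Longrightarrow> m \<le> b \<Longrightarrow> l * (g m - g l) \<le> H m - H l"
    and upper: "\<And>l m. a \<le> l \<Longrightarrow> l \<le> m \<Longrightarrow> m \<le> b \<Longrightarrow> H m - H l \<le> m * (g m - g l)"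
  shows "(g has_integral (b * g b - a * g a - (H b - H a))) {a..b}"
proof -
  have int: "g integrable_on {c..d}" for c d
    by (rule integrable_on_mono_on) (simp add: mono_on_def g)
  define D where "D t = t * g t - H t - integral {a..t} g" for t
  have D: "\<bar>D m - D l\<bar> \<le> (m - l) * (g m - g l)" if lm: "a \<le> l" "l \<le> m" "m \<le> b" for l m
  proof -
    have "integral {a..m} g = integral {a..l} g + integral {l..m} g"
      using Henstock_Kurzweil_Integration.integral_combine[OF lm(1,2) int] by simp
    moreover have "integral {l..m} g \<le> (m - l) * g m" "(m - l) * g l \<le> integral {l..m} g"
      using integral_le[OF int, of "\<lambda>_. g m" l m] integral_le[OF _ int, of "\<lambda>_. g l" l m] g lm by auto
    moreover have "m * g m - H m - (l * g l - H l) \<le> (m - l) * g m"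
      "(m - l) * g l \<le> m * g m - H m - (l * g l - H l)"
      using lower[OF lm] upper[OF lm] by (simp_all add: algebra_simps)
    ultimately show ?thesis unfolding D_def abs_le_iff by (simp add: algebra_simps)
  qed
  have "\<bar>D b - D a\<bar> \<le> (b - a) * (g b - g a) / real (Suc n)" for n
  proof -
    define h where "h = (b - a) / real (Suc n)"
    have h: "0 \<le> h" "real (Suc n) * h = b - a" using ab by (simp_all add: h_def)
    have ub: "a + real i * h \<le> b" if "i \<le> Suc n" for i
    proof -
      have "real i * h \<le> real (Suc n) * h" using that h(1) by (intro mult_right_mono) auto
      then show ?thesis using h(2) by linarith
    qed
    have "\<bar>D (a + real i * h) - D a\<bar> \<le> h * (g (a + real i * h) - g a)" if "i \<le> Suc n" for i
      using that
    proof (induction i)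
      case (Suc i)
      have "\<bar>D (a + real (Suc i) * h) - D (a + real i * h)\<bar>
          \<le> h * (g (a + real (Suc i) * h) - g (a + real i * h))"
        using D[of "a + real i * h" "a + real (Suc i) * h"] ub[of "Suc i"] Suc.prems h(1)
        by (simp add: algebra_simps)
      then show ?case using Suc by (simp add: right_diff_distrib)
    qed simp
    from this[of "Suc n"] show ?thesis using h by (simp add: h_def)
  qed
  moreover have "(\<lambda>n. (b - a) * (g b - g a) / real (Suc n)) \<longlonglongrightarrow> 0"
    using tendsto_mult_right_zero[OF LIMSEQ_Suc[OF lim_1_over_n[where 'a=real]], of "(b - a) * (g b - g a)"]
    by simp
  ultimately have "\<bar>D b - D a\<bar> \<le> 0" using LIMSEQ_le_const by blast
  then have "integral {a..b} g = b * g b - a * g a - (H b - H a)" by (simp add: D_def)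
  then show ?thesis using int integrable_integral by metis
qed

text \<open>
  Integration by parts. The right-hand side is linear in \<open>g\<close>, which the left-hand side is not
  visibly.
\<close>

lemma Stieltjes_integral_iff:
  fixes g :: "real \<Rightarrow> real"
  assumes mono: "\<And>l m. l \<le> m \<Longrightarrow> g l \<le> g m" and right: "\<And>a. continuous (at_right a) g"
    and R: "0 < R" and low: "\<And>l. l \<le> - R \<Longrightarrow> g l = 0" and high: "\<And>l. R \<le> l \<Longrightarrow> g l = c"
  shows "has_bochner_integral (interval_measure g) (\<lambda>l. l) v \<longleftrightarrow> v = R * c - integral {-R..R} g"
proof -
  let ?M = "interval_measure g"
  have em: "emeasure ?M {a<..b} = ennreal (g b - g a)" if "a \<le> b" for a b
    using that by (intro emeasure_interval_measure_Ioc mono right)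
  have "(\<Union>n. {- R - real n<..- R}) \<union> (\<Union>n. {R<..R + real n}) \<in> null_sets ?M"
  proof (intro null_sets.Un null_sets_UN)
    show "{- R - real n<..- R} \<in> null_sets ?M" for n
      using em[of "- R - real n" "- R"] low by (intro null_setsI) auto
    show "{R<..R + real n} \<in> null_sets ?M" for n
      using em[of R "R + real n"] high R by (intro null_setsI) auto
  qed
  moreover have "{l. \<not> (- R < l \<and> l \<le> R)} \<subseteq> (\<Union>n. {- R - real n<..- R}) \<union> (\<Union>n. {R<..R + real n})"
  proof
    fix l assume l: "l \<in> {l. \<not> (- R < l \<and> l \<le> R)}"
    obtain n where "\<bar>l\<bar> < real n" using reals_Archimedean2 by blast
    then have "l \<in> {- R - real n<..- R} \<or> l \<in> {R<..R + real n}" using l R by auto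
    then show "l \<in> (\<Union>n. {- R - real n<..- R}) \<union> (\<Union>n. {R<..R + real n})" by blast
  qed
  ultimately have AE: "AE l in ?M. - R < l \<and> l \<le> R"
    by (intro AE_I') auto
  have "emeasure ?M (space ?M) = emeasure ?M {-R<..R}"
    by (rule emeasure_eq_AE) (use AE in auto)
  then have "finite_measure ?M" using em[of "-R" R] R by (intro finite_measureI) simp
  then interpret finite_measure ?M .
  have meas: "measure ?M {a<..b} = g b - g a" if "a \<le> b" for a b
    using em[OF that] mono[OF that] by (simp add: measure_def)
  have int: "integrable ?M (\<lambda>l. l)"
    by (rule integrable_const_bound[of _ R]) (use AE in auto)
  define H where "H l = (\<integral>x. indicator {-R<..l} x * x \<partial>?M)" for l
  have intI: "integrable ?M (\<lambda>x. indicator {a<..b} x * x)" for a b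
    using integrable_mult_indicator[OF _ int, of "{a<..b}"] by simp
  have intC: "integrable ?M (\<lambda>x. indicator {a<..b} x * k)" for a b k :: real
    by (intro integrable_mult_left integrable_real_indicator) (auto simp: less_top[symmetric])
  have HH: "H m - H l = (\<integral>x. indicator {l<..m} x * x \<partial>?M)" if "- R \<le> l" "l \<le> m" for l m
  proof -
    have "H m - H l = (\<integral>x. indicator {-R<..m} x * x - indicator {-R<..l} x * x \<partial>?M)"
      unfolding H_def by (intro Bochner_Integration.integral_diff[symmetric] intI)
    also have "\<dots> = (\<integral>x. indicator {l<..m} x * x \<partial>?M)"
      using that by (intro Bochner_Integration.integral_cong) (auto simp: indicator_def)
    finally show ?thesis .
  qed
  have C: "(\<integral>x. indicator {l<..m} x * k \<partial>?M) = k * (g m - g l)" if "l \<le> m" for l m k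
    using meas[OF that] by simp
  have "(g has_integral (R * g R - (- R) * g (- R) - (H R - H (- R)))) {-R..R}"
  proof (rule sandwich_integral[OF mono])
    fix l m assume lm: "- R \<le> l" "l \<le> m" "m \<le> R"
    show "l * (g m - g l) \<le> H m - H l"
      unfolding HH[OF lm(1,2)] C[OF lm(2), symmetric]
      by (intro integral_mono intI intC) (auto simp: indicator_def)
    show "H m - H l \<le> m * (g m - g l)"
      unfolding HH[OF lm(1,2)] C[OF lm(2), symmetric]
      by (intro integral_mono intI intC) (auto simp: indicator_def)
  qed (use R in auto)
  moreover have "H R = (\<integral>x. x \<partial>?M)"
    unfolding H_def by (rule integral_cong_AE) (use AE in auto)
  moreover have "H (- R) = 0" by (simp add: H_def)
  ultimately have "integral {-R..R} g = R * c - (\<integral>x. x \<partial>?M)"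
    using low[of "-R"] high[of R] by (simp add: integral_unique)
  then show ?thesis
    using int has_bochner_integral_iff[of ?M "\<lambda>l. l" v] by auto
qed

section \<open>The spectral theorem\<close>

text \<open>
  The algebraic characterization of the spectral family: \<open>E l\<close> reduces \<open>x\<close>, and \<open>x \<le> l\<close> on its range
  and \<open>x \<ge> l\<close> on the complement. By \<open>is_spectral_family_iff_bounds\<close> it is equivalent to
  \<open>x = \<integral> l dE\<^sub>l\<close>, and it is the form in which the spectral family is used.
\<close>

definition spectral_bounds :: "('h::chilbert_space \<Rightarrow>\<^sub>L 'h) \<Rightarrow> (real \<Rightarrow> ('h \<Rightarrow>\<^sub>L 'h)) \<Rightarrow> bool"
  where "spectral_bounds x E \<longleftrightarrow> selfadjoint x \<and> resolution E \<and> (\<forall>l u. E l (x u) = x (E l u)) \<and>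
    (\<forall>l u. E l u = u \<longrightarrow> \<langle>x u, u\<rangle> \<le> l * (norm u)\<^sup>2) \<and>
    (\<forall>l u. E l u = 0 \<longrightarrow> l * (norm u)\<^sup>2 \<le> \<langle>x u, u\<rangle>)"

lemma spectral_boundsD:
  assumes "spectral_bounds x E"
  shows "selfadjoint x" "resolution E" "E l (x u) = x (E l u)"
    "E l u = u \<Longrightarrow> \<langle>x u, u\<rangle> \<le> l * (norm u)\<^sup>2"
    "E l u = 0 \<Longrightarrow> l * (norm u)\<^sup>2 \<le> \<langle>x u, u\<rangle>"
    "is_projection (E l)"
  using assms by (auto simp: spectral_bounds_def resolution_projection)

lemma projection_orthogonal:
  assumes "is_projection p" "p u = u" "p v = 0" shows "\<langle>u, v\<rangle> = 0"
  using projectionD(2)[OF assms(1), of u v] assms by (simp add: re_inner.zero_right)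

lemma spectral_bounds_integral:
  assumes S: "spectral_bounds x E" and R: "0 < R" "\<forall>l\<le>- R. E l = 0" "\<forall>l\<ge>R. E l = id_blinfun"
  shows "((\<lambda>l. \<langle>E l u, u\<rangle>) has_integral (R * (norm u)\<^sup>2 - \<langle>x u, u\<rangle>)) {-R..R}"
proof -
  note D = spectral_boundsD[OF S]
  define H where "H l = \<langle>x (E l u), E l u\<rangle>" for l
  have HH: "H m - H l = \<langle>x (E m u - E l u), E m u - E l u\<rangle>" if "l \<le> m" for l m
  proof -
    let ?d = "E m u - E l u"
    have d: "E l ?d = 0" by (rule resolution_increment(1)[OF D(2) that])
    have w: "E l (x (E l u)) = x (E l u)" using D(3) projectionD(3)[OF D(6)] by simp
    have "\<langle>x (E l u), ?d\<rangle> = 0" by (rule projection_orthogonal[OF D(6) w d])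
    moreover from this have "\<langle>x ?d, E l u\<rangle> = 0"
      using selfadjointD[OF D(1), of ?d "E l u"] by (simp add: re_inner_commute)
    moreover have "H m = \<langle>x (E l u + ?d), E l u + ?d\<rangle>" by (simp add: H_def)
    ultimately show ?thesis
      by (simp only: H_def blinfun.add_right re_inner.add_left re_inner.add_right)
  qed
  have "((\<lambda>l. \<langle>E l u, u\<rangle>) has_integral
      (R * \<langle>E R u, u\<rangle> - (- R) * \<langle>E (- R) u, u\<rangle> - (H R - H (- R)))) {-R..R}"
  proof (rule sandwich_integral)
    fix l m assume "- R \<le> l" and lm: "l \<le> m" and "m \<le> R"
    note inc = resolution_increment[OF D(2) lm, of u]
    show "l * (\<langle>E m u, u\<rangle> - \<langle>E l u, u\<rangle>) \<le> H m - H l"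
      unfolding HH[OF lm] inc(3)[symmetric] by (rule D(5)[OF inc(1)])
    show "H m - H l \<le> m * (\<langle>E m u, u\<rangle> - \<langle>E l u, u\<rangle>)"
      unfolding HH[OF lm] inc(3)[symmetric] by (rule D(4)[OF inc(2)])
  qed (use R(1) resolution_form_mono[OF D(2)] in auto)
  then show ?thesis using R(2,3)
    by (simp add: H_def re_inner.zero_left re_inner_self blinfun.zero_right)
qed

lemma is_spectral_family_formula:
  assumes E: "resolution E" and R: "0 < R" "\<forall>l\<le>- R. E l = 0" "\<forall>l\<ge>R. E l = id_blinfun"
  shows "is_spectral_family x E \<longleftrightarrow>
    (\<forall>u. \<langle>x u, u\<rangle> = R * (norm u)\<^sup>2 - integral {-R..R} (\<lambda>l. \<langle>E l u, u\<rangle>))"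
proof -
  have "has_bochner_integral (interval_measure (\<lambda>l. \<langle>E l u, u\<rangle>)) (\<lambda>l. l) \<langle>x u, u\<rangle> \<longleftrightarrow>
      \<langle>x u, u\<rangle> = R * (norm u)\<^sup>2 - integral {-R..R} (\<lambda>l. \<langle>E l u, u\<rangle>)" for u
  proof (rule Stieltjes_integral_iff[OF _ _ R(1)])
    show "continuous (at_right a) (\<lambda>l. \<langle>E l u, u\<rangle>)" for a
      unfolding continuous_within
      by (intro re_inner.tendsto resolution_right_lim[OF E] tendsto_const)
  qed (use resolution_form_mono[OF E] R in \<open>auto simp: re_inner.zero_left re_inner_self\<close>)
  then show ?thesis using E by (simp add: is_spectral_family_iff)
qed

text \<open>
  A subspace invariant under a self-adjoint operator reduces it.
\<close>

lemma commute_if_invariant: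
  assumes x: "selfadjoint x" and p: "is_projection p" and inv: "\<And>u. p (x (p u)) = x (p u)"
  shows "p (x u) = x (p u)"
proof (rule re_inner_ext)
  fix v
  have "\<langle>p (x u), v\<rangle> = \<langle>u, x (p v)\<rangle>" using projectionD(2)[OF p] selfadjointD[OF x] by simp
  also have "\<dots> = \<langle>u, p (x (p v))\<rangle>" by (simp only: inv)
  also have "\<dots> = \<langle>p (x (p u)), v\<rangle>" using projectionD(2)[OF p] selfadjointD[OF x] by simp
  finally show "\<langle>p (x u), v\<rangle> = \<langle>x (p u), v\<rangle>" by (simp only: inv)
qed

text \<open>
  For the converse direction, \<open>x = R - \<integral> E l dl\<close> in the weak sense. For \<open>u\<close> in the range of \<open>E l\<close> and
  \<open>v\<close> in its complement, the quadratic form of every \<open>E k\<close> is additive on \<open>u + v\<close>; integrating,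
  the one of \<open>x\<close> is additive too, so \<open>\<langle>x u, v\<rangle> = 0\<close>.
\<close>

lemma is_spectral_family_iff_bounds:
  assumes x: "selfadjoint x"
  shows "is_spectral_family x E \<longleftrightarrow> spectral_bounds x E"
proof
  assume S: "spectral_bounds x E"
  note D = spectral_boundsD[OF S]
  obtain R where R: "0 < R" "\<forall>l\<le>- R. E l = 0" "\<forall>l\<ge>R. E l = id_blinfun"
    using resolution_bound[OF D(2)] by metis
  show "is_spectral_family x E"
    by (rule is_spectral_family_formula[OF D(2) R, THEN iffD2])
      (simp add: integral_unique[OF spectral_bounds_integral[OF S R]])
next
  assume S: "is_spectral_family x E"
  then have E: "resolution E" by (simp add: is_spectral_family_iff)
  note P = resolution_projection[OF E]
  have int: "(\<lambda>k. \<langle>E k u, u\<rangle>) integrable_on {a..b}" for u a b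
    by (rule integrable_on_mono_on) (simp add: mono_on_def resolution_form_mono[OF E])
  have *: "E l (x u) = x (E l u) \<and> (E l u = u \<longrightarrow> \<langle>x u, u\<rangle> \<le> l * (norm u)\<^sup>2) \<and>
    (E l u = 0 \<longrightarrow> l * (norm u)\<^sup>2 \<le> \<langle>x u, u\<rangle>)" for l u
  proof -
    obtain R where Rl: "R > \<bar>l\<bar>" and R: "0 < R" "\<forall>l\<le>- R. E l = 0" "\<forall>l\<ge>R. E l = id_blinfun"
      using resolution_bound[OF E, of "\<bar>l\<bar>"] by metis
    have formula: "\<langle>x u, u\<rangle> = R * (norm u)\<^sup>2 - integral {-R..R} (\<lambda>l. \<langle>E l u, u\<rangle>)" for u
      using S is_spectral_family_formula[OF E R] by blast
    have split: "integral {-R..R} (\<lambda>k. \<langle>E k u, u\<rangle>)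
        = integral {-R..l} (\<lambda>k. \<langle>E k u, u\<rangle>) + integral {l..R} (\<lambda>k. \<langle>E k u, u\<rangle>)" for u
      using Henstock_Kurzweil_Integration.integral_combine[of "-R" l R, OF _ _ int] Rl by simp
    have upper: "\<langle>x u, u\<rangle> \<le> l * (norm u)\<^sup>2" if u: "E l u = u" for u
    proof -
      have "0 \<le> integral {-R..l} (\<lambda>k. \<langle>E k u, u\<rangle>)"
        by (intro Henstock_Kurzweil_Integration.integral_nonneg int) (simp add: projectionD(4)[OF P])
      moreover have "integral {l..R} (\<lambda>k. \<langle>E k u, u\<rangle>) = integral {l..R} (\<lambda>k. (norm u)\<^sup>2)"
      proof (rule Henstock_Kurzweil_Integration.integral_cong)
        fix k assume "k \<in> {l..R}"
        then have "E k u = u" using resolution_mono[OF E _ u] by simp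
        then show "\<langle>E k u, u\<rangle> = (norm u)\<^sup>2" by (simp add: re_inner_self)
      qed
      moreover have "integral {l..R} (\<lambda>k. (norm u)\<^sup>2) = R * (norm u)\<^sup>2 - l * (norm u)\<^sup>2"
      proof -
        have "l \<le> R" using Rl by linarith
        then show ?thesis by (simp add: algebra_simps)
      qed
      ultimately show ?thesis using formula[of u] split[of u] by simp
    qed
    have lower: "l * (norm u)\<^sup>2 \<le> \<langle>x u, u\<rangle>" if u: "E l u = 0" for u
    proof -
      have "integral {-R..l} (\<lambda>k. \<langle>E k u, u\<rangle>) = integral {-R..l} (\<lambda>k. 0)"
      proof (rule Henstock_Kurzweil_Integration.integral_cong)
        fix k assume "k \<in> {-R..l}"
        then have "E k u = E k (E l u)" using resolution_compose(2)[OF E, of k l u] by simp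
        then show "\<langle>E k u, u\<rangle> = 0" using u by (simp add: blinfun.zero_right re_inner.zero_left)
      qed
      moreover have "integral {l..R} (\<lambda>k. \<langle>E k u, u\<rangle>) \<le> integral {l..R} (\<lambda>k. (norm u)\<^sup>2)"
        by (intro integral_le int) (auto simp: projectionD(4)[OF P] projectionD(5)[OF P] intro!: power_mono)
      moreover have "integral {l..R} (\<lambda>k. (norm u)\<^sup>2) = R * (norm u)\<^sup>2 - l * (norm u)\<^sup>2"
      proof -
        have "l \<le> R" using Rl by linarith
        then show ?thesis by (simp add: algebra_simps)
      qed
      ultimately show ?thesis using formula[of u] split[of u] by simp
    qed
    have orth: "\<langle>x u, v\<rangle> = 0" if u: "E l u = u" and v: "E l v = 0" for u v
    proof -
      have "\<langle>E k (u + v), u + v\<rangle> = \<langle>E k u, u\<rangle> + \<langle>E k v, v\<rangle>" for k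
      proof -
        have "\<langle>E k u, v\<rangle> = 0"
        proof (cases "k \<le> l")
          case True
          have "E l (E k u) = E k u" by (rule resolution_compose(1)[OF E True])
          then show ?thesis using projection_orthogonal[OF P _ v] by blast
        next
          case False
          then have "E k u = u" using resolution_mono[OF E _ u] by simp
          then show ?thesis using projection_orthogonal[OF P u v] by simp
        qed
        moreover from this have "\<langle>E k v, u\<rangle> = 0"
          using projectionD(2)[OF P, of k v u] by (simp add: re_inner_commute)
        ultimately show ?thesis by (simp add: blinfun.add_right re_inner.add_left re_inner.add_right)
      qed
      then have "integral {-R..R} (\<lambda>k. \<langle>E k (u + v), u + v\<rangle>)
          = integral {-R..R} (\<lambda>k. \<langle>E k u, u\<rangle>) + integral {-R..R} (\<lambda>k. \<langle>E k v, v\<rangle>)"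
        by (simp add: Henstock_Kurzweil_Integration.integral_add int)
      moreover have "(norm (u + v))\<^sup>2 = (norm u)\<^sup>2 + (norm v)\<^sup>2"
        using projection_orthogonal[OF P u v]
        by (simp add: re_inner_self[symmetric] re_inner.add_left re_inner.add_right re_inner_commute[of v u])
      ultimately have "\<langle>x (u + v), u + v\<rangle> = \<langle>x u, u\<rangle> + \<langle>x v, v\<rangle>"
        unfolding formula by (simp add: algebra_simps)
      moreover have "\<langle>x v, u\<rangle> = \<langle>x u, v\<rangle>" using selfadjointD[OF x] re_inner_commute by metis
      ultimately show ?thesis by (simp add: blinfun.add_right re_inner.add_left re_inner.add_right)
    qed
    have inv: "E l (x (E l u)) = x (E l u)" for u
    proof (rule re_inner_ext)
      fix v
      have "\<langle>x (E l u), v - E l v\<rangle> = 0"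
        by (rule orth) (simp_all add: projectionD(3)[OF P] blinfun.diff_right)
      then show "\<langle>E l (x (E l u)), v\<rangle> = \<langle>x (E l u), v\<rangle>"
        using projectionD(2)[OF P] by (simp add: re_inner.diff_right)
    qed
    show ?thesis using upper lower commute_if_invariant[OF x P inv] by blast
  qed
  show "spectral_bounds x E" unfolding spectral_bounds_def using x E * by blast
qed

text \<open>
  With \<open>P l\<close> and \<open>N l\<close> the positive and negative parts of \<open>x - l\<close>, let \<open>E l\<close> be the projection onto
  the kernel of \<open>P l\<close>. There \<open>x - l = - N l \<le> 0\<close>; and as \<open>P l\<close> annihilates the range of \<open>N l\<close>, the
  operator \<open>N l\<close> vanishes on the complement, where therefore \<open>x - l = P l \<ge> 0\<close>.
\<close>

lemma spectral_bounds_exists: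
  assumes x: "selfadjoint x"
  shows "\<exists>E. spectral_bounds x E"
proof -
  define M where "M = norm x + 1"
  have M: "form_between (- M) M x" by (rule form_between_norm[OF x]) (simp add: M_def)
  let ?f = "\<lambda>l t::real. max (t - l) 0"
  have "\<exists>b. fun_calc (- M) M x (?f l) b" for l
    by (rule fun_calc_exists[OF M]) (intro continuous_intros)
  then obtain P where P: "\<And>l. fun_calc (- M) M x (?f l) (P l)" by metis
  have pos: "positive_op (P l)" for l by (rule fun_calc_positive[OF M P]) simp
  have comm: "P l (x u) = x (P l u)" for l u by (rule fun_calc_commute[OF P]) simp
  define N where "N l = P l - (x - l *\<^sub>R id_blinfun)" for l
  have N: "fun_calc (- M) M x (\<lambda>t. ?f l t - (t - l)) (N l)" for l
    unfolding N_def by (intro fun_calc_diff P fun_calc_id fun_calc_const)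
  have Npos: "positive_op (N l)" for l by (rule fun_calc_positive[OF M N]) simp
  have "P l o\<^sub>L N l = 0 *\<^sub>R id_blinfun" for l
    by (rule fun_calc_eqI[OF M fun_calc_mult[OF P N] fun_calc_const]) (simp add: max_def)
  then have PN: "P l (N l u) = 0" for l u
    by (metis blinfun_apply_blinfun_compose scale_zero_left zero_blinfun.rep_eq)
  have "\<exists>p. is_projection p \<and> (\<forall>u. p u = u \<longleftrightarrow> u \<in> {u. P l u = 0})" for l
  proof (rule projection_onto)
    show "subspace {u. P l u = 0}" by (auto simp: subspace_def blinfun_simps blinfun.zero_right)
    show "closed {u. P l u = 0}" by (intro closed_Collect_eq continuous_intros)
    show "\<i> *\<^sub>C u \<in> {u. P l u = 0}" if "u \<in> {u. P l u = 0}" for u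
    proof -
      have "P l (\<i> *\<^sub>C u) = \<i> *\<^sub>C P l u"
        using positive_selfadjoint[OF pos] by (simp add: selfadjoint_iff complex_linear_def)
      then have "norm (P l (\<i> *\<^sub>C u)) = 0" using that by (simp add: norm_scaleC)
      then show ?thesis by simp
    qed
  qed
  then have "\<exists>p. is_projection p \<and> (\<forall>u. p u = u \<longleftrightarrow> P l u = 0)" for l by simp
  then obtain E where E: "\<And>l. is_projection (E l)" "\<And>l u. E l u = u \<longleftrightarrow> P l u = 0" by metis
  have PE: "P l (E l u) = 0" for l u using E(2)[of l "E l u"] projectionD(3)[OF E(1)] by simp
  have xform: "\<langle>x u, u\<rangle> = l * (norm u)\<^sup>2 + \<langle>P l u, u\<rangle> - \<langle>N l u, u\<rangle>" for l u
    by (simp add: N_def blinfun_simps re_inner_simps re_inner_self)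
  have res: "resolution E"
  proof (rule resolutionI[OF E(1)])
    show "E m u = u" if "l \<le> m" "E l u = u" for l m u
    proof -
      have "\<langle>P m u, u\<rangle> \<le> \<langle>P l u, u\<rangle>" by (rule fun_calc_mono[OF M P P]) (use that in auto)
      also have "\<dots> = 0" using that E(2) by (simp add: re_inner.zero_left)
      finally have "\<langle>P m u, u\<rangle> = 0" using pos[of m] by (simp add: positive_op_iff antisym)
      then show ?thesis using positive_kernel[OF pos] E(2) by blast
    qed
    show "E l u = u" if *: "\<And>m. l < m \<Longrightarrow> E m u = u" for l u
    proof -
      have "\<langle>P l u, u\<rangle> \<le> 0"
      proof (rule field_le_epsilon)
        fix e :: real assume e: "0 < e"
        define d where "d = e / ((norm u)\<^sup>2 + 1)"
        have n1: "0 < (norm u)\<^sup>2 + 1" by (simp add: add_nonneg_pos)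
        have d: "0 < d" "d * (norm u)\<^sup>2 \<le> e" using e n1 by (auto simp: d_def divide_simps mult_left_mono)
        have "\<langle>(P l - P (l + d)) u, u\<rangle> \<le> \<langle>(d *\<^sub>R id_blinfun) u, u\<rangle>"
          by (rule fun_calc_mono[OF M fun_calc_diff[OF P P] fun_calc_const]) (use d in auto)
        moreover have "P (l + d) u = 0" using *[of "l + d"] d E(2) by simp
        ultimately show "\<langle>P l u, u\<rangle> \<le> 0 + e"
          using d(2) by (simp add: blinfun_simps re_inner_simps re_inner_self)
      qed
      then have "\<langle>P l u, u\<rangle> = 0" using pos[of l] by (simp add: positive_op_iff antisym)
      then show ?thesis using positive_kernel[OF pos] E(2) by blast
    qed
    show "E l = 0" if "l < - M" for l
    proof (rule blinfun_eqI)
      fix u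
      let ?w = "E l u"
      have "\<langle>((- M - l) *\<^sub>R id_blinfun) ?w, ?w\<rangle> \<le> \<langle>P l ?w, ?w\<rangle>"
        by (rule fun_calc_mono[OF M fun_calc_const P]) auto
      then have "(- M - l) * (norm ?w)\<^sup>2 \<le> 0"
        using PE by (simp add: blinfun_simps re_inner_simps re_inner_self re_inner.zero_left)
      then show "E l u = blinfun_apply 0 u" using that by (simp add: mult_le_0_iff)
    qed
    show "E l = id_blinfun" if "M < l" for l
    proof (rule blinfun_eqI)
      fix u
      have "P l = 0 *\<^sub>R id_blinfun" by (rule fun_calc_eqI[OF M P fun_calc_const]) (use that in simp)
      then have "P l u = 0" by simp
      then show "E l u = id_blinfun u" using E(2) by simp
    qed
  qed
  have "E l (x (E l u)) = x (E l u)" for l u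
    unfolding E(2) comm by (simp add: PE blinfun.zero_right)
  then have "E l (x u) = x (E l u)" for l u by (rule commute_if_invariant[OF x E(1)])
  moreover have "\<langle>x u, u\<rangle> \<le> l * (norm u)\<^sup>2" if "E l u = u" for l u
    using xform[of u l] that E(2) Npos[of l] by (simp add: positive_op_iff re_inner.zero_left)
  moreover have "l * (norm u)\<^sup>2 \<le> \<langle>x u, u\<rangle>" if u: "E l u = 0" for l u
  proof -
    have "N l u = 0"
    proof (rule re_inner_ext)
      fix v
      have "E l (N l v) = N l v" using E(2) PN by simp
      then have "\<langle>N l v, u\<rangle> = 0" by (rule projection_orthogonal[OF E(1) _ u])
      then show "\<langle>N l u, v\<rangle> = \<langle>0, v\<rangle>"
        using selfadjointD[OF positive_selfadjoint[OF Npos], of l u v]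
        by (simp add: re_inner_commute[of u] re_inner.zero_left)
    qed
    then show ?thesis using xform[of u l] pos[of l] by (simp add: positive_op_iff re_inner.zero_left)
  qed
  ultimately show ?thesis using res x unfolding spectral_bounds_def by blast
qed

section \<open>Growth of powers and spectral subspaces\<close>

lemma spectral_bounds_power_commute:
  assumes S: "spectral_bounds x E"
  shows "E l (op_power x n u) = op_power x n (E l u)"
  using op_power_commute_apply[of x "E l" n u] spectral_boundsD(3)[OF S] by simp

lemma spectral_bounds_negative:
  assumes S: "spectral_bounds x E" and x: "positive_op x" and l: "l < 0"
  shows "E l = 0"
proof (rule blinfun_eqI)
  fix u
  have "0 \<le> \<langle>x (E l u), E l u\<rangle>" using x by (simp add: positive_op_iff)
  also have "\<dots> \<le> l * (norm (E l u))\<^sup>2"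
    by (rule spectral_boundsD(4)[OF S]) (rule projectionD(3)[OF spectral_boundsD(6)[OF S]])
  finally show "E l u = blinfun_apply 0 u" using l by (simp add: zero_le_mult_iff)
qed

lemma power_form_upper:
  assumes S: "spectral_bounds x E" and x: "positive_op x" and l: "0 \<le> l" and u: "E l u = u"
  shows "\<langle>op_power x n u, u\<rangle> \<le> l ^ n * (norm u)\<^sup>2"
proof -
  note D = spectral_boundsD[OF S]
  have step: "norm (x v) \<le> l * norm v" if v: "E l v = v" for v
  proof -
    let ?b = "E l o\<^sub>L x o\<^sub>L E l"
    have b: "\<langle>?b w, w\<rangle> = \<langle>x (E l w), E l w\<rangle>" for w using projectionD(2)[OF D(6)] by simp
    have "positive_op ?b"
      unfolding positive_op_iff b using x selfadjoint_conj[OF D(1) projectionD(1)[OF D(6)]]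
      by (simp add: positive_op_iff)
    moreover have "\<langle>?b w, w\<rangle> \<le> l * (norm w)\<^sup>2" for w
    proof -
      have "\<langle>x (E l w), E l w\<rangle> \<le> l * (norm (E l w))\<^sup>2"
        by (rule D(4)) (rule projectionD(3)[OF D(6)])
      also have "\<dots> \<le> l * (norm w)\<^sup>2"
        using l projectionD(5)[OF D(6)] by (intro mult_left_mono power_mono) auto
      finally show ?thesis unfolding b .
    qed
    ultimately have "norm (?b v) \<le> l * norm v" by (rule positive_norm_bound)
    then show ?thesis using v D(3)[of l v] by simp
  qed
  have n: "norm (op_power x n u) \<le> l ^ n * norm u"
  proof (induction n)
    case (Suc n)
    have "norm (op_power x (Suc n) u) \<le> l * norm (op_power x n u)"
      unfolding op_power_Suc_apply by (rule step) (simp add: spectral_bounds_power_commute[OF S] u)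
    also have "\<dots> \<le> l * (l ^ n * norm u)" using Suc l by (rule mult_left_mono)
    finally show ?case by simp
  qed simp
  have "\<langle>op_power x n u, u\<rangle> \<le> norm (op_power x n u) * norm u"
    using re_inner_Cauchy_Schwarz[of "op_power x n u" u] by linarith
  also have "\<dots> \<le> (l ^ n * norm u) * norm u" using n by (rule mult_right_mono) simp
  finally show ?thesis by (simp add: power2_eq_square mult.assoc)
qed

text \<open>
  A Chebyshev inequality: on the kernel of \<open>E l\<close> the operator \<open>x\<close> is at least \<open>l\<close> and expands norms by
  at least \<open>l\<close>, so the form of \<open>x\<^sup>n\<close> gains a factor \<open>l\<^sup>2\<close> when \<open>n\<close> grows by two.
\<close>

lemma power_form_lower:
  assumes S: "spectral_bounds x E" and x: "positive_op x" and l: "0 \<le> l"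
  shows "l ^ n * (norm (u - E l u))\<^sup>2 \<le> \<langle>op_power x n u, u\<rangle>"
proof -
  note D = spectral_boundsD[OF S]
  have low: "l ^ n * (norm v)\<^sup>2 \<le> \<langle>op_power x n v, v\<rangle>" if "E l v = 0" for v n
    using that
  proof (induction n arbitrary: v rule: induct_nat_012)
    case 0
    show ?case by (simp add: re_inner_self)
  next
    case 1
    then show ?case using D(5)[OF 1] by simp
  next
    case (ge2 n)
    have "l * (norm v)\<^sup>2 \<le> norm (x v) * norm v"
      using D(5)[OF ge2.prems] re_inner_Cauchy_Schwarz[of "x v" v] by linarith
    then have "l * norm v \<le> norm (x v)"
      by (cases "norm v = 0") (auto simp: power2_eq_square)
    then have "(l * norm v)\<^sup>2 \<le> (norm (x v))\<^sup>2" using l by (intro power_mono) auto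
    then have "l ^ n * (l * norm v)\<^sup>2 \<le> l ^ n * (norm (x v))\<^sup>2" using l by (intro mult_left_mono) auto
    also have "\<dots> \<le> \<langle>op_power x n (x v), x v\<rangle>"
      by (rule ge2.IH(1)) (simp add: D(3) ge2.prems blinfun.zero_right)
    also have "\<dots> = \<langle>op_power x (Suc (Suc n)) v, v\<rangle>"
      using selfadjointD[OF D(1)] op_power_commute_apply[of x x n v]
      by (simp add: op_power_Suc_apply)
    finally show ?case by (simp add: power_mult_distrib power2_eq_square algebra_simps)
  qed
  let ?w = "E l u" and ?v = "u - E l u" and ?p = "op_power x n"
  have w: "E l (?p ?w) = ?p ?w" and v: "E l ?v = 0" and v': "E l (?p ?v) = 0" and ww: "E l ?w = ?w"
    by (simp_all add: spectral_bounds_power_commute[OF S] projectionD(3)[OF D(6)] blinfun.diff_right)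
  have "\<langle>?p u, u\<rangle> = \<langle>?p (?w + ?v), ?w + ?v\<rangle>" by simp
  also have "\<dots> = \<langle>?p ?w, ?w\<rangle> + \<langle>?p ?v, ?v\<rangle>"
    using projection_orthogonal[OF D(6) w v] projection_orthogonal[OF D(6) ww v']
    by (simp only: blinfun.add_right re_inner.add_left re_inner.add_right) (simp add: re_inner_commute)
  finally have "\<langle>?p ?v, ?v\<rangle> \<le> \<langle>?p u, u\<rangle>"
    using positive_power[OF x, of n] by (simp add: positive_op_iff)
  then show ?thesis using low[OF v, of n] by linarith
qed

text \<open>
  If powers grow at most like \<open>l\<^sup>n\<close> on \<open>u\<close>, then for \<open>m > l\<close> the Chebyshev inequality bounds the
  component of \<open>u\<close> above \<open>m\<close> by a multiple of \<open>(l/m)\<^sup>n\<close>. The exponent zero is left out to match vectors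
  on which only positive powers are controlled. The right-hand side does not mention \<open>E\<close>, so the
  spectral family is unique.
\<close>

lemma spectral_subspace_iff_growth:
  assumes S: "spectral_bounds x E" and x: "positive_op x" and l: "0 \<le> l"
  shows "E l u = u \<longleftrightarrow> (\<exists>C. \<forall>n>0. \<langle>op_power x n u, u\<rangle> \<le> C * l ^ n)"
proof
  assume "E l u = u"
  then have "\<forall>n>0. \<langle>op_power x n u, u\<rangle> \<le> (norm u)\<^sup>2 * l ^ n"
    using power_form_upper[OF S x l, of u] by (simp add: mult.commute)
  then show "\<exists>C. \<forall>n>0. \<langle>op_power x n u, u\<rangle> \<le> C * l ^ n" by blast
next
  assume "\<exists>C. \<forall>n>0. \<langle>op_power x n u, u\<rangle> \<le> C * l ^ n"
  then obtain C where C: "\<And>n. 0 < n \<Longrightarrow> \<langle>op_power x n u, u\<rangle> \<le> C * l ^ n" by blast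
  show "E l u = u"
  proof (rule resolution_right[OF spectral_boundsD(2)[OF S]])
    fix m assume m: "l < m"
    have "(norm (u - E m u))\<^sup>2 \<le> C * (l / m) ^ Suc n" for n
    proof -
      have "m ^ Suc n * (norm (u - E m u))\<^sup>2 \<le> \<langle>op_power x (Suc n) u, u\<rangle>"
        using power_form_lower[OF S x, of m "Suc n" u] m l by simp
      also have "\<dots> \<le> C * l ^ Suc n" by (rule C) simp
      finally show ?thesis using m l by (simp add: power_divide field_simps del: power_Suc)
    qed
    moreover have "(\<lambda>n. C * (l / m) ^ Suc n) \<longlonglongrightarrow> C * 0"
      using m l by (intro tendsto_mult tendsto_const LIMSEQ_Suc LIMSEQ_power_zero) simp
    ultimately have "(norm (u - E m u))\<^sup>2 \<le> C * 0" using LIMSEQ_le_const by blast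
    then show "E m u = u" by simp
  qed
qed

lemma resolution_shift:
  assumes E: "resolution E" shows "resolution (\<lambda>l. E (l - c))"
proof -
  obtain R where R: "0 < R" "\<forall>l\<le>- R. E l = 0" "\<forall>l\<ge>R. E l = id_blinfun"
    using resolution_bound[OF E] by metis
  show ?thesis
  proof (rule resolutionI[where r = "R + \<bar>c\<bar>"])
    show "E (m - c) u = u" if "l \<le> m" "E (l - c) u = u" for l m u
      using resolution_mono[OF E _ that(2)] that(1) by simp
    show "E (l - c) u = u" if *: "\<And>m. l < m \<Longrightarrow> E (m - c) u = u" for l u
    proof (rule resolution_right[OF E])
      fix m assume "l - c < m" then show "E m u = u" using *[of "m + c"] by simp
    qed
  qed (use R resolution_projection[OF E] in auto)
qed

lemma spectral_bounds_shift:
  assumes S: "spectral_bounds x E"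
  shows "spectral_bounds (x + c *\<^sub>R id_blinfun) (\<lambda>l. E (l - c))"
proof -
  note D = spectral_boundsD[OF S]
  have q: "\<langle>(x + c *\<^sub>R id_blinfun) u, u\<rangle> = \<langle>x u, u\<rangle> + c * (norm u)\<^sup>2" for u
    by (simp add: blinfun_simps re_inner_simps re_inner_self)
  show ?thesis
    unfolding spectral_bounds_def q
  proof (intro conjI allI impI)
    show "selfadjoint (x + c *\<^sub>R id_blinfun)"
      by (intro selfadjoint_add selfadjoint_scaleR D(1) selfadjoint_id)
    show "E (l - c) ((x + c *\<^sub>R id_blinfun) u) = (x + c *\<^sub>R id_blinfun) (E (l - c) u)" for l u
      by (simp add: blinfun_simps D(3))
    show "\<langle>x u, u\<rangle> + c * (norm u)\<^sup>2 \<le> l * (norm u)\<^sup>2" if "E (l - c) u = u" for l u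
      using D(4)[OF that] by (simp add: algebra_simps)
    show "l * (norm u)\<^sup>2 \<le> \<langle>x u, u\<rangle> + c * (norm u)\<^sup>2" if "E (l - c) u = 0" for l u
      using D(5)[OF that] by (simp add: algebra_simps)
  qed (rule resolution_shift[OF D(2)])
qed

lemma spectral_bounds_unique:
  assumes S: "spectral_bounds x E" and S': "spectral_bounds x E'"
  shows "E = E'"
proof
  fix l
  \<comment> \<open>shifts \<open>x\<close> to a positive operator and \<open>l\<close> to a nonnegative level\<close>
  define c where "c = norm x + \<bar>l\<bar>"
  let ?x = "x + c *\<^sub>R id_blinfun"
  have "norm x * (norm u)\<^sup>2 \<le> c * (norm u)\<^sup>2" for u :: 'a
    by (intro mult_right_mono) (auto simp: c_def)
  then have pos: "positive_op ?x"
    unfolding positive_op_iff using spectral_boundsD(1)[OF spectral_bounds_shift[OF S]] form_le_norm(2)[of x]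
    by (simp add: blinfun_simps re_inner_simps re_inner_self) (smt (verit))
  have l: "0 \<le> l + c" using norm_ge_zero[of x] abs_ge_minus_self[of l] unfolding c_def by linarith
  have "E (l + c - c) = E' (l + c - c)"
  proof (rule projection_eqI)
    show "E (l + c - c) u = u \<longleftrightarrow> E' (l + c - c) u = u" for u
      using spectral_subspace_iff_growth[OF spectral_bounds_shift[OF S] pos l]
        spectral_subspace_iff_growth[OF spectral_bounds_shift[OF S'] pos l] by simp
  qed (use spectral_boundsD(6)[OF S] spectral_boundsD(6)[OF S'] in auto)
  then show "E l = E' l" by simp
qed

lemma spectral_family_eqI:
  assumes "spectral_bounds x E" shows "spectral_family x = E"
  unfolding spectral_family_def
proof (rule the_equality)
  note sa = spectral_boundsD(1)[OF assms]
  show "is_spectral_family x E" using assms is_spectral_family_iff_bounds[OF sa] by simp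
  show "F = E" if "is_spectral_family x F" for F
    using that is_spectral_family_iff_bounds[OF sa] spectral_bounds_unique[OF _ assms] by simp
qed

lemma spectral_family_bounds:
  assumes "selfadjoint x" shows "spectral_bounds x (spectral_family x)"
proof -
  obtain E where "spectral_bounds x E" using spectral_bounds_exists[OF assms] by blast
  then show ?thesis using spectral_family_eqI[of x E] by simp
qed

section \<open>The operator of a resolution\<close>

lemma left_Riemann_sum:
  fixes g :: "real \<Rightarrow> real"
  assumes g: "\<And>l m. l \<le> m \<Longrightarrow> g l \<le> g m" and h: "0 \<le> h"
  shows "\<bar>integral {a..a + real n * h} g - h * (\<Sum>i<n. g (a + real i * h))\<bar> \<le> h * (g (a + real n * h) - g a)"
proof (induction n)
  case (Suc n)
  have int: "g integrable_on {c..d}" for c d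
    by (rule integrable_on_mono_on) (simp add: mono_on_def g)
  let ?l = "a + real n * h" and ?m = "a + real (Suc n) * h"
  have lm: "a \<le> ?l" "?l \<le> ?m" "?m - ?l = h" using h by (auto simp: algebra_simps)
  have "integral {a..?m} g = integral {a..?l} g + integral {?l..?m} g"
    using Henstock_Kurzweil_Integration.integral_combine[OF lm(1,2) int] by simp
  moreover have "integral {?l..?m} g \<le> (?m - ?l) * g ?m" "(?m - ?l) * g ?l \<le> integral {?l..?m} g"
    using integral_le[OF int, of "\<lambda>_. g ?m" ?l ?m] integral_le[OF _ int, of "\<lambda>_. g ?l" ?l ?m] g lm
    by auto
  ultimately have "\<bar>integral {a..?m} g - (integral {a..?l} g + h * g ?l)\<bar> \<le> h * g ?m - h * g ?l"
    unfolding lm(3) by linarith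
  then show ?case using Suc by (simp add: right_diff_distrib distrib_left)
qed simp

text \<open>
  The operator is \<open>R - \<integral> G l dl\<close>. The Riemann sums converge in norm although \<open>G\<close> need not be
  continuous in norm: by monotonicity their quadratic forms differ from the limit by at most one
  mesh width.
\<close>

lemma spectral_bounds_of_resolution:
  fixes G :: "real \<Rightarrow> ('h::chilbert_space \<Rightarrow>\<^sub>L 'h)"
  assumes G: "resolution G"
  shows "\<exists>s. spectral_bounds s G"
proof -
  note P = resolution_projection[OF G]
  obtain R where R: "0 < R" "\<forall>l\<le>- R. G l = 0" "\<forall>l\<ge>R. G l = id_blinfun"
    using resolution_bound[OF G] by metis
  define h where "h n = 2 * R / real (Suc n)" for n
  define T where "T n = R *\<^sub>R id_blinfun - h n *\<^sub>R (\<Sum>i<Suc n. G (- R + real i * h n))" for n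
  have h: "0 \<le> h n" "- R + real (Suc n) * h n = R" for n using R(1) by (simp_all add: h_def field_simps)
  have h0: "h \<longlonglongrightarrow> 0"
    unfolding h_def using tendsto_mult_right_zero[OF LIMSEQ_Suc[OF lim_1_over_n[where 'a=real]], of "2 * R"] by simp
  define q where "q u = R * (norm u)\<^sup>2 - integral {-R..R} (\<lambda>l. \<langle>G l u, u\<rangle>)" for u
  have T: "\<bar>\<langle>T n u, u\<rangle> - q u\<bar> \<le> h n * (norm u)\<^sup>2" for n u
  proof -
    have "\<langle>T n u, u\<rangle> = R * (norm u)\<^sup>2 - h n * (\<Sum>i<Suc n. \<langle>G (- R + real i * h n) u, u\<rangle>)"
      by (simp only: T_def blinfun.diff_left blinfun.scaleR_left blinfun.sum_left re_inner.diff_left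
          re_inner.scaleR_left re_inner.sum_left id_blinfun.rep_eq re_inner_self real_scaleR_def)
    moreover have "\<bar>integral {- R..- R + real (Suc n) * h n} (\<lambda>l. \<langle>G l u, u\<rangle>)
        - h n * (\<Sum>i<Suc n. \<langle>G (- R + real i * h n) u, u\<rangle>)\<bar>
        \<le> h n * (\<langle>G (- R + real (Suc n) * h n) u, u\<rangle> - \<langle>G (- R) u, u\<rangle>)"
      by (rule left_Riemann_sum[OF resolution_form_mono[OF G] h(1)])
    moreover have "\<langle>G R u, u\<rangle> - \<langle>G (- R) u, u\<rangle> = (norm u)\<^sup>2"
      using R by (simp add: re_inner_self re_inner.zero_left)
    ultimately show ?thesis unfolding q_def h(2) by (simp add: abs_minus_commute del: sum.lessThan_Suc)
  qed
  have saT: "selfadjoint (T n)" for n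
    unfolding T_def using projectionD(1)[OF P]
    by (intro selfadjoint_diff selfadjoint_scaleR selfadjoint_sum selfadjoint_id)
  have norm: "norm (T n - T k) \<le> h n + h k" for n k
  proof (rule norm_blinfun_bound)
    show "0 \<le> h n + h k" using h(1)[of n] h(1)[of k] by simp
    show "norm ((T n - T k) u) \<le> (h n + h k) * norm u" for u
    proof (rule selfadjoint_norm_bound)
      show "selfadjoint (T n - T k)" using saT by auto
      show "\<bar>\<langle>(T n - T k) u, u\<rangle>\<bar> \<le> (h n + h k) * (norm u)\<^sup>2" for u
        using T[of n u] T[of k u] by (simp add: blinfun_simps re_inner_simps distrib_right abs_le_iff)
    qed
  qed
  have "Cauchy T"
  proof (rule CauchyI)
    fix e :: real assume e: "0 < e"
    then have "\<forall>\<^sub>F n in sequentially. h n < e / 2" by (intro order_tendstoD(2)[OF h0]) simp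
    then obtain N where N: "\<And>n. N \<le> n \<Longrightarrow> h n < e / 2" by (auto simp: eventually_sequentially)
    show "\<exists>N. \<forall>n\<ge>N. \<forall>k\<ge>N. norm (T n - T k) < e"
    proof (intro exI allI impI)
      fix n k assume "N \<le> n" "N \<le> k"
      then show "norm (T n - T k) < e" using norm[of n k] N[of n] N[of k] by linarith
    qed
  qed
  then obtain s where s: "T \<longlonglongrightarrow> s" using Cauchy_convergent convergent_def by blast
  have sa: "selfadjoint s" by (rule selfadjoint_limit[OF saT s])
  have "\<langle>s u, u\<rangle> = q u" for u
  proof (rule LIMSEQ_unique)
    show "(\<lambda>n. \<langle>T n u, u\<rangle>) \<longlonglongrightarrow> \<langle>s u, u\<rangle>"
      by (intro re_inner.tendsto tendsto_blinfun_apply s tendsto_const)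
    have "(\<lambda>n. \<langle>T n u, u\<rangle> - q u) \<longlonglongrightarrow> 0"
    proof (rule Lim_null_comparison)
      show "\<forall>\<^sub>F n in sequentially. norm (\<langle>T n u, u\<rangle> - q u) \<le> h n * (norm u)\<^sup>2" using T by simp
      show "(\<lambda>n. h n * (norm u)\<^sup>2) \<longlonglongrightarrow> 0" using tendsto_mult_left_zero[OF h0] by simp
    qed
    then show "(\<lambda>n. \<langle>T n u, u\<rangle>) \<longlonglongrightarrow> q u" by (simp add: LIM_zero_iff)
  qed
  then have "is_spectral_family s G"
    by (intro is_spectral_family_formula[OF G R, THEN iffD2]) (simp add: q_def)
  then show ?thesis using is_spectral_family_iff_bounds[OF sa] by blast
qed

section \<open>Strong convergence from convergence of spectral projections\<close>

text \<open>
  Compressing \<open>y - c\<close> by the projection \<open>E b - E a\<close> gives a self-adjoint operator whose quadratic form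
  is bounded by \<open>D\<close>.
\<close>

lemma spectral_slice_norm:
  assumes S: "spectral_bounds y E" and ab: "a \<le> b" and v: "E a v = 0" "E b v = v"
    and c: "b - c \<le> D" "c - a \<le> D" "0 \<le> D"
  shows "norm (y v - c *\<^sub>R v) \<le> D * norm v"
proof -
  note d = spectral_boundsD[OF S]
  let ?Q = "E b - E a" and ?z = "y - c *\<^sub>R id_blinfun"
  note inc = resolution_increment[OF d(2) ab]
  have Qn: "norm (?Q w) \<le> norm w" for w
  proof -
    have "(norm (?Q w))\<^sup>2 = (norm (E b w))\<^sup>2 - (norm (E a w))\<^sup>2"
      using inc(3)[of w] by (simp add: blinfun.diff_left projectionD(4)[OF d(6)])
    also have "\<dots> \<le> (norm (E b w))\<^sup>2" by simp
    also have "\<dots> \<le> (norm w)\<^sup>2" using projectionD(5)[OF d(6)] by (intro power_mono) auto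
    finally show ?thesis by (simp add: abs_le_square_iff[symmetric])
  qed
  have zsa: "selfadjoint ?z"
    by (intro selfadjoint_diff selfadjoint_scaleR d(1) selfadjoint_id)
  have Qsa: "selfadjoint ?Q" using projectionD(1)[OF d(6)] by (intro selfadjoint_diff)
  have "norm ((?Q o\<^sub>L ?z o\<^sub>L ?Q) v) \<le> D * norm v"
  proof (rule selfadjoint_norm_bound)
    show "selfadjoint (?Q o\<^sub>L ?z o\<^sub>L ?Q)" by (rule selfadjoint_conj[OF zsa Qsa])
    fix w
    have "\<langle>(?Q o\<^sub>L ?z o\<^sub>L ?Q) w, w\<rangle> = \<langle>?z (?Q w), ?Q w\<rangle>" using selfadjointD[OF Qsa] by simp
    also have "\<dots> = \<langle>y (?Q w), ?Q w\<rangle> - c * (norm (?Q w))\<^sup>2"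
      by (simp only: blinfun.diff_left[of y] blinfun.scaleR_left re_inner.diff_left re_inner.scaleR_left
          id_blinfun.rep_eq re_inner_self real_scaleR_def)
    finally have eq: "\<langle>(?Q o\<^sub>L ?z o\<^sub>L ?Q) w, w\<rangle> = \<langle>y (?Q w), ?Q w\<rangle> - c * (norm (?Q w))\<^sup>2" .
    have "\<langle>y (?Q w), ?Q w\<rangle> \<le> b * (norm (?Q w))\<^sup>2" "a * (norm (?Q w))\<^sup>2 \<le> \<langle>y (?Q w), ?Q w\<rangle>"
      using d(4)[of b "?Q w"] d(5)[of a "?Q w"] inc(1,2)[of w] by (simp_all add: blinfun.diff_left)
    moreover have "(b - c) * (norm (?Q w))\<^sup>2 \<le> D * (norm (?Q w))\<^sup>2"
      "(c - a) * (norm (?Q w))\<^sup>2 \<le> D * (norm (?Q w))\<^sup>2"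
      using c by (auto intro: mult_right_mono)
    ultimately have "\<bar>\<langle>(?Q o\<^sub>L ?z o\<^sub>L ?Q) w, w\<rangle>\<bar> \<le> D * (norm (?Q w))\<^sup>2"
      unfolding eq abs_le_iff by (simp add: left_diff_distrib)
    also have "\<dots> \<le> D * (norm w)\<^sup>2" using c(3) Qn by (intro mult_left_mono power_mono) auto
    finally show "\<bar>\<langle>(?Q o\<^sub>L ?z o\<^sub>L ?Q) w, w\<rangle>\<bar> \<le> D * (norm w)\<^sup>2" .
  qed
  moreover have "(?Q o\<^sub>L ?z o\<^sub>L ?Q) v = y v - c *\<^sub>R v"
    by (simp add: blinfun_simps v d(3) blinfun.zero_right)
  ultimately show ?thesis by simp
qed

text \<open>
  For \<open>v\<close> in the slice \<open>(a, b]\<close> of \<open>G\<close>, the two limit hypotheses say that \<open>v\<close> lies asymptotically in a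
  slightly larger slice of \<open>E i\<close>, on which \<open>y i\<close> is nearly \<open>a\<close>.
\<close>

lemma slice_approximation:
  fixes y :: "'i \<Rightarrow> ('h::chilbert_space \<Rightarrow>\<^sub>L 'h)"
  assumes S: "\<And>i. spectral_bounds (y i) (E i)" and B: "\<And>i. norm (y i) \<le> B"
    and upper: "\<And>l m u. l < m \<Longrightarrow> G l u = u \<Longrightarrow> ((\<lambda>i. u - E i m u) \<longlongrightarrow> 0) F"
    and lower: "\<And>l m u. l < m \<Longrightarrow> ((\<lambda>i. E i l (u - G m u)) \<longlongrightarrow> 0) F"
    and v: "G a v = 0" "G b v = v" and ab: "a < b" and e: "0 < e"
  shows "\<forall>\<^sub>F i in F. norm (y i v - a *\<^sub>R v) \<le> 2 * (b - a) * norm v + e"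
proof -
  define d where "d = b - a"
  have d: "0 < d" using ab by (simp add: d_def)
  \<comment> \<open>the part of \<open>v\<close> outside the slice \<open>(a - d, b + d]\<close> of \<open>E i\<close>\<close>
  define r where "r i = (v - E i (b + d) v) + E i (a - d) v" for i
  have "((\<lambda>i. (v - E i (b + d) v) + E i (a - d) (v - G a v)) \<longlongrightarrow> 0 + 0) F"
    using d v by (intro tendsto_add upper lower) auto
  then have r0: "(r \<longlongrightarrow> 0) F" by (simp add: r_def[abs_def] v)
  have B0: "0 \<le> B" using B norm_ge_zero order_trans by blast
  have "((\<lambda>i. (B + \<bar>a\<bar>) * norm (r i)) \<longlongrightarrow> 0) F"
    using tendsto_mult_right_zero[OF tendsto_norm_zero[OF r0]] by simp
  then have "\<forall>\<^sub>F i in F. (B + \<bar>a\<bar>) * norm (r i) < e" by (rule order_tendstoD) (rule e)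
  then show ?thesis
  proof eventually_elim
    case (elim i)
    note D = spectral_boundsD[OF S[of i]]
    define w where "w = E i (b + d) v - E i (a - d) v"
    have le: "a - d \<le> b + d" using d ab by simp
    have vw: "v = w + r i" by (simp add: w_def r_def)
    have "norm (y i w - a *\<^sub>R w) \<le> (2 * d) * norm w"
      by (rule spectral_slice_norm[OF S le])
        (use resolution_increment[OF D(2) le] d in \<open>auto simp: w_def d_def\<close>)
    also have "\<dots> \<le> (2 * d) * norm v"
    proof (rule mult_left_mono)
      have "(norm w)\<^sup>2 = (norm (E i (b + d) v))\<^sup>2 - (norm (E i (a - d) v))\<^sup>2"
        using resolution_increment(3)[OF D(2) le, of v] by (simp add: w_def projectionD(4)[OF D(6)])
      also have "\<dots> \<le> (norm (E i (b + d) v))\<^sup>2" by simp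
      also have "\<dots> \<le> (norm v)\<^sup>2" using projectionD(5)[OF D(6)] by (intro power_mono) auto
      finally show "norm w \<le> norm v" by (simp add: abs_le_square_iff[symmetric])
    qed (use d in simp)
    finally have 1: "norm (y i w - a *\<^sub>R w) \<le> (2 * d) * norm v" .
    have "norm (y i (r i) - a *\<^sub>R r i) \<le> norm (y i (r i)) + \<bar>a\<bar> * norm (r i)"
      using norm_triangle_ineq4[of "y i (r i)" "a *\<^sub>R r i"] by simp
    also have "norm (y i (r i)) \<le> B * norm (r i)"
      using norm_blinfun[of "y i" "r i"] B[of i] by (meson mult_right_mono norm_ge_zero order_trans)
    finally have 2: "norm (y i (r i) - a *\<^sub>R r i) \<le> (B + \<bar>a\<bar>) * norm (r i)" by (simp add: distrib_right)
    have "y i v - a *\<^sub>R v = (y i w - a *\<^sub>R w) + (y i (r i) - a *\<^sub>R r i)"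
    proof -
      have "y i v = y i w + y i (r i)" "a *\<^sub>R v = a *\<^sub>R w + a *\<^sub>R r i"
        unfolding blinfun.add_right[symmetric] scaleR_add_right[symmetric] vw[symmetric] by simp_all
      then show ?thesis by simp
    qed
    then have "norm (y i v - a *\<^sub>R v) \<le> norm (y i w - a *\<^sub>R w) + norm (y i (r i) - a *\<^sub>R r i)"
      by (metis norm_triangle_ineq)
    then show ?case using 1 2 elim unfolding d_def by linarith
  qed
qed

text \<open>
  Only strict inequalities \<open>l < m\<close> are assumed, since the projections \<open>E i l\<close> themselves need not
  converge. Cutting \<open>u\<close> along \<open>N\<close> slices of \<open>G\<close> of width \<open>2 * R / N\<close>, the errors add up to a multiple of
  \<open>1/N\<close> times the sum of the norms of the slices. This sum is at most \<open>sqrt N * norm u\<close> by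
  orthogonality, so the total error is of order \<open>1 / sqrt N\<close>.
\<close>

lemma strong_limit_if_spectral_limit:
  fixes y :: "'i \<Rightarrow> ('h::chilbert_space \<Rightarrow>\<^sub>L 'h)"
  assumes S: "\<And>i. spectral_bounds (y i) (E i)" and B: "\<And>i. norm (y i) \<le> B"
    and s: "spectral_bounds s G"
    and upper: "\<And>l m u. l < m \<Longrightarrow> G l u = u \<Longrightarrow> ((\<lambda>i. u - E i m u) \<longlongrightarrow> 0) F"
    and lower: "\<And>l m u. l < m \<Longrightarrow> ((\<lambda>i. E i l (u - G m u)) \<longlongrightarrow> 0) F"
  shows "((\<lambda>i. y i u) \<longlongrightarrow> s u) F"
proof (rule tendstoI)
  fix e :: real assume e: "0 < e"
  note D = spectral_boundsD[OF s]
  obtain R where R: "0 < R" "\<forall>l\<le>- R. G l = 0" "\<forall>l\<ge>R. G l = id_blinfun"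
    using resolution_bound[OF D(2)] by metis
  define h where "h n = 2 * R / real (Suc n)" for n
  have h: "0 < h n" "- R + real (Suc n) * h n = R" for n using R(1) by (simp_all add: h_def field_simps)
  have inv0: "(\<lambda>n. 1 / real (Suc n)) \<longlonglongrightarrow> 0" using LIMSEQ_Suc[OF lim_1_over_n[where 'a=real]] by simp
  have "(\<lambda>n. 6 * R * norm u * sqrt (1 / real (Suc n)) + 2 * R * (1 / real (Suc n)))
      \<longlonglongrightarrow> 6 * R * norm u * sqrt 0 + 2 * R * 0"
    by (intro tendsto_add tendsto_mult tendsto_const tendsto_real_sqrt inv0)
  then have "\<forall>\<^sub>F n in sequentially. 6 * R * norm u * sqrt (1 / real (Suc n)) + 2 * R * (1 / real (Suc n)) < e"
    by (intro order_tendstoD(2)) (use e in auto)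
  then obtain n where n: "6 * R * norm u * sqrt (1 / real (Suc n)) + 2 * R * (1 / real (Suc n)) < e"
    by (auto simp: eventually_sequentially)
  let ?N = "Suc n" and ?h = "h n"
  define l where "l j = - R + real j * ?h" for j
  have ll: "l j < l (Suc j)" "l (Suc j) - l j = ?h" for j using h(1)[of n] by (simp_all add: l_def algebra_simps)
  have l0: "G (l 0) = 0" and lN: "G (l ?N) = id_blinfun" using R h(2)[of n] by (simp_all add: l_def)
  define v where "v j = G (l (Suc j)) u - G (l j) u" for j
  have sum_v: "(\<Sum>j<?N. v j) = u"
    using sum_lessThan_telescope[of "\<lambda>j. G (l j) u" ?N] l0 lN by (simp add: v_def)
  have inc: "G (l j) (v j) = 0" "G (l (Suc j)) (v j) = v j" for j
    using resolution_increment[OF D(2) less_imp_le[OF ll(1)]] by (simp_all add: v_def)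
  have sum_sq: "(\<Sum>j<?N. (norm (v j))\<^sup>2) = (norm u)\<^sup>2"
  proof -
    have "(norm (v j))\<^sup>2 = \<langle>G (l (Suc j)) u, u\<rangle> - \<langle>G (l j) u, u\<rangle>" for j
      using resolution_increment(3)[OF D(2) less_imp_le[OF ll(1)]] by (simp add: v_def)
    then show ?thesis
      using sum_lessThan_telescope[of "\<lambda>j. \<langle>G (l j) u, u\<rangle>" ?N] l0 lN
      by (simp add: re_inner_self re_inner.zero_left)
  qed
  have sum_v': "(\<Sum>j<?N. norm (v j)) \<le> norm u * sqrt (real ?N)"
  proof -
    have "(\<Sum>j<?N. norm (v j))\<^sup>2 \<le> (norm u * sqrt (real ?N))\<^sup>2"
      using sum_squared_le_sum_of_squares[of "\<lambda>j. norm (v j)" "{..<?N}"] sum_sq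
      by (simp add: power_mult_distrib del: sum.lessThan_Suc)
    then show ?thesis by (rule power2_le_imp_le) simp
  qed
  have "\<forall>\<^sub>F i in F. \<forall>j\<in>{..<?N}. norm (y i (v j) - l j *\<^sub>R v j) \<le> 2 * (l (Suc j) - l j) * norm (v j) + ?h / real ?N"
    by (intro eventually_ball_finite ballI slice_approximation[OF S B upper lower inc ll(1)])
      (use h(1)[of n] in simp_all)
  then show "\<forall>\<^sub>F i in F. dist (y i u) (s u) < e"
  proof eventually_elim
    case (elim i)
    have piece: "norm (y i (v j) - s (v j)) \<le> 3 * ?h * norm (v j) + ?h / real ?N" if "j < ?N" for j
    proof -
      have "norm (s (v j) - l j *\<^sub>R v j) \<le> ?h * norm (v j)"
        by (rule spectral_slice_norm[OF s less_imp_le[OF ll(1)] inc]) (use ll(2) h(1)[of n] in auto)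
      moreover have "norm (y i (v j) - l j *\<^sub>R v j) \<le> 2 * ?h * norm (v j) + ?h / real ?N"
        using elim[rule_format, of j] that unfolding ll(2) by simp
      moreover have "norm (y i (v j) - s (v j)) \<le>
          norm (y i (v j) - l j *\<^sub>R v j) + norm (s (v j) - l j *\<^sub>R v j)"
        using norm_triangle_ineq4[of "y i (v j) - l j *\<^sub>R v j" "s (v j) - l j *\<^sub>R v j"] by simp
      ultimately show ?thesis by linarith
    qed
    have "y i u - s u = (\<Sum>j<?N. y i (v j) - s (v j))"
      by (subst (1 2) sum_v[symmetric]) (simp only: blinfun.sum_right sum_subtractf)
    then have "norm (y i u - s u) \<le> (\<Sum>j<?N. norm (y i (v j) - s (v j)))"
      by (simp only: norm_sum)
    also have "\<dots> \<le> (\<Sum>j<?N. 3 * ?h * norm (v j) + ?h / real ?N)"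
      by (rule sum_mono) (use piece in simp)
    also have "\<dots> = 3 * ?h * (\<Sum>j<?N. norm (v j)) + ?h"
      by (simp add: sum.distrib sum_distrib_left[symmetric] del: sum.lessThan_Suc)
    also have "\<dots> \<le> 3 * ?h * (norm u * sqrt (real ?N)) + ?h"
      using sum_v' h(1)[of n] by (intro add_right_mono mult_left_mono) auto
    also have "3 * ?h * (norm u * sqrt (real ?N)) = 6 * R * norm u * sqrt (1 / real ?N)"
      by (simp add: h_def real_sqrt_divide field_simps flip: real_sqrt_mult)
    also have "6 * R * norm u * sqrt (1 / real ?N) + ?h < e" using n by (simp add: h_def)
    finally show ?case by (simp add: dist_norm)
  qed
qed

section \<open>Joins in the spectral order\<close>

abbreviation spec :: "('h::chilbert_space \<Rightarrow>\<^sub>L 'h) \<Rightarrow> real \<Rightarrow> ('h \<Rightarrow>\<^sub>L 'h)"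
  where "spec \<equiv> spectral_family"

lemma spectral_le_iff:
  assumes "selfadjoint x" "selfadjoint y"
  shows "spectral_le x y \<longleftrightarrow> (\<forall>l u. spec y l u = u \<longrightarrow> spec x l u = u)"
  unfolding spectral_le_def
  using projection_le_iff[OF spectral_boundsD(6)[OF spectral_family_bounds[OF assms(2)]]
      spectral_boundsD(6)[OF spectral_family_bounds[OF assms(1)]]] by blast

lemma spec_top:
  assumes x: "selfadjoint x" and B: "\<And>u. \<langle>x u, u\<rangle> \<le> B * (norm u)\<^sup>2"
  shows "spec x B = id_blinfun"
proof (rule blinfun_eqI)
  fix u
  note S = spectral_family_bounds[OF x]
  note D = spectral_boundsD[OF S]
  have "spec x B u = u"
  proof (rule resolution_right[OF D(2)])
    fix m assume m: "B < m"
    let ?v = "u - spec x m u"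
    have "spec x m ?v = 0" by (simp add: blinfun.diff_right projectionD(3)[OF D(6)])
    then have "m * (norm ?v)\<^sup>2 \<le> B * (norm ?v)\<^sup>2" using D(5) B order_trans by blast
    then have "norm ?v = 0" using m by (simp add: mult_le_cancel_right)
    then show "spec x m u = u" by simp
  qed
  then show "spec x B u = id_blinfun u" by simp
qed

text \<open>
  Integrating the inequality between the spectral families: the spectral order is finer than the
  usual one.
\<close>

lemma spectral_le_form:
  assumes x: "selfadjoint x" and y: "selfadjoint y" and le: "spectral_le x y"
  shows "\<langle>x u, u\<rangle> \<le> \<langle>y u, u\<rangle>"
proof -
  note S = spectral_family_bounds[OF x] and S' = spectral_family_bounds[OF y]
  obtain R where R: "0 < R" "\<forall>l\<le>- R. spec x l = 0" "\<forall>l\<ge>R. spec x l = id_blinfun"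
    using resolution_bound[OF spectral_boundsD(2)[OF S]] by metis
  obtain R' where R': "R < R'" "0 < R'" "\<forall>l\<le>- R'. spec y l = 0" "\<forall>l\<ge>R'. spec y l = id_blinfun"
    using resolution_bound[OF spectral_boundsD(2)[OF S']] by metis
  have R2: "\<forall>l\<le>- R'. spec x l = 0" "\<forall>l\<ge>R'. spec x l = id_blinfun" using R R' by auto
  have "\<langle>spec y l u, u\<rangle> \<le> \<langle>spec x l u, u\<rangle>" for l
    using le projectionD(1)[OF spectral_boundsD(6)[OF S]] projectionD(1)[OF spectral_boundsD(6)[OF S']]
    by (simp add: spectral_le_def op_le_iff)
  then have "R' * (norm u)\<^sup>2 - \<langle>y u, u\<rangle> \<le> R' * (norm u)\<^sup>2 - \<langle>x u, u\<rangle>"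
    by (intro has_integral_le[OF spectral_bounds_integral[OF S' R'(2-4)]
          spectral_bounds_integral[OF S R'(2) R2]])
  then show ?thesis by simp
qed

text \<open>
  The supremum in the spectral order. Meets of spectral projections are expressed by fixed vectors,
  and families are indexed so that the definition applies both to a set of operators and to the set
  of their inverses.
\<close>

definition spectral_join :: "('i \<Rightarrow> ('h::chilbert_space \<Rightarrow>\<^sub>L 'h)) \<Rightarrow> 'i set \<Rightarrow> ('h \<Rightarrow>\<^sub>L 'h) \<Rightarrow> bool"
  where "spectral_join x I s \<longleftrightarrow> selfadjoint s \<and>
    (\<forall>l u. spec s l u = u \<longleftrightarrow> (\<forall>i\<in>I. spec (x i) l u = u))"

lemma spectral_join_exists:
  fixes x :: "'i \<Rightarrow> ('h::chilbert_space \<Rightarrow>\<^sub>L 'h)"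
  assumes I: "I \<noteq> {}" and x: "\<And>i. i \<in> I \<Longrightarrow> positive_op (x i)" and B: "\<And>i. i \<in> I \<Longrightarrow> norm (x i) \<le> B"
  shows "\<exists>s. spectral_join x I s \<and> positive_op s \<and> norm s \<le> B"
proof -
  have S: "spectral_bounds (x i) (spec (x i))" if "i \<in> I" for i
    by (rule spectral_family_bounds[OF positive_selfadjoint[OF x[OF that]]])
  note D = spectral_boundsD[OF S]
  have B0: "0 \<le> B" using I B norm_ge_zero order_trans by blast
  have top: "spec (x i) B = id_blinfun" if "i \<in> I" for i
  proof (rule spec_top[OF D(1)[OF that]])
    fix u
    have "\<langle>x i u, u\<rangle> \<le> norm (x i) * (norm u)\<^sup>2" by (rule form_le_norm)
    also have "\<dots> \<le> B * (norm u)\<^sup>2" using B[OF that] by (intro mult_right_mono) auto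
    finally show "\<langle>x i u, u\<rangle> \<le> B * (norm u)\<^sup>2" .
  qed
  have "\<exists>q. is_projection q \<and> (\<forall>u. q u = u \<longleftrightarrow> (\<forall>i\<in>I. spec (x i) l u = u))" for l
    by (rule projection_meet) (rule D(6))
  then obtain G where G: "\<And>l. is_projection (G l)" "\<And>l u. G l u = u \<longleftrightarrow> (\<forall>i\<in>I. spec (x i) l u = u)"
    by metis
  have neg: "G l = 0" if l: "l < 0" for l
  proof (rule blinfun_eqI)
    fix u
    obtain i where i: "i \<in> I" using I by blast
    have "spec (x i) l (G l u) = G l u" using G(2)[of l "G l u"] projectionD(3)[OF G(1)] i by simp
    then show "G l u = blinfun_apply 0 u" using spectral_bounds_negative[OF S[OF i] x[OF i] l] by simp
  qed
  have GB: "G B = id_blinfun" by (rule blinfun_eqI) (use G(2) top in simp)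
  have res: "resolution G"
  proof (rule resolutionI[OF G(1), where r = B])
    show mono: "G m u = u" if "l \<le> m" "G l u = u" for l m u
      using that G(2) resolution_mono[OF D(2) that(1)] by simp
    show "G l u = u" if "\<And>m. l < m \<Longrightarrow> G m u = u" for l u
      using that G(2) resolution_right[OF D(2)] by simp
    show "G l = 0" if "l < - B" for l using that B0 neg by simp
    show "G l = id_blinfun" if "B < l" for l
    proof (rule blinfun_eqI)
      fix u show "G l u = id_blinfun u" using mono[of B l u] that GB by simp
    qed
  qed
  obtain s where s: "spectral_bounds s G" using spectral_bounds_of_resolution[OF res] by blast
  note d = spectral_boundsD[OF s]
  have "spec s = G" by (rule spectral_family_eqI[OF s])
  then have join: "spectral_join x I s" using G(2) d(1) by (simp add: spectral_join_def)
  have "0 \<le> \<langle>s u, u\<rangle>" for u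
  proof (rule field_le_epsilon)
    fix e :: real assume e: "0 < e"
    define k where "k = e / ((norm u)\<^sup>2 + 1)"
    have n1: "0 < (norm u)\<^sup>2 + 1" by (simp add: add_nonneg_pos)
    have k: "0 < k" "k * (norm u)\<^sup>2 \<le> e" using e n1 by (auto simp: k_def divide_simps mult_left_mono)
    have "- k * (norm u)\<^sup>2 \<le> \<langle>s u, u\<rangle>" by (rule d(5)) (use neg[of "- k"] k in simp)
    then show "0 \<le> \<langle>s u, u\<rangle> + e" using k(2) by simp
  qed
  then have pos: "positive_op s" using d(1) by (simp add: positive_op_iff)
  have "norm s \<le> B"
    by (rule norm_blinfun_bound[OF B0], rule positive_norm_bound[OF pos], rule d(4)) (simp add: GB)
  then show ?thesis using join pos by blast
qed

text \<open>
  If some part of the spectrum of \<open>y\<close> lay above \<open>m > C\<close>, the Chebyshev inequality would force \<open>y\<^sup>n\<close> to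
  exceed \<open>C\<^sup>n\<close> there.
\<close>

lemma positive_norm_if_power_bound:
  assumes y: "positive_op y" and C: "0 \<le> C" and n: "0 < n"
    and bound: "\<And>u. \<langle>op_power y n u, u\<rangle> \<le> C ^ n * (norm u)\<^sup>2"
  shows "norm y \<le> C"
proof -
  note S = spectral_family_bounds[OF positive_selfadjoint[OF y]]
  have *: "\<langle>y u, u\<rangle> \<le> C * (norm u)\<^sup>2" for u
  proof (rule spectral_boundsD(4)[OF S])
    show "spec y C u = u"
    proof (rule resolution_right[OF spectral_boundsD(2)[OF S]])
      fix m assume m: "C < m"
      let ?v = "u - spec y m u"
      have "spec y m ?v = 0"
        by (simp add: blinfun.diff_right projectionD(3)[OF spectral_boundsD(6)[OF S]])
      then have "m ^ n * (norm ?v)\<^sup>2 \<le> C ^ n * (norm ?v)\<^sup>2"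
        using power_form_lower[OF S y, of m n ?v] bound[of ?v] m C by simp
      moreover have "C ^ n < m ^ n" using m C n by (intro power_strict_mono) auto
      ultimately have "norm ?v = 0" by (simp add: mult_le_cancel_right)
      then show "spec y m u = u" by simp
    qed
  qed
  show ?thesis by (rule norm_blinfun_bound[OF C]) (rule positive_norm_bound[OF y *])
qed

lemma geometric_sqrt_tendsto_0:
  fixes q C :: real assumes "0 \<le> q" "q < 1"
  shows "(\<lambda>n. C * q ^ Suc n) \<longlonglongrightarrow> 0" "(\<lambda>n. C * sqrt (q ^ Suc n)) \<longlonglongrightarrow> 0"
proof -
  have "(\<lambda>n. q ^ Suc n) \<longlonglongrightarrow> 0" using assms by (intro LIMSEQ_Suc LIMSEQ_power_zero) simp
  then show "(\<lambda>n. C * q ^ Suc n) \<longlonglongrightarrow> 0" "(\<lambda>n. C * sqrt (q ^ Suc n)) \<longlonglongrightarrow> 0"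
    using tendsto_mult_right_zero tendsto_real_sqrt[of "\<lambda>n. q ^ Suc n" 0] by (auto simp del: power_Suc)
qed

text \<open>
  Both halves of the convergence criterion come from the Chebyshev inequality: applied to the root
  \<open>y n\<close> for vectors in a spectral subspace of \<open>s\<close>, and applied to the \<open>x i\<close>, whose powers are dominated
  by those of \<open>y n\<close>, for vectors in a spectral subspace of \<open>y n\<close>.
\<close>

lemma root_of_power_sum_tendsto:
  fixes x :: "'i \<Rightarrow> ('h::chilbert_space \<Rightarrow>\<^sub>L 'h)"
  assumes F: "finite F" "F \<noteq> {}" and x: "\<And>i. i \<in> F \<Longrightarrow> positive_op (x i)" and s: "spectral_join x F s"
  shows "(\<lambda>n. op_root (Suc n) (\<Sum>i\<in>F. op_power (x i) (Suc n)) u) \<longlonglongrightarrow> s u"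
proof -
  define a where "a n = (\<Sum>i\<in>F. op_power (x i) (Suc n))" for n
  define y where "y n = op_root (Suc n) (a n)" for n
  have a_form: "\<langle>a n u, u\<rangle> = (\<Sum>i\<in>F. \<langle>op_power (x i) (Suc n) u, u\<rangle>)" for n u
    by (simp add: a_def blinfun.sum_left re_inner.sum_left)
  have a_pos: "positive_op (a n)" for n
    unfolding positive_op_iff a_form
    using positive_power[OF x] by (auto simp: a_def positive_op_iff intro!: selfadjoint_sum sum_nonneg)
  have y: "positive_op (y n)" "op_power (y n) (Suc n) = a n" for n
    unfolding y_def using op_root[OF a_pos] by auto
  define B where "B = Max ((\<lambda>i. norm (x i)) ` F)"
  have B: "norm (x i) \<le> B" if "i \<in> F" for i using that F by (simp add: B_def)
  have B0: "0 \<le> B" using F B norm_ge_zero order_trans by blast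
  have Sx: "spectral_bounds (x i) (spec (x i))" if "i \<in> F" for i
    by (rule spectral_family_bounds[OF positive_selfadjoint[OF x[OF that]]])
  have Sy: "spectral_bounds (y n) (spec (y n))" for n
    by (rule spectral_family_bounds[OF positive_selfadjoint[OF y(1)]])
  have Ss: "spectral_bounds s (spec s)" using s by (auto simp: spectral_join_def intro: spectral_family_bounds)
  have upper_a: "\<langle>a n u, u\<rangle> \<le> real (card F) * (l ^ Suc n * (norm u)\<^sup>2)"
    if "0 \<le> l" "\<And>i. i \<in> F \<Longrightarrow> spec (x i) l u = u" for n l u
  proof -
    have "\<langle>a n u, u\<rangle> \<le> (\<Sum>i\<in>F. l ^ Suc n * (norm u)\<^sup>2)"
      unfolding a_form using power_form_upper[OF Sx x that(1)] that(2) by (intro sum_mono) blast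
    then show ?thesis by simp
  qed
  have lower_a: "\<langle>op_power (x i) (Suc n) u, u\<rangle> \<le> \<langle>a n u, u\<rangle>" if "i \<in> F" for i n u
    unfolding a_form using positive_power[OF x] F(1) that
    by (intro member_le_sum) (auto simp: positive_op_iff)
  have ybound: "norm (y n) \<le> real (card F) * B" for n
  proof (rule positive_norm_if_power_bound[OF y(1), of _ "Suc n"])
    have c1: "1 \<le> real (card F)" using F by (simp add: Suc_le_eq card_gt_0_iff)
    show "0 \<le> real (card F) * B" using B0 by simp
    fix u
    have top: "spec (x i) B u = u" if "i \<in> F" for i
    proof -
      have "\<langle>x i w, w\<rangle> \<le> B * (norm w)\<^sup>2" for w
        using form_le_norm(1)[of "x i" w] B[OF that] by (meson mult_right_mono order_trans zero_le_power2)
      then show ?thesis using spec_top[OF positive_selfadjoint[OF x[OF that]]] by simp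
    qed
    have "\<langle>a n u, u\<rangle> \<le> real (card F) * (B ^ Suc n * (norm u)\<^sup>2)" by (rule upper_a[OF B0 top])
    also have "\<dots> \<le> real (card F) ^ Suc n * (B ^ Suc n * (norm u)\<^sup>2)"
      using c1 B0 self_le_power[OF c1, of "Suc n"] by (intro mult_right_mono) auto
    finally show "\<langle>op_power (y n) (Suc n) u, u\<rangle> \<le> (real (card F) * B) ^ Suc n * (norm u)\<^sup>2"
      unfolding y(2) by (simp add: power_mult_distrib algebra_simps)
  qed simp
  have "(\<lambda>n. y n u) \<longlonglongrightarrow> s u"
  proof (rule strong_limit_if_spectral_limit[OF Sy ybound Ss])
    fix l m :: real and u assume lm: "l < m" and u: "spec s l u = u"
    have xu: "spec (x i) l u = u" if "i \<in> F" for i using s u that by (simp add: spectral_join_def)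
    show "(\<lambda>n. u - spec (y n) m u) \<longlonglongrightarrow> 0"
    proof (cases "0 \<le> l")
      case False
      obtain i where i: "i \<in> F" using F by blast
      have "u = 0" using xu[OF i] spectral_bounds_negative[OF Sx[OF i] x[OF i]] False by simp
      then show ?thesis by (simp add: blinfun.zero_right)
    next
      case True
      have m: "0 < m" using True lm by simp
      define C where "C = real (card F) * (norm u)\<^sup>2"
      have "norm (u - spec (y n) m u) \<le> sqrt C * sqrt ((l / m) ^ Suc n)" for n
      proof -
        have "m ^ Suc n * (norm (u - spec (y n) m u))\<^sup>2 \<le> \<langle>a n u, u\<rangle>"
          using power_form_lower[OF Sy y(1), of m "Suc n" u n] m unfolding y(2) by simp
        also have "\<dots> \<le> C * l ^ Suc n" using upper_a[OF True xu, of n] by (simp add: C_def algebra_simps)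
        finally have "(norm (u - spec (y n) m u))\<^sup>2 \<le> C * (l / m) ^ Suc n"
          using m by (simp add: power_divide field_simps del: power_Suc)
        then have "sqrt ((norm (u - spec (y n) m u))\<^sup>2) \<le> sqrt (C * (l / m) ^ Suc n)"
          by (rule real_sqrt_le_mono)
        then show ?thesis by (simp add: real_sqrt_mult del: power_Suc)
      qed
      then show ?thesis
        using True lm
        by (intro Lim_null_comparison[OF always_eventually[OF allI] geometric_sqrt_tendsto_0(2)[of "l / m" "sqrt C"]])
          (auto simp del: power_Suc)
    qed
  next
    fix l m :: real and u assume lm: "l < m"
    let ?V = "{u. (\<lambda>n. spec (y n) l u) \<longlonglongrightarrow> 0}"
    show "(\<lambda>n. spec (y n) l (u - spec s m u)) \<longlonglongrightarrow> 0"
    proof (cases "0 \<le> l")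
      case False
      then have "spec (y n) l = 0" for n by (intro spectral_bounds_negative[OF Sy y(1)]) simp
      then show ?thesis by simp
    next
      case True
      have m: "0 < m" using True lm by simp
      have Py: "is_projection (spec (y n) l)" for n by (rule spectral_boundsD(6)[OF Sy])
      have "u - spec s m u \<in> ?V"
      proof (rule meet_complement_in[of F "\<lambda>i. spec (x i) m"])
        show "is_projection (spec (x i) m)" if "i \<in> F" for i by (rule spectral_boundsD(6)[OF Sx[OF that]])
        show "is_projection (spec s m)" by (rule spectral_boundsD(6)[OF Ss])
        show "spec s m u = u \<longleftrightarrow> (\<forall>i\<in>F. spec (x i) m u = u)" for u using s by (simp add: spectral_join_def)
        show "u - spec (x i) m u \<in> ?V" if i: "i \<in> F" for i u
        proof -
          let ?v = "u - spec (x i) m u" and ?q = "l / m"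
          have Px: "is_projection (spec (x i) m)" by (rule spectral_boundsD(6)[OF Sx[OF i]])
          have q: "0 \<le> ?q" "?q < 1" using True lm m by auto
          have "norm (spec (y n) l ?v) \<le> norm u * sqrt (?q ^ Suc n)" for n
          proof -
            let ?w = "spec (y n) l ?v"
            let ?z = "?w - spec (x i) m ?w"
            have "m ^ Suc n * (norm ?z)\<^sup>2 \<le> \<langle>op_power (x i) (Suc n) ?w, ?w\<rangle>"
              using power_form_lower[OF Sx[OF i] x[OF i], of m "Suc n" ?w] m by simp
            also have "\<dots> \<le> \<langle>a n ?w, ?w\<rangle>" by (rule lower_a[OF i])
            also have "\<dots> \<le> l ^ Suc n * (norm ?w)\<^sup>2"
              unfolding y(2)[symmetric]
              by (rule power_form_upper[OF Sy y(1) True]) (rule projectionD(3)[OF Py])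
            finally have "(norm ?z)\<^sup>2 \<le> ?q ^ Suc n * (norm ?w)\<^sup>2"
              using m by (simp add: power_divide field_simps del: power_Suc)
            then have "sqrt ((norm ?z)\<^sup>2) \<le> sqrt (?q ^ Suc n * (norm ?w)\<^sup>2)" by (rule real_sqrt_le_mono)
            then have z: "norm ?z \<le> sqrt (?q ^ Suc n) * norm ?w" by (simp add: real_sqrt_mult del: power_Suc)
            have "(norm ?w)\<^sup>2 = \<langle>?w, ?v\<rangle>" using projectionD(4)[OF Py] by simp
            also have "\<dots> = \<langle>?z, u\<rangle>" using projectionD(2)[OF Px] by (simp add: re_inner.diff_left re_inner.diff_right)
            also have "\<dots> \<le> norm ?z * norm u" using re_inner_Cauchy_Schwarz[of ?z u] by linarith
            also have "\<dots> \<le> (sqrt (?q ^ Suc n) * norm ?w) * norm u" using z by (rule mult_right_mono) simp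
            finally have "norm ?w * norm ?w \<le> norm ?w * (norm u * sqrt (?q ^ Suc n))"
              by (simp add: power2_eq_square algebra_simps del: power_Suc)
            then show ?thesis using q by (cases "norm ?w = 0") (auto simp del: power_Suc)
          qed
          then have "(\<lambda>n. spec (y n) l ?v) \<longlonglongrightarrow> 0"
            by (intro Lim_null_comparison[OF _ geometric_sqrt_tendsto_0(2)[OF q]] always_eventually allI)
          then show ?thesis by simp
        qed
      qed (use null_space[OF Py] in auto)
      then show ?thesis by simp
    qed
  qed
  then show ?thesis by (simp add: y_def a_def)
qed

section \<open>Joins in a von Neumann algebra\<close>

lemma von_neumann_strong_limit:
  fixes f :: "'i \<Rightarrow> ('h::chilbert_space \<Rightarrow>\<^sub>L 'h)"
  assumes A: "von_neumann_algebra A" and F: "F \<noteq> bot" and f: "\<forall>\<^sub>F i in F. f i \<in> A"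
    and lim: "\<And>u. ((\<lambda>i. blinfun_apply (f i) u) \<longlongrightarrow> blinfun_apply a u) F"
  shows "a \<in> A"
proof (rule limitin_closedin)
  show "limitin strong_operator_topology f a F" using lim by (simp add: strong_limit_iff)
  show "closedin strong_operator_topology A" using A by (simp add: von_neumann_algebra_def)
qed (use F f in auto)

lemma positive_sum: "(\<And>i. i \<in> I \<Longrightarrow> positive_op (f i)) \<Longrightarrow> positive_op (sum f I)"
  by (auto simp: positive_op_iff blinfun.sum_left re_inner.sum_left intro!: selfadjoint_sum sum_nonneg)

lemma positive_scaleR: "positive_op a \<Longrightarrow> 0 \<le> r \<Longrightarrow> positive_op (r *\<^sub>R a)"
  by (auto simp: positive_op_iff blinfun_simps re_inner_simps)

lemma op_power_scaleR: "op_power (r *\<^sub>R a) n = r ^ n *\<^sub>R op_power a n"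
  by (induction n) (auto intro!: blinfun_eqI simp: op_power_Suc blinfun_simps)

lemma op_root_scaleR:
  assumes "positive_op a" "0 \<le> r" "0 < n"
  shows "op_root n (r *\<^sub>R a) = root n r *\<^sub>R op_root n a"
  by (rule op_root_unique)
    (use assms op_root[OF assms(1,3)] in \<open>auto simp: op_power_scaleR real_root_pow_pos2 intro!: positive_scaleR\<close>)

lemma spectral_join_in_algebra:
  assumes A: "von_neumann_algebra A" and F: "finite F" "F \<noteq> {}"
    and x: "\<And>i. i \<in> F \<Longrightarrow> positive_op (x i) \<and> x i \<in> A" and s: "spectral_join x F s"
  shows "s \<in> A"
proof (rule von_neumann_strong_limit[OF A])
  have C: "cstar_subalgebra A" using A by (simp add: von_neumann_algebra_def)
  have "op_root (Suc n) (\<Sum>i\<in>F. op_power (x i) (Suc n)) \<in> A" for n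
    using x by (intro algebra_op_root[OF C] positive_sum algebra_sum[OF C] positive_power algebra_power[OF C]) auto
  then show "\<forall>\<^sub>F n in sequentially. op_root (Suc n) (\<Sum>i\<in>F. op_power (x i) (Suc n)) \<in> A" by simp
  show "(\<lambda>n. op_root (Suc n) (\<Sum>i\<in>F. op_power (x i) (Suc n)) u) \<longlonglongrightarrow> s u" for u
    using x by (intro root_of_power_sum_tendsto[OF F _ s]) auto
qed simp

lemma eventually_finite_subset:
  assumes "i \<in> I"
  shows "\<forall>\<^sub>F F in finite_subsets_at_top I. finite F \<and> F \<noteq> {} \<and> F \<subseteq> I \<and> i \<in> F"
  unfolding eventually_finite_subsets_at_top using assms by (intro exI[of _ "{i}"]) auto

text \<open>
  For \<open>i \<in> F\<close> the spectral projection of \<open>g F\<close> is below that of \<open>x i\<close>, so it eventually vanishes on the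
  complement of the latter; these complements span the complement of the spectral projection of \<open>s\<close>.
\<close>

lemma spectral_joins_tendsto:
  fixes x :: "'i \<Rightarrow> ('h::chilbert_space \<Rightarrow>\<^sub>L 'h)"
  assumes I: "I \<noteq> {}" and x: "\<And>i. i \<in> I \<Longrightarrow> selfadjoint (x i)" and s: "spectral_join x I s"
    and g: "\<And>F. finite F \<Longrightarrow> F \<noteq> {} \<Longrightarrow> F \<subseteq> I \<Longrightarrow> spectral_join x F (g F) \<and> norm (g F) \<le> B"
  shows "((\<lambda>F. g F u) \<longlongrightarrow> s u) (finite_subsets_at_top I)"
proof -
  \<comment> \<open>the criterion needs a spectral family for every index, so \<open>g\<close> is replaced by \<open>s\<close> off the filter\<close>
  define y where "y F = (if finite F \<and> F \<noteq> {} \<and> F \<subseteq> I then g F else s)" for F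
  have y: "spectral_join x F (y F)" if "finite F" "F \<noteq> {}" "F \<subseteq> I" for F using that g by (simp add: y_def)
  have y': "y F = s" if "\<not> (finite F \<and> F \<noteq> {} \<and> F \<subseteq> I)" for F using that by (auto simp: y_def)
  have ysa: "selfadjoint (y F)" for F using g s by (auto simp: y_def spectral_join_def)
  have yB: "norm (y F) \<le> max B (norm s)" for F using g by (auto simp: y_def le_max_iff_disj)
  note Sy = spectral_family_bounds[OF ysa]
  have Ss: "spectral_bounds s (spec s)" using s by (auto simp: spectral_join_def intro: spectral_family_bounds)
  have Sx: "spectral_bounds (x i) (spec (x i))" if "i \<in> I" for i by (rule spectral_family_bounds[OF x[OF that]])
  have "((\<lambda>F. y F u) \<longlongrightarrow> s u) (finite_subsets_at_top I)"
  proof (rule strong_limit_if_spectral_limit[OF Sy yB Ss])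
    fix l m :: real and u assume lm: "l < m" and u: "spec s l u = u"
    have "spec (y F) m u = u" for F
    proof (cases "finite F \<and> F \<noteq> {} \<and> F \<subseteq> I")
      case True
      have "spec (y F) l u = u" using y[of F] True s u by (auto simp: spectral_join_def)
      then show ?thesis by (rule resolution_mono[OF spectral_boundsD(2)[OF Sy] less_imp_le[OF lm]])
    next
      case False
      then show ?thesis using y' u resolution_mono[OF spectral_boundsD(2)[OF Ss], of l m u] lm by simp
    qed
    then show "((\<lambda>F. u - spec (y F) m u) \<longlongrightarrow> 0) (finite_subsets_at_top I)" by simp
  next
    fix l m :: real and u assume lm: "l < m"
    let ?V = "{u. ((\<lambda>F. spec (y F) l u) \<longlongrightarrow> 0) (finite_subsets_at_top I)}"
    have Py: "is_projection (spec (y F) l)" for F by (rule spectral_boundsD(6)[OF Sy])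
    have "u - spec s m u \<in> ?V"
    proof (rule meet_complement_in[of I "\<lambda>i. spec (x i) m"])
      show "is_projection (spec (x i) m)" if "i \<in> I" for i by (rule spectral_boundsD(6)[OF Sx[OF that]])
      show "is_projection (spec s m)" by (rule spectral_boundsD(6)[OF Ss])
      show "spec s m u = u \<longleftrightarrow> (\<forall>i\<in>I. spec (x i) m u = u)" for u using s by (simp add: spectral_join_def)
      show "u - spec (x i) m u \<in> ?V" if i: "i \<in> I" for i u
      proof -
        let ?v = "u - spec (x i) m u"
        have Px: "is_projection (spec (x i) m)" by (rule spectral_boundsD(6)[OF Sx[OF i]])
        have "spec (y F) l ?v = 0" if F: "finite F \<and> F \<noteq> {} \<and> F \<subseteq> I \<and> i \<in> F" for F
        proof -
          let ?w = "spec (y F) l ?v"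
          have "spec (y F) l ?w = ?w" by (rule projectionD(3)[OF Py])
          then have "spec (x i) l ?w = ?w" using y[of F] F by (auto simp: spectral_join_def)
          then have "spec (x i) m ?w = ?w"
            using resolution_mono[OF spectral_boundsD(2)[OF Sx[OF i]], of l m] lm by simp
          moreover have "spec (x i) m ?v = 0" by (simp add: blinfun.diff_right projectionD(3)[OF Px])
          ultimately have "\<langle>?w, ?v\<rangle> = 0" by (rule projection_orthogonal[OF Px])
          then show ?thesis using projectionD(4)[OF Py, of F ?v] by simp
        qed
        then have "\<forall>\<^sub>F F in finite_subsets_at_top I. spec (y F) l ?v = 0"
          by (rule eventually_mono[OF eventually_finite_subset[OF i]])
        then show ?thesis by (simp add: tendsto_eventually)
      qed
    qed (use null_space[OF Py] in auto)
    then show "((\<lambda>F. spec (y F) l (u - spec s m u)) \<longlongrightarrow> 0) (finite_subsets_at_top I)" by simp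
  qed
  moreover obtain i where i: "i \<in> I" using I by blast
  have "\<forall>\<^sub>F F in finite_subsets_at_top I. y F u = g F u"
    using eventually_finite_subset[OF i] by eventually_elim (simp add: y_def)
  ultimately show ?thesis by (rule Lim_transform_eventually)
qed

lemma bounded_family_join:
  fixes x :: "'i \<Rightarrow> ('h::chilbert_space \<Rightarrow>\<^sub>L 'h)"
  assumes A: "von_neumann_algebra A" and I: "I \<noteq> {}"
    and x: "\<And>i. i \<in> I \<Longrightarrow> positive_op (x i) \<and> x i \<in> A \<and> norm (x i) \<le> B"
  shows "\<exists>s g. spectral_join x I s \<and> positive_op s \<and> s \<in> A \<and>
    (\<forall>F. finite F \<and> F \<noteq> {} \<and> F \<subseteq> I \<longrightarrow> spectral_join x F (g F) \<and> positive_op (g F) \<and> g F \<in> A) \<and>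
    (\<forall>u. ((\<lambda>F. g F u) \<longlongrightarrow> s u) (finite_subsets_at_top I))"
proof -
  obtain s where s: "spectral_join x I s" "positive_op s"
    using spectral_join_exists[of I x B] I x by blast
  have "\<exists>t. finite F \<and> F \<noteq> {} \<and> F \<subseteq> I \<longrightarrow> spectral_join x F t \<and> positive_op t \<and> norm t \<le> B" for F
    using spectral_join_exists[of F x B] x by (metis subsetD)
  then obtain g where g: "\<And>F. finite F \<Longrightarrow> F \<noteq> {} \<Longrightarrow> F \<subseteq> I \<Longrightarrow>
      spectral_join x F (g F) \<and> positive_op (g F) \<and> norm (g F) \<le> B"
    by metis
  have gA: "g F \<in> A" if "finite F" "F \<noteq> {}" "F \<subseteq> I" for F
    using that g[OF that] x by (intro spectral_join_in_algebra[OF A that(1,2), of x]) auto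
  have lim: "((\<lambda>F. g F u) \<longlongrightarrow> s u) (finite_subsets_at_top I)" for u
    by (rule spectral_joins_tendsto[OF I _ s(1)]) (use x g positive_selfadjoint in auto)
  obtain i where i: "i \<in> I" using I by blast
  have "\<forall>\<^sub>F F in finite_subsets_at_top I. g F \<in> A"
    using eventually_finite_subset[OF i] by eventually_elim (simp add: gA)
  then have "s \<in> A" by (intro von_neumann_strong_limit[OF A _ _ lim]) simp_all
  then show ?thesis using s g gA lim by (intro exI[of _ s] exI[of _ g]) blast
qed

text \<open>
  The roots are only considered from the first one on, because \<open>op_root 0\<close> is meaningless.
\<close>

lemma iterated_slimI:
  fixes X :: "('h::chilbert_space \<Rightarrow>\<^sub>L 'h) set" and f :: "('h \<Rightarrow>\<^sub>L 'h) set \<Rightarrow> nat \<Rightarrow> ('h \<Rightarrow>\<^sub>L 'h)" and g :: "('h \<Rightarrow>\<^sub>L 'h) set \<Rightarrow> ('h \<Rightarrow>\<^sub>L 'h)"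
    and s :: "'h \<Rightarrow>\<^sub>L 'h"
  assumes "\<And>F u. finite F \<Longrightarrow> F \<noteq> {} \<Longrightarrow> F \<subseteq> X \<Longrightarrow> (\<lambda>n. f F (Suc n) u) \<longlonglongrightarrow> g F u"
    and "\<And>u. ((\<lambda>F. g F u) \<longlongrightarrow> s u) (finite_subsets_at_top X)"
  shows "iterated_slim X f s"
  unfolding iterated_slim_def strong_limit_iff
  using assms by (intro exI[of _ g]) (simp add: LIMSEQ_imp_Suc)

lemma root_scaled_tendsto:
  fixes y z :: "nat \<Rightarrow> ('h::chilbert_space \<Rightarrow>\<^sub>L 'h)"
  assumes "(\<lambda>n. y n u) \<longlonglongrightarrow> v" "0 < c" "\<And>n. z n = root (Suc n) c *\<^sub>R y n"
  shows "(\<lambda>n. z n u) \<longlonglongrightarrow> v"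
proof -
  have "(\<lambda>n. root (Suc n) c *\<^sub>R y n u) \<longlonglongrightarrow> 1 *\<^sub>R v"
    by (intro tendsto_scaleR assms(1) LIMSEQ_Suc LIMSEQ_root_const assms(2))
  then show ?thesis by (simp add: assms(3) blinfun.scaleR_left)
qed

section \<open>Inverses in an algebra with unit\<close>

text \<open>
  A unit is automatically self-adjoint: the adjoint \<open>f\<close> of \<open>e\<close> lies in the algebra, so \<open>f = e f\<close>, and
  \<open>e f\<close> is self-adjoint.
\<close>

lemma unit_projection:
  assumes A: "cstar_subalgebra A" and e: "is_unit_of A e"
  shows "is_projection e" "e \<in> A" "a \<in> A \<Longrightarrow> a (e u) = a u" "a \<in> A \<Longrightarrow> e (a u) = a u"
proof -
  show eA: "e \<in> A" using e by (simp add: is_unit_of_def)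
  have ea: "e o\<^sub>L a = a" "a o\<^sub>L e = a" if "a \<in> A" for a using e that by (simp_all add: is_unit_of_def)
  show "a \<in> A \<Longrightarrow> a (e u) = a u" "a \<in> A \<Longrightarrow> e (a u) = a u" for a u
    using ea by (metis blinfun_apply_blinfun_compose)+
  obtain f where f: "f \<in> A" "is_adjoint e f" using A eA unfolding cstar_subalgebra_def by blast
  have ef: "e (f u) = f u" for u using ea(1)[OF f(1)] by (metis blinfun_apply_blinfun_compose)
  have cl: "complex_linear f" and adj: "\<langle>e u, v\<rangle> = \<langle>u, f v\<rangle>" for u v using f(2) by (auto simp: is_adjoint_iff)
  have fsym: "\<langle>f u, v\<rangle> = \<langle>u, f v\<rangle>" for u v
  proof -
    have "\<langle>f u, f v\<rangle> = \<langle>f u, v\<rangle>" using adj[of "f u" v] ef by simp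
    moreover have "\<langle>f v, f u\<rangle> = \<langle>f v, u\<rangle>" using adj[of "f v" u] ef by simp
    ultimately show ?thesis using re_inner_commute by metis
  qed
  have "e = f"
  proof (rule blinfun_eqI, rule re_inner_ext)
    fix u v show "\<langle>e u, v\<rangle> = \<langle>f u, v\<rangle>" using adj fsym by simp
  qed
  then show "is_projection e"
    unfolding is_projection_def selfadjoint_iff using cl fsym ea(1)[OF eA] by simp
qed

lemma unit_unique: "is_unit_of A e \<Longrightarrow> is_unit_of A f \<Longrightarrow> e = f"
  unfolding is_unit_of_def by metis

lemma inverse_in_eqI:
  fixes a b e :: "'h::chilbert_space \<Rightarrow>\<^sub>L 'h"
  assumes e: "is_unit_of A e" and ab: "a \<in> A" "b \<in> A" "\<And>u. a (b u) = e u" "\<And>u. b (a u) = e u"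
  shows "inverse_in A a = b" "is_inverse_in A a b"
proof -
  have "a o\<^sub>L b = e" "b o\<^sub>L a = e" using ab by (auto intro: blinfun_eqI)
  then show inv: "is_inverse_in A a b" using e ab by (simp add: is_inverse_in_def)
  show "inverse_in A a = b" unfolding inverse_in_def
  proof (rule the_equality[where P = "is_inverse_in A a", OF inv])
    fix c assume c: "is_inverse_in A a c"
    then have "c o\<^sub>L a = e" "c \<in> A" using unit_unique[OF e] by (auto simp: is_inverse_in_def)
    have "c = c o\<^sub>L e" using e \<open>c \<in> A\<close> by (simp add: is_unit_of_def)
    also have "\<dots> = (c o\<^sub>L a) o\<^sub>L b" using ab(3) by (auto intro!: blinfun_eqI)
    also have "\<dots> = b" using e ab \<open>c o\<^sub>L a = e\<close> by (simp add: is_unit_of_def)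
    finally show "c = b" .
  qed
qed

text \<open>
  By Cauchy-Schwarz for the form of \<open>x\<close>, \<open>(norm (x u))\<^sup>2 \<le> norm x * \<langle>x u, u\<rangle>\<close>, and \<open>norm (e u)\<close> is at most
  \<open>norm b * norm (x u)\<close>.
\<close>

lemma left_invertible_bounded_below:
  fixes x b e :: "'h::chilbert_space \<Rightarrow>\<^sub>L 'h"
  assumes x: "positive_op x" and b: "\<And>u. blinfun_apply b (x u) = blinfun_apply e u"
  shows "\<exists>c>0. \<forall>u. c * (norm (e u))\<^sup>2 \<le> \<langle>x u, u\<rangle>"
proof -
  define K where "K = (norm b)\<^sup>2 * norm x + 1"
  have K: "0 < K" unfolding K_def by (intro add_nonneg_pos) auto
  have "(norm (e u))\<^sup>2 \<le> K * \<langle>x u, u\<rangle>" for u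
  proof -
    have pos: "0 \<le> \<langle>x u, u\<rangle>" using x by (simp add: positive_op_iff)
    have "((norm (x u))\<^sup>2)\<^sup>2 \<le> \<langle>x u, u\<rangle> * \<langle>x (x u), x u\<rangle>"
      using positive_Cauchy_Schwarz[OF x, of u "x u"] by (simp add: re_inner_self)
    also have "\<dots> \<le> \<langle>x u, u\<rangle> * (norm x * (norm (x u))\<^sup>2)"
      using form_le_norm(1)[of x "x u"] pos by (rule mult_left_mono)
    finally have *: "(norm (x u))\<^sup>2 * (norm (x u))\<^sup>2 \<le> (\<langle>x u, u\<rangle> * norm x) * (norm (x u))\<^sup>2"
      by (simp add: power2_eq_square mult.assoc)
    then have xu: "(norm (x u))\<^sup>2 \<le> \<langle>x u, u\<rangle> * norm x"
    proof (cases "norm (x u) = 0")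
      case False
      then have "0 < (norm (x u))\<^sup>2" by simp
      with * show ?thesis by (rule mult_right_le_imp_le)
    qed (use pos in simp)
    have "norm (e u) \<le> norm b * norm (x u)" using norm_blinfun[of b "x u"] b by simp
    then have "(norm (e u))\<^sup>2 \<le> (norm b * norm (x u))\<^sup>2" by (rule power_mono) simp
    also have "\<dots> \<le> (norm b)\<^sup>2 * (\<langle>x u, u\<rangle> * norm x)"
      unfolding power_mult_distrib using xu by (rule mult_left_mono) simp
    also have "\<dots> \<le> K * \<langle>x u, u\<rangle>" using pos by (simp add: K_def algebra_simps)
    finally show ?thesis .
  qed
  then have "1 / K * (norm (e u))\<^sup>2 \<le> \<langle>x u, u\<rangle>" for u using K by (simp add: field_simps)
  then show ?thesis using K by (intro exI[of _ "1 / K"]) simp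
qed

text \<open>
  Adding the complement of \<open>e\<close> makes \<open>x\<close> invertible on the whole space. The inverse is obtained from
  the function \<open>1/t\<close>; cutting polynomials in \<open>y\<close> down by \<open>e\<close> gives polynomials in \<open>x\<close>, which keeps the
  inverse in the algebra.
\<close>

lemma inverse_in_bounded_below:
  assumes A: "cstar_subalgebra A" and e: "is_unit_of A e" and x: "positive_op x" "x \<in> A"
    and c: "0 < c" "\<And>u. c * (norm (e u))\<^sup>2 \<le> \<langle>x u, u\<rangle>"
  shows "inverse_in A x \<in> A" "positive_op (inverse_in A x)"
    "x (inverse_in A x u) = e u" "inverse_in A x (x u) = e u"
proof -
  note E = unit_projection[OF A e]
  note P = projectionD[OF E(1)]
  define y where "y = x + (id_blinfun - e)"
  have ysa: "selfadjoint y"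
    unfolding y_def by (intro selfadjoint_add selfadjoint_diff positive_selfadjoint x P(1) selfadjoint_id)
  \<comment> \<open>\<open>c\<close> is a lower bound on the range of \<open>e\<close>, and 1 on its complement\<close>
  define k where "k = min c 1"
  have k: "0 < k" "k \<le> c" "k \<le> 1" using c by (auto simp: k_def)
  define M where "M = max (norm y) k + 1"
  have M: "form_between k M y"
    unfolding form_between_def
  proof (intro conjI allI ysa)
    show "k < M" by (simp add: M_def)
    fix u
    have "\<langle>y u, u\<rangle> = \<langle>x u, u\<rangle> + ((norm u)\<^sup>2 - (norm (e u))\<^sup>2)"
      by (simp add: y_def blinfun_simps re_inner_simps re_inner_self P(4))
    moreover have "k * (norm (e u))\<^sup>2 \<le> c * (norm (e u))\<^sup>2" using k by (intro mult_right_mono) auto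
    moreover have "(norm (e u))\<^sup>2 \<le> (norm u)\<^sup>2" using P(5) by (intro power_mono) auto
    then have "k * ((norm u)\<^sup>2 - (norm (e u))\<^sup>2) \<le> 1 * ((norm u)\<^sup>2 - (norm (e u))\<^sup>2)"
      using k by (intro mult_right_mono) auto
    ultimately show "k * (norm u)\<^sup>2 \<le> \<langle>y u, u\<rangle>" using c(2)[of u] by (simp add: right_diff_distrib)
    have "\<langle>y u, u\<rangle> \<le> norm y * (norm u)\<^sup>2" by (rule form_le_norm)
    also have "\<dots> \<le> M * (norm u)\<^sup>2" by (intro mult_right_mono) (auto simp: M_def)
    finally show "\<langle>y u, u\<rangle> \<le> M * (norm u)\<^sup>2" .
  qed
  have "continuous_on {k..M} (\<lambda>t. 1 / t)" using k by (intro continuous_intros) auto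
  then obtain v where v: "fun_calc k M y (\<lambda>t. 1 / t) v" using fun_calc_exists[OF M] by blast
  have "y o\<^sub>L v = 1 *\<^sub>R id_blinfun" "v o\<^sub>L y = 1 *\<^sub>R id_blinfun"
    by (rule fun_calc_eqI[OF M fun_calc_mult[OF fun_calc_id v] fun_calc_const],
        use k in simp)
      (rule fun_calc_eqI[OF M fun_calc_mult[OF v fun_calc_id] fun_calc_const], use k in simp)
  then have yv: "y (v u) = u" and vy: "v (y u) = u" for u
    by (metis blinfun_apply_blinfun_compose id_blinfun.rep_eq scaleR_one)+
  have ye: "y (e u) = x u" "e (y u) = x u" for u
    using E(3,4)[OF x(2)] P(3) by (simp_all add: y_def blinfun_simps)
  have ve: "v (e u) = e (v u)" for u by (rule fun_calc_commute[OF v]) (simp add: ye)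
  have vpos: "positive_op v" by (rule fun_calc_positive[OF M v]) (use k in simp)
  define w where "w = v o\<^sub>L e"
  have "w = e o\<^sub>L v o\<^sub>L e" unfolding w_def by (rule blinfun_eqI) (simp add: ve P(3))
  then have wpos: "positive_op w"
    using vpos selfadjoint_conj[OF positive_selfadjoint[OF vpos] P(1)] P(2)
    by (simp add: positive_op_iff)
  obtain p where p: "(\<lambda>n. poly_op (p n) y) \<longlonglongrightarrow> v" using v unfolding fun_calc_def by blast
  have pe: "poly_op q y (e u) = poly_op q x (e u)" for q u
  proof (induction q)
    case (pCons r q)
    have "e (poly_op q x (e u)) = poly_op q x (e u)"
      using poly_op_commute_apply[of x e q "e u"] E(3,4)[OF x(2)] P(3) by simp
    then have "y (poly_op q x (e u)) = x (poly_op q x (e u))" by (simp add: y_def blinfun_simps)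
    then show ?case using pCons by (simp add: blinfun_simps)
  qed simp
  have "poly_op q y o\<^sub>L e = poly_op q x o\<^sub>L e" for q by (rule blinfun_eqI) (simp add: pe)
  moreover have "poly_op q x o\<^sub>L e \<in> A" for q
    by (rule algebra_poly_op[OF A x(2) E(2)]) (use e x in \<open>simp add: is_unit_of_def\<close>)
  ultimately have "poly_op (p n) y o\<^sub>L e \<in> A" for n by simp
  moreover have "(\<lambda>n. poly_op (p n) y o\<^sub>L e) \<longlonglongrightarrow> w"
    unfolding w_def by (intro bounded_bilinear.tendsto[OF bounded_bilinear_blinfun_compose] p tendsto_const)
  ultimately have wA: "w \<in> A" by (rule closed_sequentially[OF algebra_closed[OF A]])
  have xw: "x (w u) = e u" for u
  proof -
    have "x (w u) = e (y (v (e u)))" by (simp only: w_def blinfun_apply_blinfun_compose ye)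
    then show ?thesis by (simp add: yv P(3))
  qed
  have wx: "w (x u) = e u" for u
  proof -
    have "w (x u) = v (y (e u))" using E(4)[OF x(2)] by (simp add: w_def ye)
    then show ?thesis by (simp add: vy)
  qed
  have "inverse_in A x = w" by (rule inverse_in_eqI(1)[OF e x(2) wA xw wx])
  then show "inverse_in A x \<in> A" "positive_op (inverse_in A x)"
    "x (inverse_in A x u) = e u" "inverse_in A x (x u) = e u"
    using wA wpos xw wx by simp_all
qed

lemma inverse_power:
  fixes a b e :: "'h::chilbert_space \<Rightarrow>\<^sub>L 'h"
  assumes A: "cstar_subalgebra A" and e: "is_unit_of A e" and ab: "a \<in> A" "b \<in> A" "\<And>u. a (b u) = e u"
  shows "op_power a (Suc n) (op_power b (Suc n) u) = e u"
proof -
  note E = unit_projection[OF A e]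
  have ee: "e (e u) = e u" for u by (rule projectionD(3)[OF E(1)])
  have eb: "e (op_power b n (e u)) = op_power b n (e u)" for n u
    using op_power_commute_apply[of b e n "e u"] E(3,4)[OF ab(2)] ee by simp
  have "op_power a n (op_power b n (e u)) = e u" for n
  proof (induction n)
    case (Suc n)
    have "op_power a (Suc n) (op_power b (Suc n) (e u)) = op_power a n (a (b (op_power b n (e u))))"
      using op_power_commute_apply[of a a n] by (simp add: op_power_Suc_apply)
    then show ?case using Suc by (simp add: ab(3) eb)
  qed simp
  moreover have "op_power b (Suc n) (e u) = op_power b (Suc n) u"
  proof -
    have "b (op_power b n w) = op_power b n (b w)" for w using op_power_commute_apply[of b b n w] by simp
    then show ?thesis by (simp only: op_power_Suc_apply E(3)[OF ab(2)])
  qed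
  ultimately show ?thesis by metis
qed

text \<open>
  With \<open>v = b' u\<close>, Cauchy-Schwarz for the form of \<open>a\<close> gives
  \<open>\<langle>v, u\<rangle>\<^sup>2 = \<langle>a v, a' u\<rangle>\<^sup>2 \<le> \<langle>a v, v\<rangle> * \<langle>a' u, u\<rangle> \<le> \<langle>b v, v\<rangle> * \<langle>a' u, u\<rangle> = \<langle>v, u\<rangle> * \<langle>a' u, u\<rangle>\<close>.
\<close>

lemma inverse_antitone:
  fixes a b a' b' e :: "'h::chilbert_space \<Rightarrow>\<^sub>L 'h"
  assumes e: "is_projection e" and a: "positive_op a" and b: "positive_op b"
    and a': "positive_op a'" "\<And>u. a (a' u) = e u" and b': "positive_op b'" "\<And>u. b (b' u) = e u"
    and ea: "\<And>u. e (a' u) = a' u" and eb: "\<And>u. e (b' u) = b' u"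
    and le: "\<And>u. \<langle>a u, u\<rangle> \<le> \<langle>b u, u\<rangle>"
  shows "\<langle>b' u, u\<rangle> \<le> \<langle>a' u, u\<rangle>"
proof -
  let ?v = "b' u"
  have t: "\<langle>?v, e u\<rangle> = \<langle>?v, u\<rangle>" using projectionD(2)[OF e, of ?v u] eb by simp
  have t1: "\<langle>?v, u\<rangle> = \<langle>b ?v, ?v\<rangle>" using t b'(2) by (simp add: re_inner_commute)
  have t2: "\<langle>?v, u\<rangle> = \<langle>a ?v, a' u\<rangle>"
    using t a'(2)[of u] selfadjointD[OF positive_selfadjoint[OF a], of ?v "a' u"] by simp
  have "\<langle>a (a' u), a' u\<rangle> = \<langle>a' u, u\<rangle>"
    using projectionD(2)[OF e, of u "a' u"] a'(2) ea by (simp add: re_inner_commute)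
  then have "\<langle>?v, u\<rangle>\<^sup>2 \<le> \<langle>a ?v, ?v\<rangle> * \<langle>a' u, u\<rangle>"
    using positive_Cauchy_Schwarz[OF a, of ?v "a' u"] t2 by simp
  also have "\<dots> \<le> \<langle>?v, u\<rangle> * \<langle>a' u, u\<rangle>"
    unfolding t1 using le a'(1) by (intro mult_right_mono) (auto simp: positive_op_iff)
  finally have *: "\<langle>?v, u\<rangle> * \<langle>?v, u\<rangle> \<le> \<langle>?v, u\<rangle> * \<langle>a' u, u\<rangle>" by (simp add: power2_eq_square)
  have pos: "0 \<le> \<langle>?v, u\<rangle>" "0 \<le> \<langle>a' u, u\<rangle>" using a' b' by (simp_all add: positive_op_iff)
  show ?thesis
  proof (cases "\<langle>?v, u\<rangle> = 0")
    case False
    then show ?thesis using * pos by simp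
  qed (use pos in simp)
qed

text \<open>
  \<open>b i - t = b i (s - y i) t\<close>.
\<close>

lemma inverse_tendsto:
  fixes y b :: "'i \<Rightarrow> ('h::chilbert_space \<Rightarrow>\<^sub>L 'h)" and s t e :: "'h \<Rightarrow>\<^sub>L 'h"
  assumes y: "\<And>u. ((\<lambda>i. blinfun_apply (y i) u) \<longlongrightarrow> s u) F"
    and b: "\<forall>\<^sub>F i in F. (\<forall>u. blinfun_apply (b i) (y i u) = e u) \<and> (\<forall>u. b i (e u) = b i u) \<and> norm (b i) \<le> C"
    and t: "\<And>u. s (t u) = e u" "\<And>u. e (t u) = t u"
  shows "((\<lambda>i. b i u) \<longlongrightarrow> t u) F"
proof -
  have "((\<lambda>i. b i u - t u) \<longlongrightarrow> 0) F"
  proof (rule Lim_null_comparison)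
    show "\<forall>\<^sub>F i in F. norm (b i u - t u) \<le> C * norm (s (t u) - y i (t u))"
      using b
    proof eventually_elim
      case (elim i)
      have "b i (s (t u) - y i (t u)) = b i u - t u"
        using elim t by (simp add: blinfun.diff_right)
      then have "norm (b i u - t u) \<le> norm (b i) * norm (s (t u) - y i (t u))"
        by (metis norm_blinfun)
      also have "\<dots> \<le> C * norm (s (t u) - y i (t u))" using elim by (intro mult_right_mono) auto
      finally show ?case .
    qed
    have "((\<lambda>i. C * norm (s (t u) - y i (t u))) \<longlongrightarrow> C * norm (s (t u) - s (t u))) F"
      by (intro tendsto_intros y)
    then show "((\<lambda>i. C * norm (s (t u) - y i (t u))) \<longlongrightarrow> 0) F" by simp
  qed
  then show ?thesis by (simp add: LIM_zero_iff)
qed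

section \<open>Inversion and the spectral order\<close>

locale unital_algebra =
  fixes A :: "('h::chilbert_space \<Rightarrow>\<^sub>L 'h) set" and e :: "'h \<Rightarrow>\<^sub>L 'h"
  assumes cstar: "cstar_subalgebra A" and unit: "is_unit_of A e"
begin

lemmas unit_facts = unit_projection[OF cstar unit]

text \<open>
  Positive elements that are inverse to each other relative to the unit of the algebra; on the
  complement of the unit both vanish.
\<close>

definition inverse_pair :: "('h \<Rightarrow>\<^sub>L 'h) \<Rightarrow> ('h \<Rightarrow>\<^sub>L 'h) \<Rightarrow> bool"
  where "inverse_pair x w \<longleftrightarrow> x \<in> A \<and> w \<in> A \<and> positive_op x \<and> positive_op w \<and>
    (\<forall>u. x (w u) = e u) \<and> (\<forall>u. w (x u) = e u)"

lemma inverse_pair_sym: "inverse_pair x w \<Longrightarrow> inverse_pair w x"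
  by (simp add: inverse_pair_def)

lemma inverse_pairD:
  assumes "inverse_pair x w"
  shows "x \<in> A" "w \<in> A" "positive_op x" "positive_op w" "x (w u) = e u" "w (x u) = e u"
  using assms by (auto simp: inverse_pair_def)

lemma inverse_in_pair: "inverse_pair x w \<Longrightarrow> inverse_in A x = w"
  by (rule inverse_in_eqI(1)[OF unit]) (auto simp: inverse_pair_def)

lemma left_inverse_pair:
  assumes x: "positive_op x" "x \<in> A" and b: "\<And>u. blinfun_apply b (x u) = e u"
  shows "inverse_pair x (inverse_in A x)"
proof -
  obtain c where "0 < c" "\<And>u. c * (norm (e u))\<^sup>2 \<le> \<langle>x u, u\<rangle>"
    using left_invertible_bounded_below[OF x(1) b] by blast
  from inverse_in_bounded_below[OF cstar unit x this] x show ?thesis by (simp add: inverse_pair_def)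
qed

lemma inverse_pair_ge:
  assumes z: "inverse_pair z b" and x: "positive_op x" "x \<in> A" and le: "\<And>u. \<langle>z u, u\<rangle> \<le> \<langle>x u, u\<rangle>"
  shows "inverse_pair x (inverse_in A x)"
proof -
  obtain c where c: "0 < c" "\<And>u. c * (norm (e u))\<^sup>2 \<le> \<langle>z u, u\<rangle>"
    using left_invertible_bounded_below[of z b e] inverse_pairD[OF z] by blast
  have "c * (norm (e u))\<^sup>2 \<le> \<langle>x u, u\<rangle>" for u using c(2) le order_trans by blast
  from inverse_in_bounded_below[OF cstar unit x c(1) this] x show ?thesis by (simp add: inverse_pair_def)
qed

lemma inverse_pair_antitone:
  assumes a: "inverse_pair a a'" and b: "inverse_pair b b'" and le: "\<And>u. \<langle>a u, u\<rangle> \<le> \<langle>b u, u\<rangle>"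
  shows "\<langle>b' u, u\<rangle> \<le> \<langle>a' u, u\<rangle>"
proof (rule inverse_antitone[OF unit_facts(1), of a b a' b'])
  show "e (a' u) = a' u" "e (b' u) = b' u" for u
    using unit_facts(4) inverse_pairD[OF a] inverse_pairD[OF b] by auto
qed (use inverse_pairD[OF a] inverse_pairD[OF b] le in auto)

lemma inverse_pair_power:
  assumes "inverse_pair x w" shows "inverse_pair (op_power x (Suc n)) (op_power w (Suc n))"
  unfolding inverse_pair_def
  using inverse_pairD[OF assms]
  by (intro conjI allI algebra_power[OF cstar] positive_power inverse_power[OF cstar unit]) auto

lemma powers_on_unit:
  assumes "x \<in> A" shows "e (op_power x (Suc n) u) = op_power x (Suc n) u"
  by (rule unit_facts(4)[OF algebra_power[OF cstar assms]])

text \<open>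
  On the complement of the unit \<open>x\<close> vanishes, so that \<open>E\<^sup>x\<^sub>m\<close> is the identity there.
\<close>

lemma spectral_complement_unit:
  assumes x: "positive_op x" "x \<in> A" and m: "0 < m" and v: "spec x m v = 0"
  shows "e v = v"
proof -
  note S = spectral_family_bounds[OF positive_selfadjoint[OF x(1)]]
  let ?u = "v - e v"
  have xu: "x ?u = 0" using unit_facts(3)[OF x(2)] by (simp add: blinfun.diff_right)
  have "m ^ 1 * (norm (?u - spec x m ?u))\<^sup>2 \<le> \<langle>op_power x 1 ?u, ?u\<rangle>"
    using m by (intro power_form_lower[OF S x(1)]) simp
  then have "m * (norm (?u - spec x m ?u))\<^sup>2 \<le> 0" using xu by (simp add: re_inner.zero_left)
  then have "spec x m ?u = ?u" using m by (simp add: mult_le_0_iff)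
  then have "\<langle>?u, v\<rangle> = 0" by (rule projection_orthogonal[OF spectral_boundsD(6)[OF S] _ v])
  moreover have "\<langle>?u, v\<rangle> = (norm ?u)\<^sup>2"
    using projectionD(4)[OF projection_complement[OF unit_facts(1)], of v] by (simp add: blinfun.diff_left)
  ultimately show ?thesis by simp
qed

text \<open>
  Let \<open>q\<close> be the complement of \<open>E\<^sup>x\<^sub>m\<close> and \<open>z = w\<^sup>n v\<close>. As \<open>m\<^sup>n q \<le> x\<^sup>n\<close>,
  \<open>\<langle>z, v\<rangle>\<^sup>2 = \<langle>q z, v\<rangle>\<^sup>2 \<le> m\<^sup>-\<^sup>n * \<langle>x\<^sup>n z, z\<rangle> * (norm v)\<^sup>2 = m\<^sup>-\<^sup>n * \<langle>z, v\<rangle> * (norm v)\<^sup>2\<close>, so the powers of \<open>w\<close>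
  grow on \<open>v\<close> at most like \<open>m\<^sup>-\<^sup>n\<close>.
\<close>

lemma spectral_complement_inverse:
  assumes xw: "inverse_pair x w" and m: "0 < m" and v: "spec x m v = 0"
  shows "spec w (1 / m) v = v"
proof -
  note D = inverse_pairD[OF xw]
  note S = spectral_family_bounds[OF positive_selfadjoint[OF D(3)]]
  note P = spectral_boundsD(6)[OF S]
  have "\<langle>op_power w n v, v\<rangle> \<le> (norm v)\<^sup>2 * (1 / m) ^ n" if n0: "0 < n" for n
  proof -
    obtain k where n: "n = Suc k" using gr0_implies_Suc[OF n0] by blast
    define z where "z = op_power w n v"
    let ?q = "z - spec x m z" and ?t = "\<langle>z, v\<rangle>"
    have t0: "0 \<le> ?t" using positive_power[OF D(4), of n] by (simp add: z_def positive_op_iff)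
    have "\<langle>?q, v\<rangle> = ?t"
      using projectionD(2)[OF P, of m z v] v by (simp add: re_inner.diff_left re_inner.zero_right)
    then have "?t \<le> norm ?q * norm v" using re_inner_Cauchy_Schwarz[of ?q v] by linarith
    then have "?t\<^sup>2 \<le> (norm ?q * norm v)\<^sup>2" using t0 by (intro power_mono)
    also have "\<dots> = (norm ?q)\<^sup>2 * (norm v)\<^sup>2" by (simp add: power_mult_distrib)
    finally have 1: "m ^ n * ?t\<^sup>2 \<le> (m ^ n * (norm ?q)\<^sup>2) * (norm v)\<^sup>2"
      using m by (simp add: mult.assoc)
    have "m ^ n * (norm ?q)\<^sup>2 \<le> \<langle>op_power x n z, z\<rangle>"
      using m by (intro power_form_lower[OF S D(3)]) simp
    also have "op_power x n z = e v"
      using inverse_pairD(5)[OF inverse_pair_power[OF xw]] by (simp add: z_def n)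
    also have "\<langle>e v, z\<rangle> = ?t"
      using projectionD(2)[OF unit_facts(1), of v z] powers_on_unit[OF D(2)]
      by (simp add: z_def n re_inner_commute)
    finally have "(m ^ n * (norm ?q)\<^sup>2) * (norm v)\<^sup>2 \<le> ?t * (norm v)\<^sup>2" by (rule mult_right_mono) simp
    with 1 have 2: "?t * (m ^ n * ?t) \<le> ?t * (norm v)\<^sup>2"
      by (simp add: power2_eq_square algebra_simps)
    have "m ^ n * ?t \<le> (norm v)\<^sup>2"
    proof (cases "?t = 0")
      case False
      then show ?thesis using 2 t0 by simp
    qed simp
    then show ?thesis using m by (simp add: z_def power_divide field_simps)
  qed
  then show ?thesis
    using m spectral_subspace_iff_growth[OF spectral_family_bounds[OF positive_selfadjoint[OF D(4)]] D(4), of "1 / m" v]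
    by auto
qed

text \<open>
  Insert \<open>t\<^sup>n s\<^sup>n\<close> between \<open>z\<close> and \<open>v\<close> and use Cauchy-Schwarz for the form of \<open>t\<^sup>n\<close>: the square of the
  inner product is at most a multiple of \<open>(l/m)\<^sup>n\<close>.
\<close>

lemma spectral_inverse_orthogonal:
  assumes st: "inverse_pair s t" and l: "0 \<le> l" "l < m"
    and v: "spec s (1 / m) v = v" "e v = v" and z: "spec t l z = z"
  shows "\<langle>z, v\<rangle> = 0"
proof -
  note D = inverse_pairD[OF st]
  note Ss = spectral_family_bounds[OF positive_selfadjoint[OF D(3)]]
  note St = spectral_family_bounds[OF positive_selfadjoint[OF D(4)]]
  have m: "0 < m" using l by simp
  let ?C = "(norm z)\<^sup>2 * (norm v)\<^sup>2"
  have "\<langle>z, v\<rangle>\<^sup>2 \<le> ?C * (l / m) ^ Suc n" for n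
  proof -
    let ?n = "Suc n"
    let ?a = "op_power t ?n" and ?w = "op_power s ?n v"
    have aw: "?a ?w = v"
      using inverse_pairD(6)[OF inverse_pair_power[OF st], of n v] v(2) by simp
    have "\<langle>z, v\<rangle> = \<langle>?a z, ?w\<rangle>"
      using selfadjointD[OF positive_selfadjoint[OF positive_power[OF D(4)]], of ?n z ?w] aw by simp
    then have "\<langle>z, v\<rangle>\<^sup>2 \<le> \<langle>?a z, z\<rangle> * \<langle>?a ?w, ?w\<rangle>"
      using positive_Cauchy_Schwarz[OF positive_power[OF D(4), of ?n], of z ?w] by simp
    also have "\<langle>?a ?w, ?w\<rangle> = \<langle>?w, v\<rangle>" unfolding aw by (rule re_inner_commute)
    also have "\<langle>?a z, z\<rangle> * \<langle>?w, v\<rangle> \<le> (l ^ ?n * (norm z)\<^sup>2) * ((1 / m) ^ ?n * (norm v)\<^sup>2)"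
    proof (rule mult_mono)
      show "\<langle>?a z, z\<rangle> \<le> l ^ ?n * (norm z)\<^sup>2" by (rule power_form_upper[OF St D(4) l(1) z])
      show "\<langle>?w, v\<rangle> \<le> (1 / m) ^ ?n * (norm v)\<^sup>2"
        using m by (intro power_form_upper[OF Ss D(3) _ v(1)]) simp
      show "0 \<le> \<langle>?w, v\<rangle>" using positive_power[OF D(3), of ?n] unfolding positive_op_iff by blast
    qed (use l in simp)
    also have "\<dots> = ?C * (l / m) ^ ?n" by (simp add: power_divide)
    finally show ?thesis .
  qed
  moreover have "(\<lambda>n. ?C * (l / m) ^ Suc n) \<longlonglongrightarrow> 0"
    using l m by (intro geometric_sqrt_tendsto_0) auto
  ultimately have "\<langle>z, v\<rangle>\<^sup>2 \<le> 0" by (intro LIMSEQ_le_const) auto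
  then show ?thesis by simp
qed

text \<open>
  A criterion for lower bounds: by \<open>spectral_inverse_orthogonal\<close> the complement of the spectral
  projection of \<open>y\<close> for \<open>m\<close> is orthogonal to the spectral subspaces of \<open>t\<close> below \<open>m\<close>. It has to cover lower
  bounds that are neither positive nor invertible.
\<close>

lemma spectral_le_inverse:
  assumes st: "inverse_pair s t" and y: "selfadjoint y"
    and compl: "\<And>m v. 0 < m \<Longrightarrow> spec y m v = 0 \<Longrightarrow> e v = v \<and> spec s (1 / m) v = v"
  shows "spectral_le y t"
proof -
  note D = inverse_pairD[OF st]
  note Sy = spectral_family_bounds[OF y]
  have "spec y l z = z" if z: "spec t l z = z" for l z
  proof (cases "0 \<le> l")
    case False
    then have "z = 0"
      using spectral_bounds_negative[OF spectral_family_bounds[OF positive_selfadjoint[OF D(4)]] D(4), of l] z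
      by simp
    then show ?thesis by (simp add: blinfun.zero_right)
  next
    case True
    show ?thesis
    proof (rule resolution_right[OF spectral_boundsD(2)[OF Sy]])
      fix m assume m: "l < m"
      let ?v = "z - spec y m z"
      have v: "spec y m ?v = 0"
        by (simp add: blinfun.diff_right projectionD(3)[OF spectral_boundsD(6)[OF Sy]])
      have "\<langle>z, ?v\<rangle> = 0"
        using compl[OF _ v] True m by (intro spectral_inverse_orthogonal[OF st True m _ _ z]) auto
      moreover have "\<langle>z, ?v\<rangle> = (norm ?v)\<^sup>2"
        using projectionD(4)[OF projection_complement[OF spectral_boundsD(6)[OF Sy]], of m z]
        by (simp add: blinfun.diff_left re_inner_commute)
      ultimately show "spec y m z = z" by simp
    qed
  qed
  then show ?thesis using spectral_le_iff[OF y positive_selfadjoint[OF D(4)]] by blast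
qed

lemma norm_le_of_form:
  fixes a b :: "'h \<Rightarrow>\<^sub>L 'h"
  assumes "positive_op a" "\<And>u. \<langle>a u, u\<rangle> \<le> \<langle>b u, u\<rangle>" shows "norm a \<le> norm b"
proof (rule norm_blinfun_bound)
  fix u
  show "norm (a u) \<le> norm b * norm u"
    by (rule positive_norm_bound[OF assms(1)]) (use assms(2) form_le_norm(1) order_trans in blast)
qed simp

lemma power_form_le_norm:
  assumes x: "positive_op x" shows "\<langle>op_power x n u, u\<rangle> \<le> norm x ^ n * (norm u)\<^sup>2"
proof -
  have sa: "selfadjoint x" by (rule positive_selfadjoint[OF x])
  have "spec x (norm x) u = u" using spec_top[OF sa form_le_norm(1)] by simp
  then show ?thesis by (intro power_form_upper[OF spectral_family_bounds[OF sa] x]) simp_all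
qed

text \<open>
  If \<open>y\<^sup>n\<^sup>+\<^sup>1 = a\<close> then \<open>a' y\<^sup>n\<close> is a left inverse of \<open>y\<close>, which suffices for positive \<open>y\<close>.
\<close>

lemma root_of_inverse:
  fixes n :: nat
  assumes a: "inverse_pair a a'"
  defines "y \<equiv> op_root (Suc n) a"
  shows "inverse_pair y (inverse_in A y)" "op_root (Suc n) a' = inverse_in A y"
    "op_power (inverse_in A y) (Suc n) = a'"
proof -
  note D = inverse_pairD[OF a]
  have y: "positive_op y" "op_power y (Suc n) = a" "y \<in> A"
    using op_root[OF D(3), of "Suc n"] algebra_op_root[OF cstar D(3,1), of "Suc n"] by (simp_all add: y_def)
  have "(a' o\<^sub>L op_power y n) (y u) = e u" for u
    using op_power_commute_apply[of y y n u] y(2) D(6)[of u] by (simp add: op_power_Suc_apply flip: y(2))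
  then show pair: "inverse_pair y (inverse_in A y)" by (rule left_inverse_pair[OF y(1,3)])
  have "inverse_in A (op_power y (Suc n)) = op_power (inverse_in A y) (Suc n)"
    by (rule inverse_in_pair[OF inverse_pair_power[OF pair]])
  then show "op_power (inverse_in A y) (Suc n) = a'"
    unfolding y(2) inverse_in_pair[OF a] by simp
  then show "op_root (Suc n) a' = inverse_in A y"
    using inverse_pairD(4)[OF pair] by (intro op_root_unique) auto
qed

lemma inverse_pair_scaleR:
  assumes "inverse_pair a a'" "0 < c" shows "inverse_pair (c *\<^sub>R a) ((1 / c) *\<^sub>R a')"
  using inverse_pairD[OF assms(1)] assms(2)
  by (auto simp: inverse_pair_def blinfun_simps intro!: positive_scaleR algebra_scaleR[OF cstar])

end

section \<open>Suprema and infima as limits\<close>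

lemma sum_scaled: "(\<Sum>x\<in>F. f x /\<^sub>R c) = (1 / c) *\<^sub>R (\<Sum>x\<in>F. f x :: 'a::real_vector)"
  by (simp add: scaleR_sum_right divide_inverse)

lemma spectral_supremum_limit:
  fixes A X :: "('h::chilbert_space \<Rightarrow>\<^sub>L 'h) set"
  assumes A: "von_neumann_algebra A" and XA: "X \<subseteq> sa_part A" and X: "X \<noteq> {}"
    and pos: "\<forall>x\<in>X. positive_op x" and up: "Upper (spectral_poset A) X \<noteq> {}"
  shows "\<exists>s. least (spectral_poset A) s (Upper (spectral_poset A) X) \<and>
        iterated_slim X (\<lambda>F n. op_root n (\<Sum>x\<in>F. op_power x n)) s \<and>
        iterated_slim X (\<lambda>F n. op_root n (\<Sum>x\<in>F. op_power x n /\<^sub>R real (card F))) s"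
proof -
  have carrier: "carrier (spectral_poset A) = sa_part A" and le: "le (spectral_poset A) = spectral_le"
    by (simp_all add: spectral_poset_def)
  have inA: "x \<in> A" "selfadjoint x" if "x \<in> X" for x using that XA by (auto simp: sa_part_def)
  have Upper: "u \<in> Upper (spectral_poset A) X \<longleftrightarrow> u \<in> sa_part A \<and> (\<forall>x\<in>X. spectral_le x u)" for u
    using XA by (auto simp: Upper_def carrier le)
  obtain b where b: "b \<in> sa_part A" "\<forall>x\<in>X. spectral_le x b" using up Upper by blast
  have bound: "norm x \<le> norm b" if "x \<in> X" for x
  proof (rule norm_blinfun_bound)
    show "norm (x u) \<le> norm b * norm u" for u
    proof (rule positive_norm_bound)
      show "positive_op x" using pos that by blast
      have "\<langle>x u, u\<rangle> \<le> \<langle>b u, u\<rangle>" for u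
        using b that inA by (intro spectral_le_form) (auto simp: sa_part_def)
      then show "\<langle>x u, u\<rangle> \<le> norm b * (norm u)\<^sup>2" for u using form_le_norm(1) order_trans by blast
    qed
  qed simp
  have "positive_op (x) \<and> x \<in> A \<and> norm (x) \<le> norm b" if "x \<in> X" for x
    using pos inA[OF that] bound[OF that] that by blast
  then have "\<exists>s g. spectral_join (\<lambda>x. x) X s \<and> positive_op s \<and> s \<in> A \<and>
    (\<forall>F. finite F \<and> F \<noteq> {} \<and> F \<subseteq> X \<longrightarrow> spectral_join (\<lambda>x. x) F (g F) \<and> positive_op (g F) \<and> g F \<in> A) \<and>
    (\<forall>u. ((\<lambda>F. g F u) \<longlongrightarrow> s u) (finite_subsets_at_top X))" (is "\<exists>s g. ?P s g")
    by (rule bounded_family_join[OF A X, where x = "\<lambda>x. x" and B = "norm b"])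
  then obtain s g where sg: "?P s g" by blast
  then have s: "spectral_join (\<lambda>x. x) X s" "s \<in> A"
    and lim: "((\<lambda>F. g F u) \<longlongrightarrow> s u) (finite_subsets_at_top X)" for u by auto
  have g: "spectral_join (\<lambda>x. x) F (g F)" if "finite F" "F \<noteq> {}" "F \<subseteq> X" for F using sg that by blast
  have ssa: "selfadjoint s" using s by (simp add: spectral_join_def)
  have "s \<in> Upper (spectral_poset A) X"
    unfolding Upper using s ssa inA by (auto simp: sa_part_def spectral_le_iff spectral_join_def)
  moreover have "spectral_le s u" if "u \<in> Upper (spectral_poset A) X" for u
    using that s ssa inA unfolding Upper by (auto simp: sa_part_def spectral_le_iff spectral_join_def)
  ultimately have "least (spectral_poset A) s (Upper (spectral_poset A) X)"
    unfolding least_def by (auto simp: Upper carrier le)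
  moreover have inner: "(\<lambda>n. op_root (Suc n) (\<Sum>x\<in>F. op_power x (Suc n)) u) \<longlonglongrightarrow> g F u"
    if "finite F" "F \<noteq> {}" "F \<subseteq> X" for F u
    using root_of_power_sum_tendsto[OF that(1,2) _ g[OF that]] that pos by blast
  then have "iterated_slim X (\<lambda>F n. op_root n (\<Sum>x\<in>F. op_power x n)) s"
    using lim by (intro iterated_slimI[of X _ g]) auto
  moreover have "iterated_slim X (\<lambda>F n. op_root n (\<Sum>x\<in>F. op_power x n /\<^sub>R real (card F))) s"
  proof (rule iterated_slimI[of X _ g, OF _ lim])
    fix F u assume F: "finite F" "F \<noteq> {}" "F \<subseteq> X"
    have c: "0 < 1 / real (card F)" using F by (simp add: card_gt_0_iff)
    have "positive_op (\<Sum>x\<in>F. op_power x n)" for n using pos F by (intro positive_sum positive_power) auto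
    then have "op_root (Suc n) (\<Sum>x\<in>F. op_power x (Suc n) /\<^sub>R real (card F)) =
        root (Suc n) (1 / real (card F)) *\<^sub>R op_root (Suc n) (\<Sum>x\<in>F. op_power x (Suc n))" for n
      unfolding sum_scaled using c by (intro op_root_scaleR) auto
    then show "(\<lambda>n. op_root (Suc n) (\<Sum>x\<in>F. op_power x (Suc n) /\<^sub>R real (card F)) u) \<longlonglongrightarrow> g F u"
      by (rule root_scaled_tendsto[OF inner[OF F] c])
  qed
  ultimately show ?thesis by blast
qed

text \<open>
  The supremum \<open>s\<close> of the inverses \<open>w x\<close> is formed by \<open>bounded_family_join\<close>, and its inverse \<open>t\<close> is the
  infimum. The roots in question are inverses of the roots \<open>y F n\<close> that converge to the suprema of
  finite families. Each inverse is bounded by the norm of some \<open>x\<close> in the family because inversion is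
  antitone, which gives the uniform bounds needed to invert the limits.
\<close>

lemma spectral_infimum_limit:
  fixes A X :: "('h::chilbert_space \<Rightarrow>\<^sub>L 'h) set"
  assumes A: "von_neumann_algebra A" and XA: "X \<subseteq> sa_part A" and X: "X \<noteq> {}"
    and pos: "\<forall>x\<in>X. positive_op x"
    and z: "z \<in> Lower (spectral_poset A) X" "positive_op z" "invertible_in A z"
  shows "\<exists>s. greatest (spectral_poset A) s (Lower (spectral_poset A) X) \<and>
        iterated_slim X
          (\<lambda>F n. op_root n (inverse_in A (\<Sum>x\<in>F. op_power (inverse_in A x) n))) s \<and>
        iterated_slim X
          (\<lambda>F n. op_root n (inverse_in A
             (\<Sum>x\<in>F. op_power (inverse_in A x) n /\<^sub>R real (card F)))) s"
proof -
  have C: "cstar_subalgebra A" using A by (simp add: von_neumann_algebra_def)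
  obtain b where b: "is_inverse_in A z b" using z by (auto simp: invertible_in_def)
  define e where "e = b o\<^sub>L z"
  have unit: "is_unit_of A e" using b by (simp add: is_inverse_in_def e_def)
  interpret unital_algebra A e by unfold_locales (rule C, rule unit)
  have carrier: "carrier (spectral_poset A) = sa_part A" and le: "le (spectral_poset A) = spectral_le"
    by (simp_all add: spectral_poset_def)
  have inA: "x \<in> A" "selfadjoint x" if "x \<in> X" for x using that XA by (auto simp: sa_part_def)
  have Lower: "u \<in> Lower (spectral_poset A) X \<longleftrightarrow> u \<in> sa_part A \<and> (\<forall>x\<in>X. spectral_le u x)" for u
    using XA by (auto simp: Lower_def carrier le)
  have zA: "z \<in> A" "selfadjoint z" and zx: "\<And>x. x \<in> X \<Longrightarrow> spectral_le z x"
    using z Lower by (auto simp: sa_part_def)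
  define z' where "z' = inverse_in A z"
  have zz': "inverse_pair z z'"
    unfolding z'_def by (rule left_inverse_pair[OF z(2) zA(1), of b]) (simp add: e_def)
  define w where "w x = inverse_in A x" for x
  have zle: "\<langle>z u, u\<rangle> \<le> \<langle>x u, u\<rangle>" if "x \<in> X" for x u
    by (rule spectral_le_form[OF zA(2) inA(2)[OF that] zx[OF that]])
  have xw: "inverse_pair x (w x)" if "x \<in> X" for x
    unfolding w_def using that pos inA zle by (intro inverse_pair_ge[OF zz']) auto
  have wB: "norm (w x) \<le> norm z'" if "x \<in> X" for x
    using inverse_pairD(4)[OF xw[OF that]] inverse_pair_antitone[OF zz' xw[OF that] zle[OF that]]
    by (rule norm_le_of_form)
  have "positive_op (w x) \<and> w x \<in> A \<and> norm (w x) \<le> norm z'" if "x \<in> X" for x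
    using inverse_pairD[OF xw[OF that]] wB[OF that] by blast
  then have "\<exists>s g. spectral_join w X s \<and> positive_op s \<and> s \<in> A \<and>
    (\<forall>F. finite F \<and> F \<noteq> {} \<and> F \<subseteq> X \<longrightarrow> spectral_join w F (g F) \<and> positive_op (g F) \<and> g F \<in> A) \<and>
    (\<forall>u. ((\<lambda>F. g F u) \<longlongrightarrow> s u) (finite_subsets_at_top X))" (is "\<exists>s g. ?P s g")
    by (rule bounded_family_join[OF A X, where x = "w" and B = "norm z'"])
  then obtain s g where sg: "?P s g" by blast
  then have s: "spectral_join w X s" "positive_op s" "s \<in> A"
    and lim: "((\<lambda>F. g F u) \<longlongrightarrow> s u) (finite_subsets_at_top X)" for u by auto
  have g: "spectral_join w F (g F) \<and> positive_op (g F) \<and> g F \<in> A"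
    if "finite F" "F \<noteq> {}" "F \<subseteq> X" for F using sg that by blast
  have join_le: "\<langle>w x u, u\<rangle> \<le> \<langle>j u, u\<rangle>" if "spectral_join w I j" "x \<in> I" "x \<in> X" for I j x u
  proof (rule spectral_le_form)
    show "selfadjoint (w x)" by (rule positive_selfadjoint[OF inverse_pairD(4)[OF xw[OF that(3)]]])
    then show "selfadjoint j" "spectral_le (w x) j"
      using that by (auto simp: spectral_join_def spectral_le_iff)
  qed
  have gpair: "inverse_pair (g F) (inverse_in A (g F))"
    and gnorm: "x \<in> F \<Longrightarrow> norm (inverse_in A (g F)) \<le> norm x" if F: "finite F" "F \<noteq> {}" "F \<subseteq> X" for F x
  proof -
    have le: "\<langle>w x u, u\<rangle> \<le> \<langle>g F u, u\<rangle>" if "x \<in> F" for x u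
      using join_le g[OF F] that F by blast
    obtain y where y: "y \<in> F" using F by blast
    show pair: "inverse_pair (g F) (inverse_in A (g F))"
      using g[OF F] by (intro inverse_pair_ge[OF inverse_pair_sym[OF xw] _ _ le[OF y]]) (use F y in auto)
    show "norm (inverse_in A (g F)) \<le> norm x" if x: "x \<in> F"
    proof (rule norm_le_of_form[OF inverse_pairD(4)[OF pair]])
      have "x \<in> X" using x F by blast
      then show "\<langle>inverse_in A (g F) u, u\<rangle> \<le> \<langle>x u, u\<rangle>" for u
        by (intro inverse_pair_antitone[OF inverse_pair_sym[OF xw] pair le[OF x]])
    qed
  qed
  obtain x0 where x0: "x0 \<in> X" using X by blast
  define t where "t = inverse_in A s"
  have st: "inverse_pair s t"
    unfolding t_def
    by (rule inverse_pair_ge[OF inverse_pair_sym[OF xw[OF x0]] s(2,3) join_le[OF s(1) x0 x0]])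
  have tsa: "selfadjoint t" by (rule positive_selfadjoint[OF inverse_pairD(4)[OF st]])
  have t_lower: "spectral_le t x" if x: "x \<in> X" for x
  proof (rule spectral_le_inverse[OF inverse_pair_sym[OF xw[OF x]] tsa])
    fix m v assume m: "0 < m" and v: "spec t m v = 0"
    have "spec s (1 / m) v = v" by (rule spectral_complement_inverse[OF inverse_pair_sym[OF st] m v])
    then have "spec (w x) (1 / m) v = v" using s(1) x by (simp add: spectral_join_def)
    moreover have "e v = v" using spectral_complement_unit[OF _ _ m v] inverse_pairD[OF st] by blast
    ultimately show "e v = v \<and> spec (w x) (1 / m) v = v" by blast
  qed
  have t_greatest: "spectral_le y t" if y: "y \<in> Lower (spectral_poset A) X" for y
  proof -
    have ysa: "selfadjoint y" and yx: "\<And>x. x \<in> X \<Longrightarrow> spectral_le y x"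
      using y Lower by (auto simp: sa_part_def)
    note Sy = spectral_family_bounds[OF ysa]
    show ?thesis
    proof (rule spectral_le_inverse[OF st ysa])
      fix m v assume m: "0 < m" and v: "spec y m v = 0"
      have xv: "spec x m v = 0" if x: "x \<in> X" for x
      proof -
        note Px = spectral_boundsD(6)[OF spectral_family_bounds[OF inA(2)[OF x]], of m]
        let ?u = "spec x m v"
        have "spec x m ?u = ?u" by (rule projectionD(3)[OF Px])
        then have "spec y m ?u = ?u" using yx[OF x] spectral_le_iff[OF ysa inA(2)[OF x]] by blast
        then have "\<langle>?u, v\<rangle> = 0" by (rule projection_orthogonal[OF spectral_boundsD(6)[OF Sy] _ v])
        then show ?thesis using projectionD(4)[OF Px, of v] by simp
      qed
      have "spec s (1 / m) v = v"
        using s(1) spectral_complement_inverse[OF xw m xv] by (simp add: spectral_join_def)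
      moreover have "e v = v"
        using spectral_complement_unit[OF _ _ m xv[OF x0]] inverse_pairD[OF xw[OF x0]] by blast
      ultimately show "e v = v \<and> spec s (1 / m) v = v" by blast
    qed
  qed
  have "t \<in> Lower (spectral_poset A) X"
    unfolding Lower using t_lower tsa inverse_pairD(2)[OF st] by (simp add: sa_part_def)
  then have greatest: "greatest (spectral_poset A) t (Lower (spectral_poset A) X)"
    unfolding greatest_def using t_greatest by (auto simp: Lower carrier le)
  have unit_right: "a (e u) = a u" if "inverse_pair a' a" for a a' u
    by (rule unit_facts(3)[OF inverse_pairD(2)[OF that]])
  have et: "e (t u) = t u" for u by (rule unit_facts(4)[OF inverse_pairD(2)[OF st]])
  have outer: "((\<lambda>F. inverse_in A (g F) u) \<longlongrightarrow> t u) (finite_subsets_at_top X)" for u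
  proof (rule inverse_tendsto[of g s _ _ e "norm x0" t, OF lim _ inverse_pairD(5)[OF st] et])
    show "\<forall>\<^sub>F F in finite_subsets_at_top X. (\<forall>u. inverse_in A (g F) (g F u) = e u) \<and>
        (\<forall>u. inverse_in A (g F) (e u) = inverse_in A (g F) u) \<and> norm (inverse_in A (g F)) \<le> norm x0"
      using eventually_finite_subset[OF x0]
    proof eventually_elim
      case (elim F)
      then have F: "finite F" "F \<noteq> {}" "F \<subseteq> X" "x0 \<in> F" by auto
      then show ?case
        using inverse_pairD(6)[OF gpair[OF F(1-3)]] unit_right[OF gpair[OF F(1-3)]] gnorm[OF F] by simp
    qed
  qed
  define a where "a F n = (\<Sum>x\<in>F. op_power (w x) (Suc n))" for F n
  define y where "y F n = op_root (Suc n) (a F n)" for F n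
  define v where "v F n = inverse_in A (y F n)" for F n
  have apair: "inverse_pair (a F n) (inverse_in A (a F n))"
    and ale: "x \<in> F \<Longrightarrow> \<langle>op_power (w x) (Suc n) u, u\<rangle> \<le> \<langle>a F n u, u\<rangle>"
    if F: "finite F" "F \<noteq> {}" "F \<subseteq> X" for F n x u
  proof -
    have wF: "w x \<in> A" "positive_op (w x)" if "x \<in> F" for x
    proof -
      have "x \<in> X" using that F by blast
      then show "w x \<in> A" "positive_op (w x)" using inverse_pairD[OF xw] by auto
    qed
    show le: "\<langle>op_power (w x) (Suc n) u, u\<rangle> \<le> \<langle>a F n u, u\<rangle>" if "x \<in> F" for x u
      unfolding a_def blinfun.sum_left re_inner.sum_left
      using positive_power[OF wF(2)] F(1) that by (intro member_le_sum) (auto simp: positive_op_iff)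
    obtain x where x: "x \<in> F" using F by blast
    have "x \<in> X" using x F by blast
    then show "inverse_pair (a F n) (inverse_in A (a F n))"
    proof (intro inverse_pair_ge[OF inverse_pair_power[OF inverse_pair_sym[OF xw]] _ _ le[OF x]])
      show "positive_op (a F n)" unfolding a_def using wF by (intro positive_sum positive_power)
      show "a F n \<in> A" unfolding a_def using wF by (intro algebra_sum[OF C] algebra_power[OF C])
    qed
  qed
  have root: "op_root (Suc n) (inverse_in A (a F n)) = v F n"
    and ypair: "inverse_pair (y F n) (v F n)" and vpow: "op_power (v F n) (Suc n) = inverse_in A (a F n)"
    if F: "finite F" "F \<noteq> {}" "F \<subseteq> X" for F n
    using root_of_inverse[OF apair[OF F], of n] by (simp_all add: y_def v_def)
  have inner: "(\<lambda>n. v F n u) \<longlonglongrightarrow> inverse_in A (g F) u" if F: "finite F" "F \<noteq> {}" "F \<subseteq> X" for F u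
  proof -
    obtain x where x: "x \<in> F" "x \<in> X" using F by blast
    have ylim: "(\<lambda>n. y F n u) \<longlonglongrightarrow> g F u" for u
      unfolding y_def a_def
      using g[OF F] inverse_pairD(4)[OF xw] F by (intro root_of_power_sum_tendsto) auto
    have vnorm: "norm (v F n) \<le> norm x" for n
    proof (rule positive_norm_if_power_bound[OF inverse_pairD(4)[OF ypair[OF F]], of _ "Suc n"])
      fix u
      have "\<langle>inverse_in A (a F n) u, u\<rangle> \<le> \<langle>op_power x (Suc n) u, u\<rangle>"
        by (rule inverse_pair_antitone[OF inverse_pair_power[OF inverse_pair_sym[OF xw[OF x(2)]]]
              apair[OF F] ale[OF F x(1)]])
      also have "\<dots> \<le> norm x ^ Suc n * (norm u)\<^sup>2" using pos x by (intro power_form_le_norm) simp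
      finally show "\<langle>op_power (v F n) (Suc n) u, u\<rangle> \<le> norm x ^ Suc n * (norm u)\<^sup>2"
        unfolding vpow[OF F] .
    qed simp_all
    show ?thesis
    proof (rule inverse_tendsto[of "y F" "g F" _ _ e "norm x", OF ylim])
      show "\<forall>\<^sub>F n in sequentially. (\<forall>u. v F n (y F n u) = e u) \<and> (\<forall>u. v F n (e u) = v F n u) \<and>
          norm (v F n) \<le> norm x"
        using inverse_pairD(6)[OF ypair[OF F]] unit_right[OF ypair[OF F]] vnorm by simp
      show "g F (inverse_in A (g F) u) = e u" for u by (rule inverse_pairD(5)[OF gpair[OF F]])
      show "e (inverse_in A (g F) u) = inverse_in A (g F) u" for u
        by (rule unit_facts(4)[OF inverse_pairD(2)[OF gpair[OF F]]])
    qed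
  qed
  have "iterated_slim X (\<lambda>F n. op_root n (inverse_in A (\<Sum>x\<in>F. op_power (inverse_in A x) n))) t"
  proof (rule iterated_slimI[of X _ "\<lambda>F. inverse_in A (g F)", OF _ outer])
    fix F u assume F: "finite F" "F \<noteq> {}" "F \<subseteq> X"
    show "(\<lambda>n. op_root (Suc n) (inverse_in A (\<Sum>x\<in>F. op_power (inverse_in A x) (Suc n))) u)
        \<longlonglongrightarrow> inverse_in A (g F) u"
      using inner[OF F, of u] unfolding root[OF F, symmetric] a_def w_def .
  qed
  moreover have "iterated_slim X (\<lambda>F n. op_root n (inverse_in A
      (\<Sum>x\<in>F. op_power (inverse_in A x) n /\<^sub>R real (card F)))) t"
  proof (rule iterated_slimI[of X _ "\<lambda>F. inverse_in A (g F)", OF _ outer])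
    fix F u assume F: "finite F" "F \<noteq> {}" "F \<subseteq> X"
    let ?c = "real (card F)"
    have c: "0 < ?c" using F by (simp add: card_gt_0_iff)
    have "op_root (Suc n) (inverse_in A (\<Sum>x\<in>F. op_power (inverse_in A x) (Suc n) /\<^sub>R ?c))
        = root (Suc n) ?c *\<^sub>R v F n" for n
    proof -
      have "inverse_in A ((1 / ?c) *\<^sub>R a F n) = (1 / (1 / ?c)) *\<^sub>R inverse_in A (a F n)"
        using c by (intro inverse_in_pair inverse_pair_scaleR apair[OF F]) simp
      then have "inverse_in A (\<Sum>x\<in>F. op_power (inverse_in A x) (Suc n) /\<^sub>R ?c) = ?c *\<^sub>R inverse_in A (a F n)"
        by (simp add: sum_scaled a_def w_def)
      moreover have "op_root (Suc n) (?c *\<^sub>R inverse_in A (a F n)) = root (Suc n) ?c *\<^sub>R v F n"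
        unfolding root[OF F, symmetric]
        using inverse_pairD(4)[OF apair[OF F]] c by (intro op_root_scaleR) auto
      ultimately show ?thesis by simp
    qed
    then show "(\<lambda>n. op_root (Suc n) (inverse_in A (\<Sum>x\<in>F. op_power (inverse_in A x) (Suc n) /\<^sub>R ?c)) u)
        \<longlonglongrightarrow> inverse_in A (g F) u"
      by (rule root_scaled_tendsto[OF inner[OF F] c])
  qed
  ultimately show ?thesis using greatest by blast
qed

theorem mainTheorem4:
  fixes A X :: "('h::chilbert_space \<Rightarrow>\<^sub>L 'h) set"
  assumes "von_neumann_algebra A"
    and "X \<subseteq> sa_part A"
    and "X \<noteq> {}"
    and "\<forall>x\<in>X. positive_op x"
    and "Upper (spectral_poset A) X \<noteq> {}"
    and "Lower (spectral_poset A) X \<noteq> {}"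
  shows
    "(\<exists>s. least (spectral_poset A) s (Upper (spectral_poset A) X) \<and>
        iterated_slim X (\<lambda>F n. op_root n (\<Sum>x\<in>F. op_power x n)) s \<and>
        iterated_slim X (\<lambda>F n. op_root n (\<Sum>x\<in>F. op_power x n /\<^sub>R real (card F))) s) \<and>
     ((\<exists>z \<in> Lower (spectral_poset A) X. positive_op z \<and> invertible_in A z) \<longrightarrow>
      (\<exists>s. greatest (spectral_poset A) s (Lower (spectral_poset A) X) \<and>
        iterated_slim X
          (\<lambda>F n. op_root n (inverse_in A (\<Sum>x\<in>F. op_power (inverse_in A x) n))) s \<and>
        iterated_slim X
          (\<lambda>F n. op_root n (inverse_in A
             (\<Sum>x\<in>F. op_power (inverse_in A x) n /\<^sub>R real (card F)))) s))"
  using spectral_supremum_limit[OF assms(1-5)] spectral_infimum_limit[OF assms(1-4)] by blast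

end
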